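(* Let $(\alpha,r)\in\,]1,+\infty[\,\times\mathbb{N}^*$ with $\alpha$ $S^+$-admissible. The set of biholomorphism classes of type II Inoue surfaces associated with $(\alpha,r)$ (i.e. of the surfaces $S^{\alpha,r}_{a,b,c,t}$ with $(a,b,c,t)\in\mathcal{A}_{\alpha,r}$) is naturally identified, via $S^{\alpha,r}_{a,b,c,t}\mapsto$ the orbit of $(a,b,[c]_{ab},[t]_{ab})$, with the quotient space $$\mathscr{Q}_{\alpha,r}:=\mathscr{A}_{\alpha,r}\big/\big((\mathbb{R}^*_+\times\mathbb{R}^* )\times(\mathrm{GL}(2,\mathbb{Z})\ltimes_\psi\mathbb{Z}_d^2)\big).$$
   Context: $\mathbb{N}^*=\{1,2,\dots\}$; $H$ is the upper half-plane, $U=H\times\mathbb{C}$ with coordinates $(w,z)$. For $x,y\in\mathbb{R}^2$, $x\wedge y=x_1y_2-x_2y_1$. Elements of $\mathbb{R}^2$ are columns; $k=(k_1,k_2)\in\mathbb{Z}^2$ is treated as a row, so $ka=k_1a_1+k_2a_2$. $\alpha$ is $S^+$-admissible if $\alpha=\frac{\theta+\sqrt{\theta^2-4}}{2}$ with $\theta\in\mathbb{Z}$, $\theta\ge3$. Put $d=\theta-2$ and $\mathbb{Z}_d=\mathbb{Z}/d\mathbb{Z}$. $\mathcal{P}_\alpha$ is the set of linearly independent pairs $(a,b)\in\mathbb{R}^2\times\mathbb{R}^2$ that are $\alpha$-compatible, i.e. such that $N=(n_{ij})=N(\alpha,a,b):=Q\,\mathrm{diag}(\alpha,\alpha^{-1})Q^{-1}\in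 M_2(\mathbb{Z})$, $Q$ being the matrix with columns $a,b$. For $(a,b)\in\mathcal{P}_\alpha$ and $r\in\mathbb{N}^*$, $\mathcal{C}_{a,b,r}$ is the set of $c\in\mathbb{R}^2$ with $$(I_2-N)\Big(c-\tfrac12\begin{pmatrix}a_1b_1\\ a_2b_2\end{pmatrix}\Big)-\tfrac{b\wedge a}{2}\begin{pmatrix}n_{11}n_{12}\\ n_{21}n_{22}\end{pmatrix}\in\tfrac{b\wedge a}{r}\mathbb{Z}^2.$$ $\mathcal{T}_{\alpha,r}$ is the set of triples $(a,b,c)$ with $(a,b)\in\mathcal{P}_\alpha$, $c\in\mathcal{C}_{a,b,r}$, and $\mathcal{A}_{\alpha,r}=\mathcal{T}_{\alpha,r}\times\mathbb{C}$. For $(a,b,c,t)\in\mathcal{A}_{\alpha,r}$, $G(\alpha,a,b,c,r,t)$ is the group of affine transformations of $U$ generated by $g_0:(w,z)\mapsto(\alpha w,z+t)$, $g_i:(w,z)\mapsto(w+a_i,z+b_iw+c_i)$ ($i=1,2$), $g_3:(w,z)\mapsto(w,z+\frac{b\wedge a}{r})$; it acts properly discontinuously on $U$, and $S^{\alpha,r}_{a,b,c,t}=U/G(\alpha,a,b,c,r,t)$ is the corresponding type II Inoue surface. Put $[c]_{ab}=c+\frac{b\wedge a}{r}\mathbb{Z}^2$, $[t]_{ab}=t+\frac{b\wedge a}{r}\mathbb{Z}$, and let $\mathscr{A}_{\alpha,r}$ be the set of all $(a,b,[c]_{ab},[t]_{ab})$ with $(a,b,c,t)\in\mathcal{A}_{\alpha,r}$.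 Actions on $\mathscr{A}_{\alpha,r}$ (all well defined): (i) $K=(k_{ij})\in\mathrm{GL}(2,\mathbb{Z})$ acts by $K\cdot(a,b,[c]_{ab},[t]_{ab})=(A,B,[C]_{AB},[t]_{AB})$ with $A=Ka$, $B=Kb$, $$C=\tfrac12\begin{pmatrix}A_1B_1\\ A_2B_2\end{pmatrix}+K\Big(c-\tfrac12\begin{pmatrix}a_1b_1\\ a_2b_2\end{pmatrix}\Big)+\tfrac{b\wedge a}{2}\begin{pmatrix}k_{11}k_{12}\\ k_{21}k_{22}\end{pmatrix}.$$ (ii) $k\in\mathbb{Z}^2$ acts by $k\cdot(a,b,[c]_{ab},[t]_{ab})=(a,b,[k\cdot c]_{ab},[k\cdot_ct]_{ab})$ with $$k\cdot c=c-\tfrac{\alpha(ka)}{\alpha-1}b-\tfrac{kb}{\alpha-1}a,$$ $$k\cdot_ct=t+\tfrac{\alpha(ka)(kb)}{1-\alpha}+kc+\tfrac{k_1(k_1-1)a_1b_1+k_2(k_2-1)a_2b_2}{2}+k_1k_2b_1a_2;$$ this descends to an action of $\mathbb{Z}_d^2=\mathbb{Z}^2/d\mathbb{Z}^2$. (iii) $(\mu,\rho)\in\mathbb{R}^*_+\times\mathbb{R}^*$ acts by $(a,b,[c]_{ab},[t]_{ab})\mapsto(\mu a,\rho b,[\mu\rho c]_{\mu a,\rho b},[\mu\rho t]_{\mu a,\rho b})$. The semidirect product $\mathrm{GL}(2,\mathbb{Z})\ltimes_\psi\mathbb{Z}_d^2$ is $\mathrm{GL}(2,\mathbb{Z})\times\mathbb{Z}_d^2$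 with the law $(K,[k])*(K',[k'])=(KK',[kK'+k'])$, and $(\mathbb{R}^*_+\times\mathbb{R}^* )\times(\mathrm{GL}(2,\mathbb{Z})\ltimes_\psi\mathbb{Z}_d^2)$ acts by $((\mu,\rho),(K,[k]))\cdot x=K\cdot(k\cdot((\mu,\rho)\cdot x))$. *)

theory Defs
  imports
    "HOL-Analysis.Analysis"
    "HOL-Algebra.Group_Action"
    "HOL-Algebra.Generated_Groups"
begin

section \<open>Complex surfaces and biholomorphisms\<close>

definition quotient_topology :: "'a topology \<Rightarrow> ('a \<Rightarrow> 'b) \<Rightarrow> 'b topology" where
  "quotient_topology X p =
     topology (\<lambda>W. W \<subseteq> p ` topspace X \<and> openin X {x \<in> topspace X. p x \<in> W})"

lemma openin_quotient_topology:
  "openin (quotient_topology X p) W \<longleftrightarrow>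
     W \<subseteq> p ` topspace X \<and> openin X {x \<in> topspace X. p x \<in> W}"
proof -
  have "istopology (\<lambda>W. W \<subseteq> p ` topspace X \<and> openin X {x \<in> topspace X. p x \<in> W})"
    unfolding istopology_def
  proof (intro conjI allI impI)
    fix S T
    assume "S \<subseteq> p ` topspace X \<and> openin X {x \<in> topspace X. p x \<in> S}"
      and "T \<subseteq> p ` topspace X \<and> openin X {x \<in> topspace X. p x \<in> T}"
    moreover have "{x \<in> topspace X. p x \<in> S \<inter> T} =
        {x \<in> topspace X. p x \<in> S} \<inter> {x \<in> topspace X. p x \<in> T}" by auto
    ultimately show "S \<inter> T \<subseteq> p ` topspace X" "openin X {x \<in> topspace X. p x \<in> S \<inter> T}"
      by auto
  next
    fix \<K>
    assume *: "\<forall>K\<in>\<K>. K \<subseteq> p ` topspace X \<and> openin X {x \<in> topspace X. p x \<in> K}"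
    have "{x \<in> topspace X. p x \<in> \<Union>\<K>} = (\<Union>K\<in>\<K>. {x \<in> topspace X. p x \<in> K})" by auto
    with * show "openin X {x \<in> topspace X. p x \<in> \<Union>\<K>}" by auto
    show "\<Union>\<K> \<subseteq> p ` topspace X" using * by auto
  qed
  then show ?thesis
    by (simp add: quotient_topology_def topology_inverse')
qed

lemma quotient_map_quotient_topology: "quotient_map X (quotient_topology X p) p"
proof -
  have "{x \<in> topspace X. p x \<in> p ` topspace X} = topspace X" by auto
  then have "openin (quotient_topology X p) (p ` topspace X)"
    by (simp add: openin_quotient_topology)
  then have "topspace (quotient_topology X p) = p ` topspace X"
    by (metis openin_quotient_topology openin_subset openin_topspace subset_antisym)
  then show ?thesis
    by (auto simp: quotient_map_def openin_quotient_topology)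
qed

text \<open>
  A complex surface is a topological space together with an atlas.  A chart is a pair
  \<open>(V, \<phi>)\<close> of an open set and a coordinate map from \<open>V\<close> to \<open>\<complex>\<^sup>2\<close>.
\<close>

type_synonym 'a chart = "'a set \<times> ('a \<Rightarrow> complex \<times> complex)"
type_synonym 'a surface = "'a topology \<times> 'a chart set"

text \<open>
  Holomorphy in two variables: the real (Frechet) derivative exists and is complex linear.
  Only used for open \<open>S\<close>.
\<close>

definition holomorphic2_on :: "(complex \<times> complex \<Rightarrow> complex \<times> complex) \<Rightarrow> (complex \<times> complex) set \<Rightarrow> bool" where
  "holomorphic2_on F S \<longleftrightarrow>
     (\<forall>u\<in>S. \<exists>D. (F has_derivative D) (at u) \<and>
        (\<forall>s x y. D (s * x, s * y) = (s * fst (D (x, y)), s * snd (D (x, y)))))"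

definition holomorphic_map :: "'a surface \<Rightarrow> 'b surface \<Rightarrow> ('a \<Rightarrow> 'b) \<Rightarrow> bool" where
  "holomorphic_map X Y f \<longleftrightarrow>
     continuous_map (fst X) (fst Y) f \<and>
     (\<forall>(V, \<phi>)\<in>snd X. \<forall>(W, \<psi>)\<in>snd Y.
        holomorphic2_on (\<psi> \<circ> f \<circ> inv_into V \<phi>) (\<phi> ` {x \<in> V. f x \<in> W}))"

definition biholomorphic :: "'a surface \<Rightarrow> 'b surface \<Rightarrow> bool" where
  "biholomorphic X Y \<longleftrightarrow>
     (\<exists>f. bij_betw f (topspace (fst X)) (topspace (fst Y)) \<and>
          holomorphic_map X Y f \<and>
          holomorphic_map Y X (inv_into (topspace (fst X)) f))"

text \<open>
  The quotient of an open set \<open>U\<close> of \<open>\<complex>\<^sup>2\<close> by a group \<open>G\<close> of bijections of \<open>U\<close>: points are the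
  \<open>G\<close>-orbits, and the charts are the inverses of the restrictions of the projection \<open>p\<close> to the
  open sets on which \<open>p\<close> is injective.  These charts cover the quotient when the action is free
  and properly discontinuous.
\<close>

definition orbit_proj ::
    "(complex \<times> complex) set \<Rightarrow> (complex \<times> complex \<Rightarrow> complex \<times> complex) set
      \<Rightarrow> complex \<times> complex \<Rightarrow> (complex \<times> complex) set" where
  "orbit_proj U G = orbit (BijGroup U\<lparr>carrier := G\<rparr>) (\<lambda>g. g)"

definition quotient_surface ::
    "(complex \<times> complex) set \<Rightarrow> (complex \<times> complex \<Rightarrow> complex \<times> complex) set
      \<Rightarrow> (complex \<times> complex) set surface" where
  "quotient_surface U G =
     (quotient_topology (top_of_set U) (orbit_proj U G),
      {(orbit_proj U G ` V, inv_into V (orbit_proj U G)) | V.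
          open V \<and> V \<subseteq> U \<and> inj_on (orbit_proj U G) V})"

section \<open>Parameters of type II Inoue surfaces\<close>

definition S_plus_root :: "int \<Rightarrow> real" where
  "S_plus_root \<theta> = (real_of_int \<theta> + sqrt (real_of_int \<theta> ^ 2 - 4)) / 2"

definition S_plus_admissible :: "real \<Rightarrow> bool" where
  "S_plus_admissible \<alpha> \<longleftrightarrow> (\<exists>\<theta>\<ge>3. \<alpha> = S_plus_root \<theta>)"

text \<open>\<open>S_plus_root\<close> is injective on integers \<open>\<theta> \<ge> 3\<close> (as \<open>\<theta> = \<alpha> + 1/\<alpha>\<close>), so \<open>\<alpha>\<close> determines \<open>\<theta>\<close>.\<close>

definition S_plus_theta :: "real \<Rightarrow> int" where
  "S_plus_theta \<alpha> = (THE \<theta>. \<theta> \<ge> 3 \<and> \<alpha> = S_plus_root \<theta>)"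

definition S_plus_d :: "real \<Rightarrow> int" where
  "S_plus_d \<alpha> = S_plus_theta \<alpha> - 2"

definition wedge :: "real^2 \<Rightarrow> real^2 \<Rightarrow> real" where
  "wedge x y = x$1 * y$2 - x$2 * y$1"

definition Q_matrix :: "real^2 \<Rightarrow> real^2 \<Rightarrow> real^2^2" where
  "Q_matrix a b = (\<chi> i j. if j = 1 then a$i else b$i)"

definition N_matrix :: "real \<Rightarrow> real^2 \<Rightarrow> real^2 \<Rightarrow> real^2^2" where
  "N_matrix \<alpha> a b =
     Q_matrix a b ** (\<chi> i j. if i = j then (if i = 1 then \<alpha> else inverse \<alpha>) else 0)
       ** matrix_inv (Q_matrix a b)"

definition compatible_pairs :: "real \<Rightarrow> ((real^2) \<times> (real^2)) set" where
  "compatible_pairs \<alpha> =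
     {(a, b). a \<noteq> b \<and> independent {a, b} \<and> (\<forall>i j. N_matrix \<alpha> a b $ i $ j \<in> \<int>)}"

definition period :: "real^2 \<Rightarrow> real^2 \<Rightarrow> nat \<Rightarrow> real" where
  "period a b r = wedge b a / real r"

definition lattice2 :: "real^2 \<Rightarrow> real^2 \<Rightarrow> nat \<Rightarrow> (real^2) set" where
  "lattice2 a b r = {period a b r *\<^sub>R v | v. \<forall>i. v$i \<in> \<int>}"

text \<open>The vector with components \<open>x\<^sub>i y\<^sub>i\<close>.\<close>

definition cwise :: "real^2 \<Rightarrow> real^2 \<Rightarrow> real^2" where
  "cwise x y = (\<chi> i. x$i * y$i)"

definition C_set :: "real \<Rightarrow> real^2 \<Rightarrow> real^2 \<Rightarrow> nat \<Rightarrow> (real^2) set" where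
  "C_set \<alpha> a b r =
     {c. (mat 1 - N_matrix \<alpha> a b) *v (c - (1/2) *\<^sub>R cwise a b)
           - (wedge b a / 2) *\<^sub>R (\<chi> i. N_matrix \<alpha> a b $ i $ 1 * N_matrix \<alpha> a b $ i $ 2)
         \<in> lattice2 a b r}"

definition param_set :: "real \<Rightarrow> nat \<Rightarrow> ((real^2) \<times> (real^2) \<times> (real^2) \<times> complex) set" where
  "param_set \<alpha> r = {(a, b, c, t). (a, b) \<in> compatible_pairs \<alpha> \<and> c \<in> C_set \<alpha> a b r}"

section \<open>The surfaces\<close>

definition U_dom :: "(complex \<times> complex) set" where
  "U_dom = {(w, z). Im w > 0}"

definition inoue_generators ::
    "real \<Rightarrow> real^2 \<Rightarrow> real^2 \<Rightarrow> real^2 \<Rightarrow> nat \<Rightarrow> complex \<Rightarrow> (complex \<times> complex \<Rightarrow> complex \<times> complex) set" where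
  "inoue_generators \<alpha> a b c r t =
     {\<lambda>(w, z)\<in>U_dom. (of_real \<alpha> * w, z + t),
      \<lambda>(w, z)\<in>U_dom. (w + of_real (a$1), z + of_real (b$1) * w + of_real (c$1)),
      \<lambda>(w, z)\<in>U_dom. (w + of_real (a$2), z + of_real (b$2) * w + of_real (c$2)),
      \<lambda>(w, z)\<in>U_dom. (w, z + of_real (period a b r))}"

definition inoue_group ::
    "real \<Rightarrow> real^2 \<Rightarrow> real^2 \<Rightarrow> real^2 \<Rightarrow> nat \<Rightarrow> complex \<Rightarrow> (complex \<times> complex \<Rightarrow> complex \<times> complex) set" where
  "inoue_group \<alpha> a b c r t = generate (BijGroup U_dom) (inoue_generators \<alpha> a b c r t)"

definition inoue_surface ::
    "real \<Rightarrow> nat \<Rightarrow> (real^2) \<times> (real^2) \<times> (real^2) \<times> complex \<Rightarrow> (complex \<times> complex) set surface" where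
  "inoue_surface \<alpha> r = (\<lambda>(a, b, c, t). quotient_surface U_dom (inoue_group \<alpha> a b c r t))"

definition inoue_surfaces :: "real \<Rightarrow> nat \<Rightarrow> (complex \<times> complex) set surface set" where
  "inoue_surfaces \<alpha> r = inoue_surface \<alpha> r ` param_set \<alpha> r"

definition biholomorphic_rel :: "real \<Rightarrow> nat \<Rightarrow> ((complex \<times> complex) set surface) rel" where
  "biholomorphic_rel \<alpha> r =
     {(X, Y). X \<in> inoue_surfaces \<alpha> r \<and> Y \<in> inoue_surfaces \<alpha> r \<and> biholomorphic X Y}"

section \<open>Reduced parameters and the actions on them\<close>

definition coset_c :: "real^2 \<Rightarrow> real^2 \<Rightarrow> nat \<Rightarrow> real^2 \<Rightarrow> (real^2) set" where
  "coset_c a b r c = {c + v | v. v \<in> lattice2 a b r}"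

definition coset_t :: "real^2 \<Rightarrow> real^2 \<Rightarrow> nat \<Rightarrow> complex \<Rightarrow> complex set" where
  "coset_t a b r t = {t + of_real (period a b r) * of_int n | n :: int. True}"

type_synonym reduced = "(real^2) \<times> (real^2) \<times> (real^2) set \<times> complex set"

definition reduce :: "nat \<Rightarrow> (real^2) \<times> (real^2) \<times> (real^2) \<times> complex \<Rightarrow> reduced" where
  "reduce r = (\<lambda>(a, b, c, t). (a, b, coset_c a b r c, coset_t a b r t))"

definition reduced_set :: "real \<Rightarrow> nat \<Rightarrow> reduced set" where
  "reduced_set \<alpha> r = reduce r ` param_set \<alpha> r"

text \<open>
  A map of parameters \<open>(a, b, c, t)\<close> induces one of reduced parameters: the value on
  \<open>(a, b, \<gamma>, \<tau>)\<close> is the common reduction of the images of all representatives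
  \<open>c \<in> \<gamma>\<close>, \<open>t \<in> \<tau>\<close>.
\<close>

definition descend ::
    "nat \<Rightarrow> ((real^2) \<times> (real^2) \<times> (real^2) \<times> complex \<Rightarrow> (real^2) \<times> (real^2) \<times> (real^2) \<times> complex)
      \<Rightarrow> reduced \<Rightarrow> reduced" where
  "descend r F = (\<lambda>(a, b, \<gamma>, \<tau>). the_elem ((\<lambda>(c, t). reduce r (F (a, b, c, t))) ` (\<gamma> \<times> \<tau>)))"

definition real_matrix :: "int^2^2 \<Rightarrow> real^2^2" where
  "real_matrix K = (\<chi> i j. real_of_int (K$i$j))"

definition act_GL :: "nat \<Rightarrow> int^2^2 \<Rightarrow> reduced \<Rightarrow> reduced" where
  "act_GL r K = descend r (\<lambda>(a, b, c, t).
     let M = real_matrix K; A = M *v a; B = M *v b in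
       (A, B,
        (1/2) *\<^sub>R cwise A B + M *v (c - (1/2) *\<^sub>R cwise a b)
          + (wedge b a / 2) *\<^sub>R (\<chi> i. M$i$1 * M$i$2),
        t))"

text \<open>The product \<open>k x\<close> of a row \<open>k \<in> \<int>\<^sup>2\<close> and a column \<open>x \<in> \<real>\<^sup>2\<close>.\<close>

definition row_mult :: "int^2 \<Rightarrow> real^2 \<Rightarrow> real" where
  "row_mult k x = of_int (k$1) * x$1 + of_int (k$2) * x$2"

definition shift_c :: "real \<Rightarrow> real^2 \<Rightarrow> real^2 \<Rightarrow> int^2 \<Rightarrow> real^2 \<Rightarrow> real^2" where
  "shift_c \<alpha> a b k c =
     c - (\<alpha> * row_mult k a / (\<alpha> - 1)) *\<^sub>R b - (row_mult k b / (\<alpha> - 1)) *\<^sub>R a"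

definition shift_t :: "real \<Rightarrow> real^2 \<Rightarrow> real^2 \<Rightarrow> int^2 \<Rightarrow> real^2 \<Rightarrow> complex \<Rightarrow> complex" where
  "shift_t \<alpha> a b k c t =
     t + of_real (
       \<alpha> * row_mult k a * row_mult k b / (1 - \<alpha>) + row_mult k c
       + (of_int (k$1) * (of_int (k$1) - 1) * a$1 * b$1
          + of_int (k$2) * (of_int (k$2) - 1) * a$2 * b$2) / 2
       + of_int (k$1) * of_int (k$2) * b$1 * a$2)"

definition act_Z2 :: "real \<Rightarrow> nat \<Rightarrow> int^2 \<Rightarrow> reduced \<Rightarrow> reduced" where
  "act_Z2 \<alpha> r k = descend r (\<lambda>(a, b, c, t). (a, b, shift_c \<alpha> a b k c, shift_t \<alpha> a b k c t))"

text \<open>The class of \<open>k\<close> in \<open>\<int>\<^sub>d\<^sup>2 = \<int>\<^sup>2 / d\<int>\<^sup>2\<close>.\<close>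

definition Zd2_class :: "int \<Rightarrow> int^2 \<Rightarrow> (int^2) set" where
  "Zd2_class d k = {k + d *s m | m. True}"

text \<open>The descended action: all representatives of a class act in the same way.\<close>

definition act_Zd2 :: "real \<Rightarrow> nat \<Rightarrow> (int^2) set \<Rightarrow> reduced \<Rightarrow> reduced" where
  "act_Zd2 \<alpha> r \<kappa> x = the_elem ((\<lambda>k. act_Z2 \<alpha> r k x) ` \<kappa>)"

definition act_scale :: "nat \<Rightarrow> real \<times> real \<Rightarrow> reduced \<Rightarrow> reduced" where
  "act_scale r = (\<lambda>(\<mu>, \<rho>). descend r (\<lambda>(a, b, c, t).
     (\<mu> *\<^sub>R a, \<rho> *\<^sub>R b, (\<mu> * \<rho>) *\<^sub>R c, of_real (\<mu> * \<rho>) * t)))"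

definition pos_real_group :: "real monoid" where
  "pos_real_group = \<lparr>carrier = {0<..}, mult = (*), one = 1\<rparr>"

definition nonzero_real_group :: "real monoid" where
  "nonzero_real_group = \<lparr>carrier = - {0}, mult = (*), one = 1\<rparr>"

definition GL_Zd2_group :: "int \<Rightarrow> ((int^2^2) \<times> (int^2) set) monoid" where
  "GL_Zd2_group d =
     \<lparr>carrier = {K. invertible K} \<times> range (Zd2_class d),
      mult = (\<lambda>(K, \<kappa>) (K', \<kappa>').
        (K ** K', the_elem ((\<lambda>(k, k'). Zd2_class d (k v* K' + k')) ` (\<kappa> \<times> \<kappa>')))),
      one = (mat 1, Zd2_class d 0)\<rparr>"

definition full_group :: "real \<Rightarrow> ((real \<times> real) \<times> ((int^2^2) \<times> (int^2) set)) monoid" where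
  "full_group \<alpha> = (pos_real_group \<times>\<times> nonzero_real_group) \<times>\<times> GL_Zd2_group (S_plus_d \<alpha>)"

definition full_action ::
    "real \<Rightarrow> nat \<Rightarrow> (real \<times> real) \<times> ((int^2^2) \<times> (int^2) set) \<Rightarrow> reduced \<Rightarrow> reduced" where
  "full_action \<alpha> r = (\<lambda>(\<sigma>, (K, \<kappa>)) x. act_GL r K (act_Zd2 \<alpha> r \<kappa> (act_scale r \<sigma> x)))"

definition moduli_quotient :: "real \<Rightarrow> nat \<Rightarrow> reduced set set" where
  "moduli_quotient \<alpha> r = orbits (full_group \<alpha>) (reduced_set \<alpha> r) (full_action \<alpha> r)"

end

theory Submission
  imports Defs "HOL-Complex_Analysis.Complex_Analysis" "HOL-Library.Real_Mod"
begin

text \<open>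
  A biholomorphism of two surfaces lifts to a biholomorphism \<open>F\<close> of \<open>U = H \<times> \<complex>\<close> that conjugates one
  group into the other.  By Liouville's theorem \<open>F (w, z) = (m w, A w * z + B w)\<close>.  The translations
  of \<open>H\<close> coming from commutators accumulate at \<open>0\<close> because \<open>\<alpha> > 1\<close>, so \<open>m'\<close> is constant; the central
  generator \<open>g\<^sub>3\<close> makes \<open>A\<close> constant; \<open>B''\<close> is again invariant under small translations, hence
  constant, and \<open>g\<^sub>0\<close> kills its value.  So \<open>F (w, z) = (\<mu> w + \<nu>, \<Lambda> z + f w + \<kappa>)\<close>, where the constant \<open>\<kappa>\<close>
  is irrelevant, \<open>\<mu>\<close> and \<open>\<rho> = \<Lambda> / \<mu>\<close> give the scaling, the change of basis of the lattice gives an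
  element of \<open>GL\<^sub>2(\<int>)\<close>, and \<open>\<nu>\<close> and \<open>f\<close> are read off from the conjugate of \<open>g\<^sub>0\<close>, which is where \<open>k\<close>
  comes from.  Conversely each of the three moves is realised by such an \<open>F\<close>.  Since an orbit is
  thereby identified with the set of reductions of all parameters with a biholomorphic surface, the
  group law of the acting group is never needed.
\<close>

unbundle no Formal_Power_Series.fps_syntax

section \<open>Holomorphic maps in two variables\<close>

text \<open>The generators \<open>g\<^sub>1\<close> and \<open>g\<^sub>2\<close> commute only up to
  a power of \<open>g\<^sub>3\<close>. The constant term of a lattice element is therefore a
  quadratic function \<open>delta\<close> of its exponents, additive only up to a bilinear term and
  modulo the period. This is why every statement about \<open>c\<close> and \<open>t\<close> is a
  congruence, and why only their classes matter. In these terms the condition on \<open>c\<close>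
  says that \<open>g\<^sub>0\<close> normalises the lattice part, the GL action is a change of
  generators, and d enters through (N - I)^2 = d N. The obstacle to rigidity is that a lattice
  element has no a priori reason to be conjugated to a lattice element: the conjugate of a
  translation of H could have a power of \<alpha> as linear part. Comparing with
  \<open>g\<^sub>0\<close> gives the translations by ka and by \<alpha> ka the same linear part, so
  their quotient, the translation by (\<alpha> - 1) ka, does become a translation. The target period
  turns out to be \<Lambda> times the source period up to sign, since the change of basis has
  determinant 1 or -1.\<close>

lemma holomorphic2_on_pointwise: "holomorphic2_on F S \<longleftrightarrow> (\<forall>u\<in>S. holomorphic2_on F {u})"
  by (auto simp: holomorphic2_on_def)

lemma holomorphic2_on_subset: "holomorphic2_on F S \<Longrightarrow> T \<subseteq> S \<Longrightarrow> holomorphic2_on F T"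
  by (auto simp: holomorphic2_on_def)

lemma holomorphic2_on_cong_near:
  assumes "open T" "u \<in> T" "\<And>x. x \<in> T \<Longrightarrow> F x = H x" "holomorphic2_on H {u}"
  shows "holomorphic2_on F {u}"
proof -
  from assms(4) obtain D where "(H has_derivative D) (at u)"
    and D: "\<And>s x y. D (s * x, s * y) = (s * fst (D (x, y)), s * snd (D (x, y)))"
    by (auto simp: holomorphic2_on_def)
  then have "(F has_derivative D) (at u)"
    using assms by (metis has_derivative_transform_within_open)
  with D show ?thesis by (auto simp: holomorphic2_on_def)
qed

lemma holomorphic2_on_cong:
  assumes "open S" "\<And>x. x \<in> S \<Longrightarrow> F x = H x" "holomorphic2_on H S"
  shows "holomorphic2_on F S"
  using assms holomorphic2_on_cong_near[of S _ F H]
  by (metis holomorphic2_on_pointwise)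

lemma holomorphic2_on_compose_at:
  assumes "holomorphic2_on H {u}" "holomorphic2_on F {H u}"
  shows "holomorphic2_on (\<lambda>x. F (H x)) {u}"
proof -
  obtain D where D: "(H has_derivative D) (at u)"
      "\<And>s x y. D (s * x, s * y) = (s * fst (D (x, y)), s * snd (D (x, y)))"
    using assms(1) by (auto simp: holomorphic2_on_def)
  obtain E where E: "(F has_derivative E) (at (H u))"
      "\<And>s x y. E (s * x, s * y) = (s * fst (E (x, y)), s * snd (E (x, y)))"
    using assms(2) by (auto simp: holomorphic2_on_def)
  have "((\<lambda>x. F (H x)) has_derivative (\<lambda>x. E (D x))) (at u)"
    using diff_chain_at[OF D(1) E(1)] by (simp add: o_def)
  moreover have "E (D (s * x, s * y)) = (s * fst (E (D (x, y))), s * snd (E (D (x, y))))" for s x y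
    by (metis D(2) E(2) prod.collapse)
  ultimately show ?thesis by (auto simp: holomorphic2_on_def)
qed

lemma holomorphic2_on_compose:
  assumes "holomorphic2_on H S" "holomorphic2_on F T" "\<And>x. x \<in> S \<Longrightarrow> H x \<in> T"
  shows "holomorphic2_on (\<lambda>x. F (H x)) S"
  using assms holomorphic2_on_compose_at by (metis holomorphic2_on_pointwise)

lemma holomorphic2_on_imp_continuous_on:
  assumes "holomorphic2_on F S"
  shows "continuous_on S F"
  using assms unfolding holomorphic2_on_def
  by (meson continuous_at_imp_continuous_on has_derivative_continuous)

lemma holomorphic2_on_id: "holomorphic2_on (\<lambda>x. x) S"
  unfolding holomorphic2_on_def
  by (auto intro!: exI[of _ "\<lambda>x. x"] derivative_eq_intros)

lemma holomorphic2_on_affine: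
  "holomorphic2_on (\<lambda>(w, z). (m * w + n, l * z + f * w + k)) S"
  unfolding holomorphic2_on_def case_prod_unfold
  by (rule ballI, rule exI[of _ "\<lambda>v. (m * fst v, l * snd v + f * fst v)"])
    (auto intro!: derivative_eq_intros simp: algebra_simps)

text \<open>Along a curve whose derivative is v -> (x v, y v) the complex linear derivative of
  \<open>F\<close> becomes multiplication by a number, which is differentiability in one complex
  variable. It is applied to the horizontal and vertical complex lines in
  \<open>U_dom\<close>.\<close>

lemma holomorphic2_on_slice:
  assumes F: "holomorphic2_on F S"
    and c: "(c has_derivative c') (at s)" and "c s \<in> S"
    and lin: "\<And>v. c' v = (x * v, y * v)"
  shows "(\<lambda>v. fst (F (c v))) field_differentiable at s"
    and "(\<lambda>v. snd (F (c v))) field_differentiable at s"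
proof -
  obtain D where D: "(F has_derivative D) (at (c s))"
      "\<And>s x y. D (s * x, s * y) = (s * fst (D (x, y)), s * snd (D (x, y)))"
    using F \<open>c s \<in> S\<close> by (auto simp: holomorphic2_on_def)
  have *: "((\<lambda>v. F (c v)) has_derivative (\<lambda>v. D (c' v))) (at s)"
    using diff_chain_at[OF c D(1)] by (simp add: o_def)
  have D': "D (c' v) = (v * fst (D (x, y)), v * snd (D (x, y)))" for v
    using D(2)[of v x y] by (simp add: lin mult.commute)
  have "((\<lambda>v. fst (F (c v))) has_derivative (\<lambda>v. fst (D (c' v)))) (at s)"
    "((\<lambda>v. snd (F (c v))) has_derivative (\<lambda>v. snd (D (c' v)))) (at s)"
    using * by (auto intro: derivative_intros)
  moreover have "(\<lambda>v. fst (D (c' v))) = (*) (fst (D (x, y)))" "(\<lambda>v. snd (D (c' v))) = (*) (snd (D (x, y)))"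
    by (auto simp: D')
  ultimately show "(\<lambda>v. fst (F (c v))) field_differentiable at s"
    "(\<lambda>v. snd (F (c v))) field_differentiable at s"
    unfolding field_differentiable_def has_field_derivative_def by metis+
qed

section \<open>Quotients by groups acting freely and with wandering neighbourhoods\<close>

text \<open>The condition \<open>wandering\<close> describes a covering space action: a nontrivial
  element moves \<open>V\<close> off itself, which gives freeness and evenly covered neighbourhoods
  at once. Group elements are extensional on \<open>U\<close>, hence the restricted
  identity.\<close>

locale wandering_group =
  fixes U :: "(complex \<times> complex) set" and G :: "(complex \<times> complex \<Rightarrow> complex \<times> complex) set"
  assumes open_U: "open U"
    and subgroup_G: "subgroup G (BijGroup U)"
    and holomorphic_G: "\<And>g. g \<in> G \<Longrightarrow> holomorphic2_on g U"
    and wandering: "\<And>u. u \<in> U \<Longrightarrow>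
      \<exists>V. open V \<and> u \<in> V \<and> V \<subseteq> U \<and> (\<forall>g\<in>G. \<forall>x\<in>V. g x \<in> V \<longrightarrow> g = (\<lambda>x\<in>U. x))"
begin

abbreviation proj where "proj \<equiv> orbit_proj U G"

lemma proj_eq: "proj u = {g u | g. g \<in> G}"
  by (simp add: orbit_proj_def orbit_def)

lemma G_Bij: "g \<in> G \<Longrightarrow> g \<in> Bij U"
  using subgroup.mem_carrier[OF subgroup_G] by (simp add: BijGroup_def)

lemma G_closed [simp]: "g \<in> G \<Longrightarrow> x \<in> U \<Longrightarrow> g x \<in> U"
  using G_Bij Bij_imp_funcset by blast

lemma G_id: "(\<lambda>x\<in>U. x) \<in> G"
  using subgroup.one_closed[OF subgroup_G] by (simp add: BijGroup_def)

lemma G_compose: "g \<in> G \<Longrightarrow> h \<in> G \<Longrightarrow> compose U g h \<in> G"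
  using subgroup.m_closed[OF subgroup_G, of g h] G_Bij by (simp add: BijGroup_def)

lemma G_inverse:
  assumes "g \<in> G"
  obtains h where "h \<in> G" "\<And>x. x \<in> U \<Longrightarrow> h (g x) = x" "\<And>x. x \<in> U \<Longrightarrow> g (h x) = x"
proof
  have g: "bij_betw g U U"
    using G_Bij[OF assms] by (simp add: Bij_def)
  show "(\<lambda>x\<in>U. inv_into U g x) \<in> G"
    using subgroup.m_inv_closed[OF subgroup_G assms] inv_BijGroup[OF G_Bij[OF assms]] by simp
  show "(\<lambda>x\<in>U. inv_into U g x) (g x) = x" if "x \<in> U" for x
    using that assms g by (simp add: bij_betw_inv_into_left)
  show "g ((\<lambda>x\<in>U. inv_into U g x) x) = x" if "x \<in> U" for x
    using that assms g by (simp add: bij_betw_inv_into_right)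
qed

lemma proj_eq_iff:
  assumes "x \<in> U" "y \<in> U"
  shows "proj x = proj y \<longleftrightarrow> (\<exists>g\<in>G. g x = y)"
proof
  assume "proj x = proj y"
  moreover have "y \<in> proj y"
    unfolding proj_eq by (rule CollectI, rule exI[of _ "\<lambda>x\<in>U. x"]) (use G_id assms in auto)
  ultimately have "y \<in> proj x" by simp
  then show "\<exists>g\<in>G. g x = y" unfolding proj_eq by blast
next
  assume "\<exists>g\<in>G. g x = y"
  then obtain g where g: "g \<in> G" "g x = y" by auto
  obtain h where h: "h \<in> G" "\<And>x. x \<in> U \<Longrightarrow> h (g x) = x"
    using G_inverse[OF g(1)] by metis
  have "k y \<in> proj x" if "k \<in> G" for k
  proof -
    have "compose U k g x = k y" using assms g by (simp add: compose_def)
    then show ?thesis using G_compose[OF that g(1)] unfolding proj_eq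
      by (intro CollectI exI[of _ "compose U k g"]) auto
  qed
  moreover have "k x \<in> proj y" if "k \<in> G" for k
  proof -
    have "h y = x" using assms g h(2) by metis
    then have "compose U k h y = k x" using assms by (simp add: compose_def)
    then show ?thesis using G_compose[OF that h(1)] unfolding proj_eq
      by (intro CollectI exI[of _ "compose U k h"]) auto
  qed
  ultimately show "proj x = proj y" by (auto simp: proj_eq)
qed

lemma G_continuous: "g \<in> G \<Longrightarrow> continuous_on U g"
  using holomorphic_G holomorphic2_on_imp_continuous_on by blast

lemma open_G_vimage: "g \<in> G \<Longrightarrow> open V \<Longrightarrow> open {x \<in> U. g x \<in> V}"
  using continuous_open_preimage[OF G_continuous open_U] by (simp add: vimage_def Int_def)

lemma open_saturation:
  assumes "open V" "V \<subseteq> U"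
  shows "open {x \<in> U. proj x \<in> proj ` V}"
proof -
  have "{x \<in> U. proj x \<in> proj ` V} = (\<Union>g\<in>G. {x \<in> U. g x \<in> V})"
  proof (intro Set.set_eqI iffI)
    fix x assume "x \<in> {x \<in> U. proj x \<in> proj ` V}"
    then obtain v where v: "x \<in> U" "v \<in> V" "proj x = proj v" by auto
    then obtain g where "g \<in> G" "g x = v" using proj_eq_iff[of x v] assms(2) by auto
    with v show "x \<in> (\<Union>g\<in>G. {x \<in> U. g x \<in> V})" by auto
  next
    fix x assume "x \<in> (\<Union>g\<in>G. {x \<in> U. g x \<in> V})"
    then obtain g where g: "g \<in> G" "x \<in> U" "g x \<in> V" by auto
    then have "proj x = proj (g x)" using proj_eq_iff[of x "g x"] by auto
    with g show "x \<in> {x \<in> U. proj x \<in> proj ` V}" by auto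
  qed
  then show ?thesis
    using open_G_vimage[OF _ assms(1)] by auto
qed

abbreviation quot where "quot \<equiv> quotient_topology (top_of_set U) proj"

lemma topspace_quot: "topspace quot = proj ` U"
  using quotient_map_quotient_topology[of "top_of_set U" proj]
  by (auto simp: quotient_map_def)

lemma openin_quot_image:
  assumes "open V" "V \<subseteq> U"
  shows "openin quot (proj ` V)"
  unfolding openin_quotient_topology
  using open_saturation[OF assms] assms open_U by (auto simp: openin_open_eq)

text \<open>The inverse of \<open>g\<close> after \<open>h\<close> fixes \<open>x\<close>, so it
  returns a point of the wandering neighbourhood of \<open>x\<close> to that neighbourhood and is
  the identity.\<close>

lemma G_free:
  assumes "g \<in> G" "h \<in> G" "x \<in> U" "g x = h x"
  shows "g = h"
proof -
  obtain k where k: "k \<in> G" "\<And>x. x \<in> U \<Longrightarrow> k (g x) = x" "\<And>x. x \<in> U \<Longrightarrow> g (k x) = x"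
    using G_inverse[OF assms(1)] by metis
  obtain V where V: "x \<in> V" "V \<subseteq> U" "\<And>g x. g \<in> G \<Longrightarrow> x \<in> V \<Longrightarrow> g x \<in> V \<Longrightarrow> g = (\<lambda>x\<in>U. x)"
    using wandering[OF assms(3)] by metis
  have "compose U k h x = x"
    using assms k by (simp add: compose_def flip: assms(4))
  then have "compose U k h = (\<lambda>x\<in>U. x)"
    using V assms k G_compose by metis
  then have "k (h y) = y" if "y \<in> U" for y
    using that by (metis compose_eq restrict_apply')
  then have "g y = h y" if "y \<in> U" for y
    using that assms k by (metis G_closed)
  then show ?thesis
    using assms G_Bij Bij_imp_extensional extensionalityI by metis
qed

lemma wandering_inj:
  assumes "V \<subseteq> U" "\<And>g x. g \<in> G \<Longrightarrow> x \<in> V \<Longrightarrow> g x \<in> V \<Longrightarrow> g = (\<lambda>x\<in>U. x)"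
  shows "inj_on proj V"
proof (rule inj_onI)
  fix x y assume xy: "x \<in> V" "y \<in> V" "proj x = proj y"
  then obtain g where "g \<in> G" "g x = y"
    using proj_eq_iff assms(1) by blast
  with assms xy show "x = y" by (metis restrict_apply' subsetD)
qed

text \<open>At each point the two maps differ by an element of \<open>G\<close>, unique by
  \<open>G_free\<close>. The wandering neighbourhoods make it locally constant, so connectedness
  makes it constant. It serves both to compare lifts and to conjugate group elements.\<close>

lemma deck_transformation:
  fixes W :: "'b::topological_space set"
  assumes "connected W" "continuous_on W \<phi>" "continuous_on W \<psi>"
    and "\<And>x. x \<in> W \<Longrightarrow> \<phi> x \<in> U" "\<And>x. x \<in> W \<Longrightarrow> \<psi> x \<in> U"
    and "\<And>x. x \<in> W \<Longrightarrow> proj (\<phi> x) = proj (\<psi> x)"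
  shows "\<exists>g\<in>G. \<forall>x\<in>W. \<phi> x = g (\<psi> x)"
proof (cases "W = {}")
  case True
  then show ?thesis using G_id by auto
next
  case False
  define R where "R x y \<longleftrightarrow> (\<exists>g\<in>G. \<phi> x = g (\<psi> x) \<and> \<phi> y = g (\<psi> y))" for x y
  have ex: "\<exists>g\<in>G. \<phi> x = g (\<psi> x)" if "x \<in> W" for x
    using assms(4-6)[OF that] proj_eq_iff[of "\<psi> x" "\<phi> x"] by metis
  have R: "R a b" if "a \<in> W" "b \<in> W" for a b
  proof (rule connected_equivalence_relation[OF \<open>connected W\<close> that])
    show "R y x" if "R x y" for x y
      using that by (auto simp: R_def)
    show "R x z" if "R x y" "R y z" "x \<in> W" "y \<in> W" "z \<in> W" for x y z
    proof -
      obtain g h where "g \<in> G" "\<phi> x = g (\<psi> x)" "\<phi> y = g (\<psi> y)"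
          "h \<in> G" "\<phi> y = h (\<psi> y)" "\<phi> z = h (\<psi> z)"
        using \<open>R x y\<close> \<open>R y z\<close> by (auto simp: R_def)
      moreover from this have "g = h" using G_free[of g h "\<psi> y"] assms(5) that by auto
      ultimately show ?thesis by (auto simp: R_def)
    qed
    fix x assume x: "x \<in> W"
    obtain g where g: "g \<in> G" "\<phi> x = g (\<psi> x)" using ex[OF x] by auto
    obtain g' where g': "g' \<in> G" "\<And>x. x \<in> U \<Longrightarrow> g' (g x) = x"
      using G_inverse[OF g(1)] by metis
    obtain V where V: "open V" "\<phi> x \<in> V" "V \<subseteq> U" "\<And>g x. g \<in> G \<Longrightarrow> x \<in> V \<Longrightarrow> g x \<in> V \<Longrightarrow> g = (\<lambda>x\<in>U. x)"
      using wandering[OF assms(4)[OF x]] by metis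
    have cg: "continuous_on W (\<lambda>x. g (\<psi> x))"
      using continuous_on_compose2[OF G_continuous[OF g(1)] assms(3)] assms(5) by auto
    \<comment> \<open>On \<open>?T\<close> both \<open>\<phi>\<close> and \<open>g\<close> after
      \<open>\<psi>\<close> stay in \<open>V\<close>. The element \<open>h\<close> that works at
      \<open>y\<close>, preceded by the inverse of \<open>g\<close>, takes one point of
      \<open>V\<close> to another, so it is the identity and \<open>g\<close> works at
      \<open>y\<close> too.\<close>
    let ?T = "(W \<inter> \<phi> -` V) \<inter> (W \<inter> (\<lambda>x. g (\<psi> x)) -` V)"
    have "openin (top_of_set W) ?T"
      using continuous_openin_preimage_gen[OF assms(2) V(1)] continuous_openin_preimage_gen[OF cg V(1)]
      by (rule openin_Int)
    moreover have "R x y" if "y \<in> ?T" for y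
    proof -
      have "y \<in> W" using that by simp
      then obtain h where h: "h \<in> G" "\<phi> y = h (\<psi> y)" using ex by blast
      have "compose U h g' (g (\<psi> y)) = \<phi> y"
        using that assms(5) g g' h by (simp add: compose_def)
      then have "compose U h g' = (\<lambda>x\<in>U. x)"
        using that by (intro V(4)[OF G_compose[OF h(1) g'(1)], of "g (\<psi> y)"]) auto
      then have "\<phi> y = g (\<psi> y)"
        using \<open>compose U h g' (g (\<psi> y)) = \<phi> y\<close> that V(3) by auto
      then show ?thesis using g by (auto simp: R_def)
    qed
    ultimately show "\<exists>T. openin (top_of_set W) T \<and> x \<in> T \<and> (\<forall>y\<in>T. R x y)"
      using x V(2) g by (intro exI[of _ ?T]) auto
  qed
  obtain a where a: "a \<in> W" using False by auto
  obtain g where g: "g \<in> G" "\<phi> a = g (\<psi> a)" using ex[OF a] by auto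
  have "\<phi> x = g (\<psi> x)" if "x \<in> W" for x
  proof -
    have "R a x" using R a that by blast
    then obtain h where "h \<in> G" "\<phi> a = h (\<psi> a)" "\<phi> x = h (\<psi> x)"
      by (auto simp: R_def)
    with g a show ?thesis using G_free[of g h "\<psi> a"] assms(5) by auto
  qed
  with g show ?thesis by auto
qed

text \<open>
  The library lifts maps through coverings of subsets of normed spaces only.  The quotient is not
  such a subset, but the pullback of the projection along \<open>\<phi>\<close> is a covering of \<open>W\<close> inside
  \<open>W \<times> U\<close>, and its sections are the lifts of \<open>\<phi>\<close>.
\<close>

lemma covering_space_pullback:
  fixes W :: "'b::real_normed_vector set"
  assumes W: "open W" and \<phi>: "continuous_map (top_of_set W) quot \<phi>"
  defines "R \<equiv> {(w, u). w \<in> W \<and> u \<in> U \<and> proj u = \<phi> w}"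
  shows "covering_space R fst W"
proof
  show "continuous_on R fst" by (intro continuous_intros)
  have \<phi>im: "\<phi> w \<in> proj ` U" if "w \<in> W" for w
    using continuous_map_image_subset_topspace[OF \<phi>] that topspace_quot by auto
  then show "fst ` R = W"
    unfolding R_def by (force simp: image_iff)
  have \<phi>open: "open {w \<in> W. \<phi> w \<in> proj ` V}" if "open V" "V \<subseteq> U" for V
  proof -
    have "openin (top_of_set W) {w \<in> W. \<phi> w \<in> proj ` V}"
      using openin_continuous_map_preimage[OF \<phi> openin_quot_image[OF that]] by simp
    then show ?thesis using W by (simp add: openin_open_eq)
  qed
  fix w0 assume w0: "w0 \<in> W"
  then obtain u0 where u0: "u0 \<in> U" "\<phi> w0 = proj u0" using \<phi>im by blast
  obtain V where V: "open V" "u0 \<in> V" "V \<subseteq> U" "\<And>g x. g \<in> G \<Longrightarrow> x \<in> V \<Longrightarrow> g x \<in> V \<Longrightarrow> g = (\<lambda>x\<in>U. x)"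
    using wandering[OF u0(1)] by metis
  have injV: "inj_on proj V" using wandering_inj V by blast
  define T where "T = {w \<in> W. \<phi> w \<in> proj ` V}"
  define s where "s = inv_into V proj"
  have T: "open T" unfolding T_def using \<phi>open V by blast
  have sV: "s (\<phi> w) \<in> V" "proj (s (\<phi> w)) = \<phi> w" if "w \<in> T" for w
    using that unfolding T_def s_def by (simp_all add: inv_into_into f_inv_into_f)
  have s_eq: "s (\<phi> w) = v" if "v \<in> V" "proj v = \<phi> w" for v w
    using that injV unfolding s_def by (metis inv_into_f_f)
  have conts: "continuous_on T (\<lambda>w. s (\<phi> w))"
  proof (subst continuous_on_open_vimage[OF T], intro allI impI)
    fix B :: "(complex \<times> complex) set" assume "open B"
    have "(\<lambda>w. s (\<phi> w)) -` B \<inter> T = {w \<in> W. \<phi> w \<in> proj ` (V \<inter> B)}"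
    proof (intro Set.set_eqI iffI)
      fix w assume "w \<in> (\<lambda>w. s (\<phi> w)) -` B \<inter> T"
      then show "w \<in> {w \<in> W. \<phi> w \<in> proj ` (V \<inter> B)}"
        using sV[of w] by (auto simp: T_def intro!: image_eqI[of _ _ "s (\<phi> w)"])
    next
      fix w assume w: "w \<in> {w \<in> W. \<phi> w \<in> proj ` (V \<inter> B)}"
      then obtain v where "v \<in> V \<inter> B" "\<phi> w = proj v" by auto
      with w s_eq[of v w] show "w \<in> (\<lambda>w. s (\<phi> w)) -` B \<inter> T"
        by (auto simp: T_def)
    qed
    then show "open ((\<lambda>w. s (\<phi> w)) -` B \<inter> T)"
      using \<phi>open[OF open_Int[OF V(1) \<open>open B\<close>]] V(3) by (simp add: le_infI1)
  qed
  \<comment> \<open>The sheets over \<open>T\<close> are indexed by \<open>G\<close>: the one for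
    \<open>g\<close> holds the points that \<open>g\<close> carries into \<open>V\<close>. They are
    disjoint because the projection is injective on \<open>V\<close> and the action is free.\<close>
  define sheet where "sheet g = {(w, u). w \<in> T \<and> u \<in> U \<and> proj u = \<phi> w \<and> g u \<in> V}" for g
  have sheet_open: "openin (top_of_set R) (sheet g)" if "g \<in> G" for g
  proof -
    have "open (T \<times> {u \<in> U. g u \<in> V})"
      using T V open_G_vimage[OF that] by (intro open_Times) auto
    moreover have "sheet g = R \<inter> (T \<times> {u \<in> U. g u \<in> V})"
      by (auto simp: sheet_def R_def T_def)
    ultimately show ?thesis by (auto simp: openin_open)
  qed
  have sheet_homeo: "\<exists>q. homeomorphism (sheet g) T fst q" if g: "g \<in> G" for g
  proof -
    obtain h where h: "h \<in> G" "\<And>x. x \<in> U \<Longrightarrow> h (g x) = x" "\<And>x. x \<in> U \<Longrightarrow> g (h x) = x"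
      using G_inverse[OF g] by metis
    have "homeomorphism (sheet g) T fst (\<lambda>w. (w, h (s (\<phi> w))))"
    proof (rule homeomorphismI)
      show "continuous_on (sheet g) fst" by (intro continuous_intros)
      have "continuous_on T (\<lambda>w. h (s (\<phi> w)))"
        using continuous_on_compose2[OF G_continuous[OF h(1)] conts] sV V(3) by auto
      then show "continuous_on T (\<lambda>w. (w, h (s (\<phi> w))))" by (intro continuous_intros)
      show "fst ` sheet g \<subseteq> T" by (auto simp: sheet_def)
      have "proj (h (s (\<phi> w))) = \<phi> w" if "w \<in> T" for w
      proof -
        have "s (\<phi> w) \<in> U" using sV[OF that] V(3) by auto
        then show ?thesis
          using sV[OF that] h g proj_eq_iff[of "h (s (\<phi> w))" "s (\<phi> w)"] G_closed by metis
      qed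
      moreover have "h (s (\<phi> w)) \<in> U" "g (h (s (\<phi> w))) \<in> V" if "w \<in> T" for w
        using sV[OF that] V(3) h(1) h(3)[of "s (\<phi> w)"] G_closed by auto
      ultimately show "(\<lambda>w. (w, h (s (\<phi> w)))) ` T \<subseteq> sheet g"
        by (auto simp: sheet_def)
      show "(fst x, h (s (\<phi> (fst x)))) = x" if "x \<in> sheet g" for x
      proof -
        obtain w u where x: "x = (w, u)" by (cases x)
        have u: "u \<in> U" "proj u = \<phi> w" "g u \<in> V" using that x by (auto simp: sheet_def)
        have "proj (g u) = \<phi> w" using u g proj_eq_iff[of u "g u"] by auto
        then have "s (\<phi> w) = g u" using s_eq u by auto
        then show ?thesis using x h u by auto
      qed
    qed auto
    then show ?thesis by blast
  qed
  have "\<Union>(sheet ` G) = R \<inter> fst -` T"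
  proof (intro Set.set_eqI iffI)
    fix x assume "x \<in> \<Union>(sheet ` G)"
    then show "x \<in> R \<inter> fst -` T" by (auto simp: sheet_def R_def T_def)
  next
    fix x assume x: "x \<in> R \<inter> fst -` T"
    obtain w u where wu: "x = (w, u)" by (cases x)
    then have *: "w \<in> T" "u \<in> U" "proj u = \<phi> w" using x by (auto simp: R_def)
    then have "proj u = proj (s (\<phi> w))" "s (\<phi> w) \<in> U" using sV[of w] V(3) by auto
    then obtain g where "g \<in> G" "g u = s (\<phi> w)" using proj_eq_iff[of u "s (\<phi> w)"] * by metis
    then have "g \<in> G" "x \<in> sheet g" using * wu sV[of w] by (auto simp: sheet_def)
    then show "x \<in> \<Union>(sheet ` G)" by blast
  qed
  moreover have "pairwise disjnt (sheet ` G)"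
  proof -
    have "g = h" if gh: "g \<in> G" "h \<in> G" and x: "x \<in> sheet g" "x \<in> sheet h" for g h x
    proof -
      obtain w u where u: "x = (w, u)" "u \<in> U" "proj u = \<phi> w" "g u \<in> V" "h u \<in> V"
        using x by (auto simp: sheet_def)
      have "proj (g u) = proj u" "proj (h u) = proj u"
        using gh u proj_eq_iff by (metis G_closed)+
      then have "g u = h u" using u injV by (metis inj_onD)
      then show ?thesis using G_free gh u by auto
    qed
    then show ?thesis unfolding pairwise_def disjnt_def by blast
  qed
  moreover have "w0 \<in> T" using w0 u0 V by (auto simp: T_def)
  ultimately show "\<exists>T. w0 \<in> T \<and> openin (top_of_set W) T \<and>
      (\<exists>v. \<Union>v = R \<inter> fst -` T \<and> (\<forall>u\<in>v. openin (top_of_set R) u) \<and>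
        pairwise disjnt v \<and> (\<forall>u\<in>v. \<exists>q. homeomorphism u T fst q))"
    using sheet_open sheet_homeo T W
    by (intro exI[of _ T] conjI exI[of _ "sheet ` G"]) (auto simp: T_def openin_open_eq)
qed

lemma lift_to_cover:
  fixes W :: "'b::real_normed_vector set"
  assumes "open W" "simply_connected W" "continuous_map (top_of_set W) quot \<phi>"
  obtains F where "continuous_on W F" "\<And>w. w \<in> W \<Longrightarrow> F w \<in> U" "\<And>w. w \<in> W \<Longrightarrow> proj (F w) = \<phi> w"
proof -
  define R where "R = {(w, u). w \<in> W \<and> u \<in> U \<and> proj u = \<phi> w}"
  have "covering_space R fst W"
    unfolding R_def by (rule covering_space_pullback) (use assms in auto)
  moreover have "locally path_connected W"
    using assms(1) by (simp add: open_imp_locally_path_connected)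
  \<comment> \<open>What is lifted is the identity of \<open>W\<close>, so the lift is a section of
    the pullback and its second component is the required map.\<close>
  ultimately obtain g where g: "continuous_on W g" "g \<in> W \<rightarrow> R" "\<And>y. y \<in> W \<Longrightarrow> fst (g y) = y"
    using covering_space_lift[of R fst W W "\<lambda>w. w"] assms(2) by auto
  show ?thesis
  proof
    show "continuous_on W (\<lambda>w. snd (g w))" using g by (intro continuous_intros)
    fix w assume w: "w \<in> W"
    then have "g w \<in> R" using g by auto
    then show "snd (g w) \<in> U" "proj (snd (g w)) = \<phi> w"
      using g(3)[OF w] by (auto simp: R_def)
  qed
qed

end

text \<open>Phrased by orbits rather than by conjugation of groups: this is what a bijection of the
  quotients sees, and symmetry and transitivity are immediate. Conjugation is recovered in
  \<open>orbit_equivalence_intertwines\<close>.\<close>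

definition orbit_equivalence ::
    "(complex \<times> complex) set \<Rightarrow> (complex \<times> complex \<Rightarrow> complex \<times> complex) set
      \<Rightarrow> (complex \<times> complex \<Rightarrow> complex \<times> complex) set
      \<Rightarrow> (complex \<times> complex \<Rightarrow> complex \<times> complex) \<Rightarrow> (complex \<times> complex \<Rightarrow> complex \<times> complex) \<Rightarrow> bool" where
  "orbit_equivalence U G G' F F' \<longleftrightarrow>
     holomorphic2_on F U \<and> holomorphic2_on F' U \<and>
     (\<forall>x\<in>U. F x \<in> U \<and> F' x \<in> U \<and> F' (F x) = x \<and> F (F' x) = x) \<and>
     (\<forall>x\<in>U. \<forall>y\<in>U. orbit_proj U G x = orbit_proj U G y \<longleftrightarrow> orbit_proj U G' (F x) = orbit_proj U G' (F y))"

lemma orbit_equivalence_id: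
  "orbit_equivalence U G G (\<lambda>x. x) (\<lambda>x. x)"
  by (simp add: orbit_equivalence_def holomorphic2_on_id)

lemma orbit_equivalence_sym:
  assumes "orbit_equivalence U G G' F F'"
  shows "orbit_equivalence U G' G F' F"
  using assms unfolding orbit_equivalence_def by (intro conjI ballI) simp_all

lemma orbit_equivalence_trans:
  assumes "orbit_equivalence U G G' F F'" "orbit_equivalence U G' G'' H H'"
  shows "orbit_equivalence U G G'' (\<lambda>x. H (F x)) (\<lambda>x. F' (H' x))"
  using assms unfolding orbit_equivalence_def
  by (intro conjI ballI) (auto elim!: holomorphic2_on_compose)

lemma fst_quotient_surface: "fst (quotient_surface U G) = quotient_topology (top_of_set U) (orbit_proj U G)"
  by (simp add: quotient_surface_def)

text \<open>The charts are themselves inverses of projections, so a map in coordinates involves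
  \<open>inv_into\<close> of \<open>inv_into\<close>. It reduces to a lift \<open>F\<close> followed
  by a local inverse of the second projection.\<close>

lemma holomorphic2_quotient_chart:
  fixes p q :: "complex \<times> complex \<Rightarrow> 'a"
  assumes "inj_on p V" "inj_on q V'" "\<And>v. v \<in> V \<Longrightarrow> f (p v) = q (F v)"
  shows "(inv_into V p) ` {x \<in> p ` V. f x \<in> q ` V'} = {v \<in> V. q (F v) \<in> q ` V'}" (is "?L = ?R")
    and "\<And>v. v \<in> V \<Longrightarrow> (inv_into V' q \<circ> f \<circ> inv_into (p ` V) (inv_into V p)) v = inv_into V' q (q (F v))"
proof -
  have 1: "inv_into V p (p v) = v" if "v \<in> V" for v
    using assms(1) that by simp
  show "?L = ?R"
  proof (intro Set.set_eqI iffI)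
    fix v assume "v \<in> ?L"
    then obtain x where "x \<in> V" "f (p x) \<in> q ` V'" "v = inv_into V p (p x)" by auto
    then show "v \<in> ?R" using 1 assms(3) by auto
  next
    fix v assume "v \<in> ?R"
    then have "p v \<in> {x \<in> p ` V. f x \<in> q ` V'}" "v = inv_into V p (p v)"
      using 1 assms(3) by auto
    then show "v \<in> ?L" by blast
  qed
  fix v assume v: "v \<in> V"
  have "inj_on (inv_into V p) (p ` V)" by (simp add: inj_on_inv_into)
  then have "inv_into (p ` V) (inv_into V p) v = p v"
    using 1[OF v] v by (metis inv_into_f_f imageI)
  then show "(inv_into V' q \<circ> f \<circ> inv_into (p ` V) (inv_into V p)) v = inv_into V' q (q (F v))"
    using assms(3) v by simp
qed

locale wandering_group_pair = dom: wandering_group U G + cod: wandering_group U G'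
  for U G G'
begin

lemma holomorphic_map_of_lift:
  assumes F: "holomorphic2_on F U" "\<And>x. x \<in> U \<Longrightarrow> F x \<in> U"
    and f: "\<And>x. x \<in> U \<Longrightarrow> f (dom.proj x) = cod.proj (F x)"
  shows "holomorphic_map (quotient_surface U G) (quotient_surface U G') f"
  unfolding holomorphic_map_def
proof (intro conjI ballI)
  have "continuous_map (top_of_set U) (top_of_set U) F"
    using holomorphic2_on_imp_continuous_on[OF F(1)] F(2) by (auto simp: continuous_map_in_subtopology)
  then have "continuous_map (top_of_set U) cod.quot (cod.proj \<circ> F)"
    using continuous_map_compose quotient_imp_continuous_map[OF quotient_map_quotient_topology] by blast
  then have "continuous_map (top_of_set U) cod.quot (f \<circ> dom.proj)"
    by (rule continuous_map_eq) (simp add: f)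
  then show "continuous_map (fst (quotient_surface U G)) (fst (quotient_surface U G')) f"
    unfolding fst_quotient_surface
    using continuous_compose_quotient_map[OF quotient_map_quotient_topology] by blast
  have "holomorphic2_on (snd WY \<circ> f \<circ> inv_into (fst VX) (snd VX)) (snd VX ` {x \<in> fst VX. f x \<in> fst WY})"
    if VW: "VX \<in> snd (quotient_surface U G)" "WY \<in> snd (quotient_surface U G')" for VX WY
  proof -
    obtain V V' where V: "open V" "V \<subseteq> U" "inj_on dom.proj V" "VX = (dom.proj ` V, inv_into V dom.proj)"
      and V': "open V'" "V' \<subseteq> U" "inj_on cod.proj V'" "WY = (cod.proj ` V', inv_into V' cod.proj)"
      using VW unfolding quotient_surface_def snd_conv by blast
    let ?S = "{v \<in> V. cod.proj (F v) \<in> cod.proj ` V'}"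
    have "holomorphic2_on (inv_into V' cod.proj \<circ> f \<circ> inv_into (dom.proj ` V) (inv_into V dom.proj)) {v}"
      if v: "v \<in> ?S" for v
    proof -
      have vU: "v \<in> U" using v V(2) by auto
      have "F v \<in> U" using F(2)[OF vU] .
      note vU = vU this
      obtain y where y: "y \<in> V'" "cod.proj (F v) = cod.proj y" using v by auto
      \<comment> \<open>\<open>F v\<close> need not lie in \<open>V'\<close>, only in the orbit of a
        point of \<open>V'\<close>. The element \<open>g\<close> brings it there, and near
        \<open>v\<close> the map in coordinates is \<open>g\<close> after \<open>F\<close>.\<close>
      then obtain g where g: "g \<in> G'" "g (F v) = y" using cod.proj_eq_iff vU V' by blast
      define T where "T = V \<inter> {x \<in> U. F x \<in> {x \<in> U. g x \<in> V'}}"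
      have "open {x \<in> U. F x \<in> {x \<in> U. g x \<in> V'}}"
        using continuous_open_preimage[OF holomorphic2_on_imp_continuous_on[OF F(1)] dom.open_U
            cod.open_G_vimage[OF g(1) V'(1)]]
        by (simp add: vimage_def Int_def)
      then have T: "open T" using V(1) unfolding T_def by auto
      have eq: "(inv_into V' cod.proj \<circ> f \<circ> inv_into (dom.proj ` V) (inv_into V dom.proj)) x = g (F x)"
        if "x \<in> T" for x
      proof -
        have x: "x \<in> V" "x \<in> U" "F x \<in> U" "g (F x) \<in> V'" using that F by (auto simp: T_def)
        have "cod.proj (F x) = cod.proj (g (F x))"
          using cod.proj_eq_iff[OF x(3), of "g (F x)"] x g V'(2) by blast
        then have "inv_into V' cod.proj (cod.proj (F x)) = g (F x)"
          using V'(3) x(4) by simp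
        moreover have "\<And>v. v \<in> V \<Longrightarrow> f (dom.proj v) = cod.proj (F v)" using f V(2) by blast
        ultimately show ?thesis using holomorphic2_quotient_chart(2)[OF V(3) V'(3), of f F x] x by simp
      qed
      have hol: "holomorphic2_on (\<lambda>x. g (F x)) {v}"
        using holomorphic2_on_compose[OF F(1) cod.holomorphic_G[OF g(1)]] F(2) vU(1)
        by (metis holomorphic2_on_pointwise)
      have vT: "v \<in> T" using v vU g y by (auto simp: T_def)
      show ?thesis by (rule holomorphic2_on_cong_near[OF T vT eq hol])
    qed
    moreover have "inv_into V dom.proj ` {x \<in> dom.proj ` V. f x \<in> cod.proj ` V'} = ?S"
      using holomorphic2_quotient_chart(1)[OF V(3) V'(3), of f F] f V(2) by blast
    ultimately show ?thesis
      unfolding V(4) V'(4) fst_conv snd_conv by (subst holomorphic2_on_pointwise) blast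
  qed
  then show "case VX of (V, \<phi>) \<Rightarrow> \<forall>(W, \<psi>)\<in>snd (quotient_surface U G').
      holomorphic2_on (\<psi> \<circ> f \<circ> inv_into V \<phi>) (\<phi> ` {x \<in> V. f x \<in> W})"
    if "VX \<in> snd (quotient_surface U G)" for VX
    using that unfolding case_prod_unfold by blast
qed

lemma holomorphic_lift:
  assumes f: "holomorphic_map (quotient_surface U G) (quotient_surface U G') f"
    and F: "continuous_on U F" "\<And>x. x \<in> U \<Longrightarrow> F x \<in> U" "\<And>x. x \<in> U \<Longrightarrow> f (dom.proj x) = cod.proj (F x)"
  shows "holomorphic2_on F U"
proof (subst holomorphic2_on_pointwise, rule ballI)
  fix u assume u: "u \<in> U"
  obtain V where V: "open V" "u \<in> V" "V \<subseteq> U" "\<And>g x. g \<in> G \<Longrightarrow> x \<in> V \<Longrightarrow> g x \<in> V \<Longrightarrow> g = (\<lambda>x\<in>U. x)"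
    using dom.wandering[OF u] by metis
  \<comment> \<open>With \<open>V'\<close> around \<open>F u\<close> itself, the local inverse of
    the projection returns exactly \<open>F\<close>, so near \<open>u\<close> the coordinate
    expression of \<open>f\<close> is \<open>F\<close>.\<close>
  obtain V' where V': "open V'" "F u \<in> V'" "V' \<subseteq> U" "\<And>g x. g \<in> G' \<Longrightarrow> x \<in> V' \<Longrightarrow> g x \<in> V' \<Longrightarrow> g = (\<lambda>x\<in>U. x)"
    using cod.wandering[OF F(2)[OF u]] by metis
  have inj: "inj_on dom.proj V" "inj_on cod.proj V'"
    using dom.wandering_inj V cod.wandering_inj V' by blast+
  have "(dom.proj ` V, inv_into V dom.proj) \<in> snd (quotient_surface U G)"
    "(cod.proj ` V', inv_into V' cod.proj) \<in> snd (quotient_surface U G')"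
    unfolding quotient_surface_def snd_conv using V V' inj by blast+
  then have H: "holomorphic2_on (inv_into V' cod.proj \<circ> f \<circ> inv_into (dom.proj ` V) (inv_into V dom.proj))
      (inv_into V dom.proj ` {x \<in> dom.proj ` V. f x \<in> cod.proj ` V'})"
    using f unfolding holomorphic_map_def by fastforce
  have fF: "\<And>v. v \<in> V \<Longrightarrow> f (dom.proj v) = cod.proj (F v)" using F(3) V(3) by blast
  define T where "T = V \<inter> {x \<in> U. F x \<in> V'}"
  have "open {x \<in> U. F x \<in> V'}"
    using continuous_open_preimage[OF F(1) dom.open_U V'(1)] by (simp add: vimage_def Int_def)
  then have T: "open T"
    unfolding T_def using V(1) by (intro open_Int)
  show "holomorphic2_on F {u}"
  proof (rule holomorphic2_on_cong_near[OF T])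
    show "u \<in> T" using u V V' by (auto simp: T_def)
    show "F x = (inv_into V' cod.proj \<circ> f \<circ> inv_into (dom.proj ` V) (inv_into V dom.proj)) x" if "x \<in> T" for x
      using holomorphic2_quotient_chart(2)[OF inj, of f F x] fF that inj(2) by (simp add: T_def)
    show "holomorphic2_on (inv_into V' cod.proj \<circ> f \<circ> inv_into (dom.proj ` V) (inv_into V dom.proj)) {u}"
    proof (rule holomorphic2_on_subset[OF H])
      have "inv_into V dom.proj ` {x \<in> dom.proj ` V. f x \<in> cod.proj ` V'} = {v \<in> V. cod.proj (F v) \<in> cod.proj ` V'}"
        by (rule holomorphic2_quotient_chart(1)[where f = f and F = F, OF inj fF])
      then show "{u} \<subseteq> inv_into V dom.proj ` {x \<in> dom.proj ` V. f x \<in> cod.proj ` V'}"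
        using V(2) V'(2) by simp
    qed
  qed
qed

lemma biholomorphic_of_orbit_equivalence:
  assumes "orbit_equivalence U G G' F F'"
  shows "biholomorphic (quotient_surface U G) (quotient_surface U G')"
proof -
  interpret rev: wandering_group_pair U G' G by unfold_locales
  have F: "holomorphic2_on F U" "\<And>x. x \<in> U \<Longrightarrow> F x \<in> U" "\<And>x. x \<in> U \<Longrightarrow> F (F' x) = x"
    and F': "holomorphic2_on F' U" "\<And>x. x \<in> U \<Longrightarrow> F' x \<in> U" "\<And>x. x \<in> U \<Longrightarrow> F' (F x) = x"
    and eq: "\<And>x y. x \<in> U \<Longrightarrow> y \<in> U \<Longrightarrow> dom.proj x = dom.proj y \<longleftrightarrow> cod.proj (F x) = cod.proj (F y)"
    using assms unfolding orbit_equivalence_def by auto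
  define f where "f P = cod.proj (F (inv_into U dom.proj P))" for P
  have f: "f (dom.proj x) = cod.proj (F x)" if "x \<in> U" for x
  proof -
    have "dom.proj (inv_into U dom.proj (dom.proj x)) = dom.proj x" "inv_into U dom.proj (dom.proj x) \<in> U"
      using that by (simp_all add: f_inv_into_f inv_into_into)
    then show ?thesis unfolding f_def using eq that by blast
  qed
  have bij: "bij_betw f (dom.proj ` U) (cod.proj ` U)"
  proof (rule bij_betw_imageI)
    show "inj_on f (dom.proj ` U)"
    proof (rule inj_onI, elim imageE)
      fix P Q x y assume "f P = f Q" "P = dom.proj x" "x \<in> U" "Q = dom.proj y" "y \<in> U"
      then show "P = Q" using f eq by metis
    qed
    show "f ` dom.proj ` U = cod.proj ` U"
    proof (intro subset_antisym subsetI)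
      fix y assume "y \<in> cod.proj ` U"
      then obtain v where v: "v \<in> U" "y = cod.proj v" by auto
      then have "y = f (dom.proj (F' v))" using f[of "F' v"] F F' by simp
      then show "y \<in> f ` dom.proj ` U" using F' v by auto
    qed (use f F in auto)
  qed
  have inv: "inv_into (dom.proj ` U) f (cod.proj x) = dom.proj (F' x)" if "x \<in> U" for x
  proof -
    have "cod.proj x = f (dom.proj (F' x))" using f F F' that by simp
    then show ?thesis using bij F' that by (simp add: bij_betw_def)
  qed
  have "holomorphic_map (quotient_surface U G) (quotient_surface U G') f"
    using holomorphic_map_of_lift[OF F(1,2) f] .
  moreover have "holomorphic_map (quotient_surface U G') (quotient_surface U G) (inv_into (dom.proj ` U) f)"
    using rev.holomorphic_map_of_lift[OF F'(1,2) inv] .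
  ultimately show ?thesis
    unfolding biholomorphic_def fst_quotient_surface dom.topspace_quot cod.topspace_quot
    using bij by blast
qed

text \<open>The lifts of the biholomorphism and of its inverse are chosen independently, so
  \<open>F'\<close> after \<open>F\<close> is only some deck transformation \<open>g\<close>.
  Following \<open>F'\<close> by the inverse of \<open>g\<close> turns it into a left inverse of
  \<open>F\<close>.\<close>

lemma orbit_equivalence_of_biholomorphic:
  assumes sc: "simply_connected U"
    and bi: "biholomorphic (quotient_surface U G) (quotient_surface U G')"
  shows "\<exists>F F'. orbit_equivalence U G G' F F'"
proof -
  interpret rev: wandering_group_pair U G' G by unfold_locales
  obtain f where bij: "bij_betw f (dom.proj ` U) (cod.proj ` U)"
    and f: "holomorphic_map (quotient_surface U G) (quotient_surface U G') f"
    and f': "holomorphic_map (quotient_surface U G') (quotient_surface U G) (inv_into (dom.proj ` U) f)"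
    using bi unfolding biholomorphic_def fst_quotient_surface dom.topspace_quot cod.topspace_quot by blast
  let ?f' = "inv_into (dom.proj ` U) f"
  have cf: "continuous_map dom.quot cod.quot f" "continuous_map cod.quot dom.quot ?f'"
    using f f' unfolding holomorphic_map_def fst_quotient_surface by blast+
  have c: "continuous_map (top_of_set U) cod.quot (f \<circ> dom.proj)"
    "continuous_map (top_of_set U) dom.quot (?f' \<circ> cod.proj)"
    using continuous_map_compose quotient_imp_continuous_map[OF quotient_map_quotient_topology] cf by blast+
  obtain F where F: "continuous_on U F" "\<And>x. x \<in> U \<Longrightarrow> F x \<in> U" "\<And>x. x \<in> U \<Longrightarrow> cod.proj (F x) = f (dom.proj x)"
    by (rule cod.lift_to_cover[OF dom.open_U sc c(1)]) simp
  obtain F' where F': "continuous_on U F'" "\<And>x. x \<in> U \<Longrightarrow> F' x \<in> U" "\<And>x. x \<in> U \<Longrightarrow> dom.proj (F' x) = ?f' (cod.proj x)"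
    by (rule dom.lift_to_cover[OF dom.open_U sc c(2)]) simp
  have f'f: "?f' (f (dom.proj x)) = dom.proj x" "f (?f' (cod.proj x)) = cod.proj x" if "x \<in> U" for x
    using bij that by (auto simp: bij_betw_inv_into_left bij_betw_inv_into_right)
  have "connected U" using sc simply_connected_imp_connected by blast
  have "\<exists>g\<in>G. \<forall>x\<in>U. F' (F x) = g x"
    by (rule dom.deck_transformation[OF \<open>connected U\<close> continuous_on_compose2[OF F'(1) F(1)]])
      (use F F' f'f in auto)
  then obtain g where g: "g \<in> G" "\<And>x. x \<in> U \<Longrightarrow> F' (F x) = g x" by blast
  obtain h where h: "h \<in> G" "\<And>x. x \<in> U \<Longrightarrow> h (g x) = x" "\<And>x. x \<in> U \<Longrightarrow> g (h x) = x"
    using dom.G_inverse[OF g(1)] by metis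
  have "\<exists>k\<in>G'. \<forall>x\<in>U. F (F' x) = k x"
    by (rule cod.deck_transformation[OF \<open>connected U\<close> continuous_on_compose2[OF F(1) F'(1)]])
      (use F F' f'f in auto)
  then obtain k where k: "k \<in> G'" "\<And>x. x \<in> U \<Longrightarrow> F (F' x) = k x" by blast
  obtain l where l: "l \<in> G'" "\<And>x. x \<in> U \<Longrightarrow> l (k x) = x" "\<And>x. x \<in> U \<Longrightarrow> k (l x) = x"
    using cod.G_inverse[OF k(1)] by metis
  have left: "h (F' (F x)) = x" if "x \<in> U" for x using g h that by simp
  \<comment> \<open>\<open>F\<close> after \<open>F'\<close> is a deck transformation as well, so
    \<open>F\<close> is onto, and its left inverse is also a right inverse.\<close>
  have right: "F (h (F' x)) = x" if "x \<in> U" for x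
  proof -
    have "F (F' (l x)) = x" "l x \<in> U" using k l that cod.G_closed by auto
    then show ?thesis using left[of "F' (l x)"] F' by metis
  qed
  have holF: "holomorphic2_on F U"
    using holomorphic_lift[OF f F(1,2)] F(3) by metis
  have "holomorphic2_on F' U"
    using rev.holomorphic_lift[OF f' F'(1,2)] F'(3) by metis
  then have "holomorphic2_on (\<lambda>x. h (F' x)) U"
    using holomorphic2_on_compose[OF _ dom.holomorphic_G[OF h(1)]] F'(2) by blast
  moreover have "dom.proj x = dom.proj y \<longleftrightarrow> cod.proj (F x) = cod.proj (F y)" if "x \<in> U" "y \<in> U" for x y
    using F(3) f'f that by metis
  ultimately have "orbit_equivalence U G G' F (\<lambda>x. h (F' x))"
    unfolding orbit_equivalence_def using holF F(2) F'(2) left right h(1) dom.G_closed by auto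
  then show ?thesis by blast
qed

text \<open>\<open>F\<close> after \<open>g\<close> and \<open>F\<close> itself pass through the
  same orbits of \<open>G'\<close>, so they differ by one element of \<open>G'\<close>.\<close>

lemma orbit_equivalence_intertwines:
  assumes "connected U" and "orbit_equivalence U G G' F F'" and "g \<in> G"
  shows "\<exists>h\<in>G'. \<forall>x\<in>U. F (g x) = h (F x)"
proof (rule cod.deck_transformation[OF \<open>connected U\<close>])
  have F: "holomorphic2_on F U" "\<And>x. x \<in> U \<Longrightarrow> F x \<in> U"
    and eq: "\<And>x y. x \<in> U \<Longrightarrow> y \<in> U \<Longrightarrow> dom.proj x = dom.proj y \<Longrightarrow> cod.proj (F x) = cod.proj (F y)"
    using assms unfolding orbit_equivalence_def by auto
  show "continuous_on U F" using F holomorphic2_on_imp_continuous_on by blast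
  then show "continuous_on U (\<lambda>x. F (g x))"
    using continuous_on_compose2[OF _ dom.G_continuous[OF assms(3)]] assms(3) dom.G_closed by blast
  show "F x \<in> U" "F (g x) \<in> U" if "x \<in> U" for x using F dom.G_closed assms(3) that by auto
  show "cod.proj (F (g x)) = cod.proj (F x)" if "x \<in> U" for x
    using eq[of "g x" x] dom.proj_eq_iff[of x "g x"] assms(3) that dom.G_closed by metis
qed

end

section \<open>Arithmetic of the parameters\<close>

lemma row_mult_add: "row_mult (k + l) x = row_mult k x + row_mult l x"
  by (simp add: row_mult_def algebra_simps)

lemma row_mult_minus: "row_mult (- k) x = - row_mult k x"
  by (simp add: row_mult_def)

lemma row_mult_zero [simp]: "row_mult 0 x = 0"
  by (simp add: row_mult_def)

lemma row_mult_scaleR: "row_mult k (m *\<^sub>R x) = m * row_mult k x"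
  by (simp add: row_mult_def algebra_simps)

lemma row_mult_smult: "row_mult (d *s k) x = of_int d * row_mult k x"
  by (simp add: row_mult_def algebra_simps)

lemma axis_nth2 [simp]:
  "(axis 1 x :: int^2) $ 1 = x" "(axis 1 x :: int^2) $ 2 = 0"
  "(axis 2 x :: int^2) $ 1 = 0" "(axis 2 x :: int^2) $ 2 = x"
  by (auto simp: axis_def)

lemma row_mult_axis [simp]: "row_mult (axis i 1) x = x $ i"
  using exhaust_2[of i] by (auto simp: row_mult_def)

lemma row_mult_vector_matrix:
  fixes K :: "int^2^2"
  shows "row_mult (k v* K) x = of_int (k$1) * row_mult (K$1) x + of_int (k$2) * row_mult (K$2) x"
  by (simp add: row_mult_def vector_matrix_mult_def sum_2 algebra_simps)

lemma real_matrix_vector: "(real_matrix K *v x) $ i = row_mult (K$i) x"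
  by (simp add: real_matrix_def row_mult_def matrix_vector_mult_def sum_2)

lemma row_mult_real_matrix: "row_mult k (real_matrix K *v x) = row_mult (k v* K) x"
  unfolding row_mult_vector_matrix unfolding row_mult_def real_matrix_vector ..

lemma int2_induct:
  fixes k :: "int^2"
  assumes "P (axis 1 1)" "P (axis 2 1)"
    and add: "\<And>k l. P k \<Longrightarrow> P l \<Longrightarrow> P (k + l)" and minus: "\<And>k. P k \<Longrightarrow> P (- k)"
  shows "P k"
proof -
  have z: "P 0" using add[OF assms(1) minus[OF assms(1)]] by simp
  have *: "P (axis i n)" if "P (axis i 1)" for i :: 2 and n :: int
  proof (induction n rule: int_induct[where k = 0])
    case base
    then show ?case using z by (simp add: axis_def zero_vec_def if_distrib cong: if_cong)
  next
    case (step1 n)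
    have "axis i (n + 1) = axis i n + axis i (1::int)" by (auto simp: axis_def vec_eq_iff)
    then show ?case using add[OF step1(2) that] by simp
  next
    case (step2 n)
    have "axis i (n - 1) = axis i n + - axis i (1::int)" by (auto simp: axis_def vec_eq_iff)
    then show ?case using add[OF step2(2) minus[OF that]] by simp
  qed
  have "k = axis 1 (k$1) + axis 2 (k$2)" by (simp add: vec_eq_iff forall_2)
  then show ?thesis using add[OF *[OF assms(1)] *[OF assms(2)], of "k$1" "k$2"] by simp
qed

lemma wedge_neq_0_iff: "wedge b a \<noteq> 0 \<longleftrightarrow> a \<noteq> b \<and> independent {a, b}"
proof -
  have "a \<noteq> b \<and> independent {a, b} \<longleftrightarrow> b \<noteq> 0 \<and> a \<notin> span {b}"
    by (auto simp: independent_insert span_base)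
  also have "\<dots> \<longleftrightarrow> wedge b a \<noteq> 0"
  proof (cases "b = 0")
    case False
    have "a \<in> span {b} \<longleftrightarrow> wedge b a = 0"
    proof
      assume "a \<in> span {b}"
      then obtain k where "a = k *\<^sub>R b" by (auto simp: span_singleton)
      then show "wedge b a = 0" by (simp add: wedge_def)
    next
      assume w: "wedge b a = 0"
      have "\<exists>k. a = k *\<^sub>R b"
      proof (cases "b$1 = 0")
        case True
        with False have "b$2 \<noteq> 0" by (auto simp: vec_eq_iff forall_2)
        with w True show ?thesis
          by (intro exI[of _ "a$2 / b$2"]) (auto simp: vec_eq_iff forall_2 wedge_def)
      next
        case b1: False
        with w show ?thesis
          by (intro exI[of _ "a$1 / b$1"]) (auto simp: vec_eq_iff forall_2 wedge_def field_simps)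
      qed
      then show "a \<in> span {b}" by (auto simp: span_singleton)
    qed
    with False show ?thesis by auto
  qed (simp add: wedge_def)
  finally show ?thesis by blast
qed

text \<open>Cramer's rule with determinant \<open>wedge b a\<close>. Identities between integer rows
  are later proved by comparing their pairings with \<open>a\<close> and \<open>b\<close>, which are
  eigenvectors of the integer matrix \<open>N\<close>.\<close>

lemma row_mult_inj:
  assumes "wedge b a \<noteq> 0" "row_mult k a = row_mult l a" "row_mult k b = row_mult l b"
  shows "k = l"
proof -
  have "of_int (k$1 - l$1) * wedge b a
      = (row_mult k b - row_mult l b) * a$2 - (row_mult k a - row_mult l a) * b$2"
    "of_int (k$2 - l$2) * wedge b a
      = (row_mult k a - row_mult l a) * b$1 - (row_mult k b - row_mult l b) * a$1"
    by (simp_all add: row_mult_def wedge_def algebra_simps)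
  with assms have "k$1 = l$1" "k$2 = l$2" by auto
  then show ?thesis by (simp add: vec_eq_iff forall_2)
qed

text \<open>
  The composition \<open>g\<^sub>1\<close> to the power \<open>k\<^sub>1\<close> after \<open>g\<^sub>2\<close> to the power \<open>k\<^sub>2\<close> is
  \<open>(w, z) \<mapsto> (w + ka, z + (kb) w + delta a b c k)\<close>.
\<close>

definition delta :: "real^2 \<Rightarrow> real^2 \<Rightarrow> real^2 \<Rightarrow> int^2 \<Rightarrow> real" where
  "delta a b c k = row_mult k c
     + (of_int (k$1) * (of_int (k$1) - 1) * a$1 * b$1
        + of_int (k$2) * (of_int (k$2) - 1) * a$2 * b$2) / 2
     + of_int (k$1) * of_int (k$2) * b$1 * a$2"

lemma delta_axis [simp]: "delta a b c (axis i 1) = c $ i"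
  using exhaust_2[of i] by (auto simp: delta_def)

lemma delta_zero [simp]: "delta a b c 0 = 0"
  by (simp add: delta_def)

lemma wedge_eq_period: "r > 0 \<Longrightarrow> wedge b a = of_int (int r) * period a b r"
  by (simp add: period_def)

text \<open>\<open>wedge b a\<close> is the translation of z by the commutator of
  \<open>g\<^sub>1\<close> and \<open>g\<^sub>2\<close>, which is the r-th power of
  \<open>g\<^sub>3\<close>.\<close>

lemma rcong_wedge: "r > 0 \<Longrightarrow> [x + of_int n * wedge b a = x] (rmod period a b r)"
  unfolding rcong_altdef wedge_eq_period by (intro exI[of _ "- n * int r"]) (simp add: wedge_eq_period)

text \<open>The bilinear term comes from substituting the translated w into the linear term of the
  second component when two lattice elements are composed. Restoring the order of the generators
  costs \<open>k$2 * l$1\<close> commutators.\<close>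

lemma delta_add:
  assumes "r > 0"
  shows "[delta a b c (k + l) = delta a b c k + delta a b c l + row_mult k b * row_mult l a] (rmod period a b r)"
proof -
  have "delta a b c (k + l) = delta a b c k + delta a b c l + row_mult k b * row_mult l a
      + of_int (k$2 * l$1) * wedge b a"
    by (simp add: delta_def row_mult_def wedge_def field_simps)
  then show ?thesis using rcong_wedge[OF assms, of _ "k$2 * l$1" b a] by metis
qed

text \<open>Two functions with the same coboundary modulo \<open>P\<close> differ by a homomorphism.\<close>

lemma rcong_cocycle_unique:
  fixes f g :: "int^2 \<Rightarrow> real"
  assumes f: "\<And>k l. [f (k + l) = f k + f l + \<beta> k l] (rmod P)"
    and g: "\<And>k l. [g (k + l) = g k + g l + \<beta> k l] (rmod P)"
    and gen: "\<And>i. [f (axis i 1) = g (axis i 1)] (rmod P)"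
  shows "[f k = g k] (rmod P)"
proof -
  define h where "h k = f k - g k" for k
  have h: "[h (k + l) = h k + h l] (rmod P)" for k l
    using rcong_diff[OF f[of k l] g[of k l]] by (simp add: h_def algebra_simps)
  have h0: "[h 0 = 0] (rmod P)" using rcong_diff[OF h[of 0 0], of "h 0" "h 0"] by (simp add: rcong_sym_iff)
  have "[h k = 0] (rmod P)"
  proof (induction k rule: int2_induct)
    case 1
    then show ?case using rcong_diff[OF gen[of 1], of "g (axis 1 1)" "g (axis 1 1)"] by (simp add: h_def)
  next
    case 2
    then show ?case using rcong_diff[OF gen[of 2], of "g (axis 2 1)" "g (axis 2 1)"] by (simp add: h_def)
  next
    case (3 k l)
    then show ?case using rcong_trans[OF h[of k l]] rcong_add[OF 3] by simp
  next
    case (4 k)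
    have "[h k + h (-k) = 0] (rmod P)" using rcong_trans[OF rcong_sym[OF h[of k "-k"]]] h0 by simp
    from rcong_diff[OF this 4] show ?case by simp
  qed
  from rcong_add[OF this, of "g k" "g k"] show ?thesis by (simp add: h_def)
qed

text \<open>By \<open>cross\<close> both sides have the same coboundary, so it suffices to compare
  them on the rows of \<open>K\<close>. The instances are conjugation by \<open>g\<^sub>0\<close>,
  with \<open>N\<close> for \<open>K\<close>, and a change of basis.\<close>

lemma delta_vector_matrix:
  assumes "r > 0"
    and gen: "\<And>i. [delta a b c (K$i) = delta a' b' c' (axis i 1)] (rmod period a b r)"
    and per: "\<And>k l. [delta a' b' c' (k + l) = delta a' b' c' k + delta a' b' c' l + row_mult k b' * row_mult l a'] (rmod period a b r)"
    and cross: "\<And>k l. row_mult (k v* K) b * row_mult (l v* K) a = row_mult k b' * row_mult l a'"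
  shows "[delta a b c (k v* K) = delta a' b' c' k] (rmod period a b r)"
proof (rule rcong_cocycle_unique[where \<beta> = "\<lambda>k l. row_mult k b' * row_mult l a'", OF _ per])
  fix k l :: "int^2"
  have "(k + l) v* K = k v* K + l v* K"
    by (simp add: vec_eq_iff vector_matrix_mult_def sum_2 algebra_simps)
  then show "[delta a b c ((k + l) v* K) = delta a b c (k v* K) + delta a b c (l v* K) + row_mult k b' * row_mult l a'] (rmod period a b r)"
    using delta_add[OF assms(1), of a b c "k v* K" "l v* K"] cross by simp
next
  fix i :: 2
  have "axis i 1 v* K = K $ i"
    using exhaust_2[of i] by (auto simp: vec_eq_iff vector_matrix_mult_def sum_2)
  then show "[delta a b c (axis i 1 v* K) = delta a' b' c' (axis i 1)] (rmod period a b r)"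
    using gen by simp
qed

text \<open>The integer form of \<open>N_matrix\<close>, characterised by its eigenvectors row by
  row. It replaces both the integrality of the entries and the matrix inverse.\<close>

definition lattice_matrix :: "real \<Rightarrow> real^2 \<Rightarrow> real^2 \<Rightarrow> int^2^2 \<Rightarrow> bool" where
  "lattice_matrix \<alpha> a b N \<longleftrightarrow>
     (\<forall>i. row_mult (N$i) a = \<alpha> * a$i \<and> row_mult (N$i) b = inverse \<alpha> * b$i)"

lemma Q_matrix_mult:
  "M ** Q_matrix a b = Q_matrix (M *v a) (M *v b)"
  "Q_matrix a b ** (\<chi> i j. if i = j then (if i = 1 then \<alpha> else inverse \<alpha>) else 0) = Q_matrix (\<alpha> *\<^sub>R a) (inverse \<alpha> *\<^sub>R b)"
  by (auto simp: Q_matrix_def matrix_matrix_mult_def matrix_vector_mult_def vec_eq_iff forall_2 sum_2)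

lemma Q_matrix_inverse:
  assumes "wedge b a \<noteq> 0"
  shows "matrix_inv (Q_matrix a b) ** Q_matrix a b = mat 1" "Q_matrix a b ** matrix_inv (Q_matrix a b) = mat 1"
proof -
  have "det (Q_matrix a b) \<noteq> 0"
    using assms by (auto simp: det_2 Q_matrix_def wedge_def algebra_simps)
  then have "invertible (Q_matrix a b)" by (simp add: invertible_det_nz)
  then show "matrix_inv (Q_matrix a b) ** Q_matrix a b = mat 1" "Q_matrix a b ** matrix_inv (Q_matrix a b) = mat 1"
    unfolding matrix_inv_def invertible_def by (rule someI2_ex, simp)+
qed

lemma N_matrix_eqI:
  assumes "wedge b a \<noteq> 0" "M *v a = \<alpha> *\<^sub>R a" "M *v b = inverse \<alpha> *\<^sub>R b"
  shows "N_matrix \<alpha> a b = M"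
proof -
  have "N_matrix \<alpha> a b = M ** Q_matrix a b ** matrix_inv (Q_matrix a b)"
    unfolding N_matrix_def Q_matrix_mult assms ..
  then show ?thesis
    by (simp add: Q_matrix_inverse[OF assms(1)] flip: matrix_mul_assoc)
qed

lemma N_matrix_vector:
  assumes "wedge b a \<noteq> 0"
  shows "N_matrix \<alpha> a b *v a = \<alpha> *\<^sub>R a" "N_matrix \<alpha> a b *v b = inverse \<alpha> *\<^sub>R b"
proof -
  have "Q_matrix (N_matrix \<alpha> a b *v a) (N_matrix \<alpha> a b *v b) = Q_matrix (\<alpha> *\<^sub>R a) (inverse \<alpha> *\<^sub>R b)"
    unfolding Q_matrix_mult[symmetric] N_matrix_def
    by (simp add: Q_matrix_inverse[OF assms(1)] flip: matrix_mul_assoc)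
  then show "N_matrix \<alpha> a b *v a = \<alpha> *\<^sub>R a" "N_matrix \<alpha> a b *v b = inverse \<alpha> *\<^sub>R b"
    by (auto simp: Q_matrix_def vec_eq_iff forall_2)
qed

lemma lattice_matrix_iff:
  "lattice_matrix \<alpha> a b N \<longleftrightarrow> real_matrix N *v a = \<alpha> *\<^sub>R a \<and> real_matrix N *v b = inverse \<alpha> *\<^sub>R b"
  unfolding lattice_matrix_def by (simp add: vec_eq_iff real_matrix_vector forall_2) blast

text \<open>Conjugating the i-th lattice generator by \<open>g\<^sub>0\<close> multiplies
  \<open>a$i\<close> by \<alpha>, divides \<open>b$i\<close> by it and keeps the constant
  \<open>c$i\<close>. The condition says that the element with exponents \<open>N$i\<close> has this
  same constant up to a power of \<open>g\<^sub>3\<close>.\<close>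

lemma mem_C_set_iff:
  assumes "wedge b a \<noteq> 0" and N: "lattice_matrix \<alpha> a b N" and "\<alpha> \<noteq> 0"
  shows "c \<in> C_set \<alpha> a b r \<longleftrightarrow> (\<forall>i. [delta a b c (N$i) = c$i] (rmod period a b r))"
proof -
  let ?v = "(mat 1 - N_matrix \<alpha> a b) *v (c - (1/2) *\<^sub>R cwise a b)
           - (wedge b a / 2) *\<^sub>R (\<chi> i. N_matrix \<alpha> a b $ i $ 1 * N_matrix \<alpha> a b $ i $ 2)"
  have Nm: "N_matrix \<alpha> a b = real_matrix N"
    using N assms(1) by (intro N_matrix_eqI) (auto simp: lattice_matrix_iff)
  have v: "?v $ i = c $ i - delta a b c (N $ i)" for i
  proof -
    \<comment> \<open>For every \<open>k\<close>, \<open>delta a b c k\<close> is the pairing of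
      \<open>k\<close> with \<open>c - (1/2) *\<^sub>R cwise a b\<close>, plus half of (ka)(kb),
      plus half of \<open>k$1 * k$2 * wedge b a\<close>. Since the eigenvalues are inverse to each
      other, (ka)(kb) is again \<open>a$i * b$i\<close> for the row \<open>N$i\<close>.\<close>
    have "row_mult (N$i) a * row_mult (N$i) b = a$i * b$i"
      using N \<open>\<alpha> \<noteq> 0\<close> by (simp add: lattice_matrix_def)
    moreover have "?v $ i = c$i - a$i * b$i / 2 - row_mult (N$i) (c - (1/2) *\<^sub>R cwise a b)
        - wedge b a / 2 * of_int (N$i$1) * of_int (N$i$2)"
      by (simp add: Nm matrix_vector_mult_diff_rdistrib real_matrix_vector cwise_def)
        (simp add: real_matrix_def)
    ultimately show ?thesis
      by (simp add: delta_def row_mult_def wedge_def cwise_def field_simps)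
  qed
  have "c \<in> C_set \<alpha> a b r \<longleftrightarrow> ?v \<in> lattice2 a b r" by (simp add: C_set_def)
  also have "\<dots> \<longleftrightarrow> (\<forall>i. \<exists>n::int. ?v $ i = period a b r * of_int n)"
  proof
    assume "?v \<in> lattice2 a b r"
    then obtain w :: "real^2" where w: "?v = period a b r *\<^sub>R w" "\<And>i. w $ i \<in> \<int>" by (auto simp: lattice2_def)
    show "\<forall>i. \<exists>n::int. ?v $ i = period a b r * of_int n"
    proof
      fix i
      from w(2) obtain n where "w $ i = of_int n" by (auto elim: Ints_cases)
      then show "\<exists>n::int. ?v $ i = period a b r * of_int n" unfolding w(1) by auto
    qed
  next
    assume "\<forall>i. \<exists>n::int. ?v $ i = period a b r * of_int n"
    then obtain n :: "2 \<Rightarrow> int" where "\<And>i. ?v $ i = period a b r * of_int (n i)" by metis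
    then have "?v = period a b r *\<^sub>R (\<chi> i. of_int (n i))" by (simp add: vec_eq_iff)
    then show "?v \<in> lattice2 a b r" unfolding lattice2_def
      by (intro CollectI exI[of _ "\<chi> i. of_int (n i)"]) auto
  qed
  also have "\<dots> \<longleftrightarrow> (\<forall>i. [delta a b c (N$i) = c$i] (rmod period a b r))"
    unfolding v rcong_altdef by (simp add: algebra_simps)
  finally show ?thesis .
qed

lemma mem_param_set_iff:
  assumes "\<alpha> \<noteq> 0"
  shows "(a, b, c, t) \<in> param_set \<alpha> r \<longleftrightarrow>
    wedge b a \<noteq> 0 \<and> (\<exists>N. lattice_matrix \<alpha> a b N \<and> (\<forall>i. [delta a b c (N$i) = c$i] (rmod period a b r)))"
proof -
  have "(\<forall>i j. N_matrix \<alpha> a b $ i $ j \<in> \<int>) \<longleftrightarrow> (\<exists>N. lattice_matrix \<alpha> a b N)" if w: "wedge b a \<noteq> 0"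
  proof
    assume "\<forall>i j. N_matrix \<alpha> a b $ i $ j \<in> \<int>"
    then have "\<forall>i j. \<exists>n. N_matrix \<alpha> a b $ i $ j = of_int n" by (meson Ints_cases)
    then obtain n where "\<And>i j. N_matrix \<alpha> a b $ i $ j = of_int (n i j)" by metis
    then have "N_matrix \<alpha> a b = real_matrix (\<chi> i j. n i j)" by (simp add: real_matrix_def vec_eq_iff)
    then show "\<exists>N. lattice_matrix \<alpha> a b N"
      using N_matrix_vector[OF w, of \<alpha>] by (auto simp: lattice_matrix_iff)
  next
    assume "\<exists>N. lattice_matrix \<alpha> a b N"
    then obtain N where "lattice_matrix \<alpha> a b N" by auto
    then have "N_matrix \<alpha> a b = real_matrix N"
      using w by (intro N_matrix_eqI) (auto simp: lattice_matrix_iff)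
    then show "\<forall>i j. N_matrix \<alpha> a b $ i $ j \<in> \<int>" by (simp add: real_matrix_def)
  qed
  then have "(a, b) \<in> compatible_pairs \<alpha> \<longleftrightarrow> wedge b a \<noteq> 0 \<and> (\<exists>N. lattice_matrix \<alpha> a b N)"
    using wedge_neq_0_iff[of b a] by (auto simp: compatible_pairs_def)
  then show ?thesis
    unfolding param_set_def using mem_C_set_iff[OF _ _ assms] by blast
qed

section \<open>Normal form of the groups\<close>

text \<open>The dilation is applied after the translation, as when a power of
  \<open>g\<^sub>0\<close> follows a lattice element. The restriction makes the map extensional, as
  membership in \<open>BijGroup\<close> demands.\<close>

definition affine_map :: "real \<Rightarrow> real \<Rightarrow> real \<Rightarrow> complex \<Rightarrow> complex \<times> complex \<Rightarrow> complex \<times> complex" where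
  "affine_map m x y s = (\<lambda>(w, z)\<in>U_dom. (of_real m * (w + of_real x), z + of_real y * w + s))"

lemma affine_map_apply:
  "Im w > 0 \<Longrightarrow> affine_map m x y s (w, z) = (of_real m * (w + of_real x), z + of_real y * w + s)"
  by (simp add: affine_map_def U_dom_def)

lemma mem_U_dom [simp]: "(w, z) \<in> U_dom \<longleftrightarrow> Im w > 0"
  by (simp add: U_dom_def)

lemma affine_map_U_dom: "m > 0 \<Longrightarrow> u \<in> U_dom \<Longrightarrow> affine_map m x y s u \<in> U_dom"
  by (cases u) (simp add: affine_map_apply)

lemma affine_map_extensional: "affine_map m x y s \<in> extensional U_dom"
  by (simp add: affine_map_def)

lemma affine_map_eqI:
  assumes "m = m'" "x = x'" "y = y'" "s = s'"
  shows "affine_map m x y s = affine_map m' x' y' s'"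
  using assms by simp

lemma affine_map_id: "affine_map 1 0 0 0 = (\<lambda>u\<in>U_dom. u)"
  unfolding affine_map_def by (rule restrict_ext) auto

lemma affine_map_compose:
  assumes "m' > 0" "m \<noteq> 0"
  shows "compose U_dom (affine_map m x y s) (affine_map m' x' y' s') =
    affine_map (m * m') (x' + x / m') (y' + y * m') (s + s' + of_real (y * m' * x'))"
proof (rule extensionalityI[where A = U_dom])
  fix u assume "u \<in> U_dom"
  then show "compose U_dom (affine_map m x y s) (affine_map m' x' y' s') u =
    affine_map (m * m') (x' + x / m') (y' + y * m') (s + s' + of_real (y * m' * x')) u"
    using assms by (cases u) (simp add: compose_def affine_map_apply algebra_simps)
qed (simp_all add: affine_map_extensional)

lemma affine_map_Bij:
  assumes "m > 0"
  shows "affine_map m x y s \<in> Bij U_dom"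
proof -
  let ?g = "affine_map (1/m) (- m * x) (- y / m) (of_real (x * y) - s)"
  have 1: "compose U_dom ?g (affine_map m x y s) = (\<lambda>u\<in>U_dom. u)"
    "compose U_dom (affine_map m x y s) ?g = (\<lambda>u\<in>U_dom. u)"
    using assms by (subst affine_map_compose, simp_all add: affine_map_id[symmetric])+
  have "bij_betw (affine_map m x y s) U_dom U_dom"
  proof (rule bij_betw_byWitness[where f' = ?g])
    show "\<forall>u\<in>U_dom. ?g (affine_map m x y s u) = u"
      using fun_cong[OF 1(1)] by (auto simp: compose_def split: if_splits) metis
    show "\<forall>u\<in>U_dom. affine_map m x y s (?g u) = u"
      using fun_cong[OF 1(2)] by (auto simp: compose_def split: if_splits) metis
  qed (use assms affine_map_U_dom in \<open>auto simp del: mem_U_dom\<close>)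
  then show ?thesis by (simp add: Bij_def affine_map_extensional)
qed

lemma open_U_dom: "open U_dom"
proof -
  have "U_dom = {w. Im w > 0} \<times> UNIV" by (auto simp: U_dom_def)
  then show ?thesis by (metis open_Times open_halfspace_Im_gt open_UNIV)
qed

lemma convex_U_dom: "convex U_dom"
proof -
  have "U_dom = {w. Im w > 0} \<times> UNIV" by (auto simp: U_dom_def)
  then show ?thesis by (metis convex_Times convex_halfspace_Im_gt convex_UNIV)
qed

lemma holomorphic2_affine_map: "holomorphic2_on (affine_map m x y s) U_dom"
proof (rule holomorphic2_on_cong[OF open_U_dom])
  show "holomorphic2_on (\<lambda>(w, z). (of_real m * w + of_real (m * x), 1 * z + of_real y * w + s)) U_dom"
    by (rule holomorphic2_on_affine)
  show "affine_map m x y s u = (\<lambda>(w, z). (of_real m * w + of_real (m * x), 1 * z + of_real y * w + s)) u"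
    if "u \<in> U_dom" for u
    using that by (cases u) (simp add: affine_map_apply algebra_simps)
qed

locale inoue =
  fixes \<alpha> :: real and r :: nat and a b c :: "real^2" and t :: complex
  assumes \<alpha>_gt_1: "\<alpha> > 1" and r_pos: "r > 0" and param: "(a, b, c, t) \<in> param_set \<alpha> r"
begin

abbreviation P where "P \<equiv> period a b r"
abbreviation \<delta> where "\<delta> \<equiv> delta a b c"

lemma \<alpha>_nonzero [simp]: "\<alpha> \<noteq> 0"
  using \<alpha>_gt_1 by simp

lemma wedge_nonzero: "wedge b a \<noteq> 0"
  using param \<alpha>_gt_1 mem_param_set_iff[of \<alpha>] by auto

lemma P_nonzero: "P \<noteq> 0"
  using wedge_nonzero r_pos by (simp add: period_def)

definition N where
  "N = (SOME N. lattice_matrix \<alpha> a b N \<and> (\<forall>i. [\<delta> (N$i) = c$i] (rmod P)))"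

lemma N: "lattice_matrix \<alpha> a b N" "[\<delta> (N$i) = c$i] (rmod P)"
proof -
  have "\<exists>N. lattice_matrix \<alpha> a b N \<and> (\<forall>i. [\<delta> (N$i) = c$i] (rmod P))"
    using param \<alpha>_gt_1 mem_param_set_iff[of \<alpha>] by auto
  from someI_ex[OF this] show "lattice_matrix \<alpha> a b N" "[\<delta> (N$i) = c$i] (rmod P)"
    by (auto simp: N_def)
qed

lemma row_mult_N:
  "row_mult (k v* N) a = \<alpha> * row_mult k a" "row_mult (k v* N) b = row_mult k b / \<alpha>"
proof -
  have e: "row_mult (N$i) a = \<alpha> * a$i" "row_mult (N$i) b = inverse \<alpha> * b$i" for i
    using N(1) by (auto simp: lattice_matrix_def)
  show "row_mult (k v* N) a = \<alpha> * row_mult k a" "row_mult (k v* N) b = row_mult k b / \<alpha>"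
    unfolding row_mult_vector_matrix e by (simp_all add: row_mult_def divide_inverse algebra_simps)
qed

text \<open>\<open>N\<close> scales the pairings with \<open>a\<close> and with \<open>b\<close> by
  inverse factors, so it preserves the bilinear term and the condition on its rows extends to all
  exponents.\<close>

lemma delta_N: "[\<delta> (k v* N) = \<delta> k] (rmod P)"
proof (rule delta_vector_matrix[OF r_pos])
  show "[\<delta> (N $ i) = \<delta> (axis i 1)] (rmod P)" for i using N(2) by simp
  show "row_mult (k v* N) b * row_mult (l v* N) a = row_mult k b * row_mult l a" for k l
    using \<alpha>_gt_1 by (simp add: row_mult_N)
qed (rule delta_add[OF r_pos])

lemma trace_N: "of_int (N$1$1 + N$2$2) = \<alpha> + 1 / \<alpha>"
proof -
  have e: "of_int (N$1$1) * a$1 + of_int (N$1$2) * a$2 = \<alpha> * a$1"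
    "of_int (N$2$1) * a$1 + of_int (N$2$2) * a$2 = \<alpha> * a$2"
    "of_int (N$1$1) * b$1 + of_int (N$1$2) * b$2 = inverse \<alpha> * b$1"
    "of_int (N$2$1) * b$1 + of_int (N$2$2) * b$2 = inverse \<alpha> * b$2"
    using N(1) unfolding lattice_matrix_def row_mult_def by blast+
  have "of_int (N$1$1 + N$2$2) * wedge b a
      = (of_int (N$1$1) * b$1 + of_int (N$1$2) * b$2) * a$2 - (of_int (N$1$1) * a$1 + of_int (N$1$2) * a$2) * b$2
       + (of_int (N$2$1) * a$1 + of_int (N$2$2) * a$2) * b$1 - (of_int (N$2$1) * b$1 + of_int (N$2$2) * b$2) * a$1"
    by (simp add: wedge_def algebra_simps)
  also have "\<dots> = (\<alpha> + 1 / \<alpha>) * wedge b a"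
    unfolding e by (simp add: wedge_def divide_inverse algebra_simps)
  finally show ?thesis using wedge_nonzero by simp
qed

text \<open>The row is the trace of \<open>N\<close> times \<open>k\<close> minus
  \<open>k v* N\<close>. By Cayley-Hamilton this is \<open>k\<close> times the inverse of
  \<open>N\<close>, because \<open>N\<close> has determinant 1.\<close>

lemma lattice_step:
  "\<exists>l. row_mult l a = row_mult k a / \<alpha> \<and> row_mult l b = \<alpha> * row_mult k b \<and> [\<delta> l = \<delta> k] (rmod P)"
proof -
  let ?T = "N$1$1 + N$2$2"
  define l where "l = ?T *s k + - (k v* N)"
  have l: "row_mult l a = row_mult k a / \<alpha>" "row_mult l b = \<alpha> * row_mult k b"
    using \<alpha>_gt_1 unfolding l_def row_mult_add row_mult_minus row_mult_smult row_mult_N trace_N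
    by (simp_all add: field_simps)
  have "l v* N = k"
    using \<alpha>_gt_1 by (intro row_mult_inj[OF wedge_nonzero]) (simp_all add: row_mult_N l)
  then show ?thesis using l delta_N[of l] by (metis rcong_sym)
qed

text \<open>The row is \<open>k\<close> times the n-th power of \<open>N\<close>. So the set of
  numbers \<open>row_mult k a\<close> is stable under all powers of \<alpha>, which is the source of
  arbitrarily small translations.\<close>

lemma lattice_scale:
  "\<exists>l. row_mult l a = \<alpha> powi n * row_mult k a \<and> row_mult l b = \<alpha> powi (- n) * row_mult k b \<and> [\<delta> l = \<delta> k] (rmod P)"
proof (induction n rule: int_induct[where k = 0])
  case base
  show ?case by (intro exI[of _ k]) simp
next
  case (step1 n)
  then obtain l where l: "row_mult l a = \<alpha> powi n * row_mult k a" "row_mult l b = \<alpha> powi (- n) * row_mult k b" "[\<delta> l = \<delta> k] (rmod P)"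
    by auto
  show ?case
    using l \<alpha>_gt_1 rcong_trans[OF delta_N[of l] l(3)]
    by (intro exI[of _ "l v* N"])
      (auto simp: row_mult_N power_int_add power_int_diff power_int_minus field_simps)
next
  case (step2 n)
  then obtain l where l: "row_mult l a = \<alpha> powi n * row_mult k a" "row_mult l b = \<alpha> powi (- n) * row_mult k b" "[\<delta> l = \<delta> k] (rmod P)"
    by auto
  obtain l' where l': "row_mult l' a = row_mult l a / \<alpha>" "row_mult l' b = \<alpha> * row_mult l b" "[\<delta> l' = \<delta> l] (rmod P)"
    using lattice_step by blast
  show ?case
    using l l' \<alpha>_gt_1 rcong_trans[OF l'(3) l(3)]
    by (intro exI[of _ l']) (auto simp: power_int_add power_int_diff power_int_minus field_simps)
qed

text \<open>The normal form \<open>g\<^sub>0\<^sup>n g\<^sub>1 g\<^sub>2 g\<^sub>3\<close>, with exponents \<open>n\<close>, \<open>k\<^sub>1\<close>, \<open>k\<^sub>2\<close> and \<open>j\<close>.\<close>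

definition T where
  "T n k j = affine_map (\<alpha> powi n) (row_mult k a) (row_mult k b) (of_real (\<delta> k + P * of_int j) + of_int n * t)"

lemma T_apply:
  "Im w > 0 \<Longrightarrow> T n k j (w, z) = (of_real (\<alpha> powi n) * (w + of_real (row_mult k a)),
     z + of_real (row_mult k b) * w + of_real (\<delta> k + P * of_int j) + of_int n * t)"
  by (simp add: T_def affine_map_apply algebra_simps)

lemma T_zero: "T 0 0 0 = (\<lambda>u\<in>U_dom. u)"
  by (simp add: T_def flip: affine_map_id)

lemma powi_pos [simp]: "\<alpha> powi n > 0"
  using \<alpha>_gt_1 by (simp add: zero_less_power_int)

lemma T_Bij: "T n k j \<in> Bij U_dom"
  unfolding T_def by (rule affine_map_Bij) simp

text \<open>Moving the power \<open>n'\<close> of \<open>g\<^sub>0\<close> to the left past the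
  exponents \<open>k\<close> turns them into \<open>l\<close>, which is \<open>k\<close> times the
  power \<open>- n'\<close> of \<open>N\<close>. The correction \<open>i\<close> is independent of
  \<open>j\<close> and \<open>j'\<close> because \<open>g\<^sub>3\<close> is central.\<close>

lemma T_compose_twisted:
  assumes "row_mult l a = \<alpha> powi (- n') * row_mult k a" "row_mult l b = \<alpha> powi n' * row_mult k b"
    and "[\<delta> l = \<delta> k] (rmod P)"
  shows "\<exists>i. \<forall>j j'. compose U_dom (T n k j) (T n' k' j') = T (n + n') (l + k') (j + j' + i)"
proof -
  have "[\<delta> (l + k') = \<delta> k + \<delta> k' + row_mult l b * row_mult k' a] (rmod P)"
    using delta_add[OF r_pos] rcong_add[OF rcong_add[OF assms(3) rcong_refl] rcong_refl] rcong_trans by blast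
  then obtain i where i: "\<delta> k + \<delta> k' + row_mult l b * row_mult k' a = \<delta> (l + k') + of_int i * P"
    unfolding rcong_altdef by auto
  have "compose U_dom (T n k j) (T n' k' j') = T (n + n') (l + k') (j + j' + i)" for j j'
    unfolding T_def
  proof (subst affine_map_compose)
    show "affine_map (\<alpha> powi n * \<alpha> powi n') (row_mult k' a + row_mult k a / \<alpha> powi n') (row_mult k' b + row_mult k b * \<alpha> powi n')
     (complex_of_real (\<delta> k + P * real_of_int j) + of_int n * t + (complex_of_real (\<delta> k' + P * real_of_int j') + of_int n' * t) +
      complex_of_real (row_mult k b * \<alpha> powi n' * row_mult k' a)) =
    affine_map (\<alpha> powi (n + n')) (row_mult (l + k') a) (row_mult (l + k') b)
     (complex_of_real (\<delta> (l + k') + P * real_of_int (j + j' + i)) + of_int (n + n') * t)"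
    proof (rule affine_map_eqI)
      have "complex_of_real (\<delta> k + \<delta> k' + row_mult l b * row_mult k' a) = complex_of_real (\<delta> (l + k') + of_int i * P)"
        using i by simp
      then show "(complex_of_real (\<delta> k + P * real_of_int j) + of_int n * t + (complex_of_real (\<delta> k' + P * real_of_int j') + of_int n' * t) +
          complex_of_real (row_mult k b * \<alpha> powi n' * row_mult k' a)) =
          (complex_of_real (\<delta> (l + k') + P * real_of_int (j + j' + i)) + of_int (n + n') * t)"
        unfolding of_real_add of_real_mult assms(2) by (simp add: algebra_simps)
    qed (use assms \<alpha>_gt_1 in \<open>auto simp: row_mult_add power_int_add power_int_minus field_simps\<close>)
  qed (simp_all add: less_imp_neq[OF powi_pos, symmetric])
  then show ?thesis by blast
qed

lemma T_compose: "\<exists>l i. \<forall>j j'. compose U_dom (T n k j) (T n' k' j') = T (n + n') (l + k') (j + j' + i)"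
  using lattice_scale[of "- n'" k] T_compose_twisted[of _ n' k n k'] by (metis minus_minus)

lemma T_compose_0: "\<exists>i. \<forall>j j'. compose U_dom (T n k j) (T 0 k' j') = T n (k + k') (j + j' + i)"
  using T_compose_twisted[of k 0 k n k'] by simp

lemma T_left_inverse: "\<exists>n' k' j'. compose U_dom (T n' k' j') (T n k j) = T 0 0 0"
proof -
  obtain l where l: "row_mult l a = \<alpha> powi n * row_mult k a" "row_mult l b = \<alpha> powi (- n) * row_mult k b" "[\<delta> l = \<delta> k] (rmod P)"
    using lattice_scale by blast
  \<comment> \<open>The inverse has exponents \<open>- n\<close> and \<open>- l\<close>. The row
    \<open>l'\<close> turns out to be \<open>- k\<close>; taking it from
    \<open>lattice_scale\<close> also brings the congruence of the constant terms.\<close>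
  obtain l' where l': "row_mult l' a = \<alpha> powi (- n) * row_mult (- l) a" "row_mult l' b = \<alpha> powi (- (- n)) * row_mult (- l) b" "[\<delta> l' = \<delta> (- l)] (rmod P)"
    using lattice_scale by blast
  have "l' = - k"
    using l l' less_imp_neq[OF powi_pos, of n]
    by (intro row_mult_inj[OF wedge_nonzero]) (auto simp: row_mult_minus power_int_minus field_simps)
  then have "\<exists>i. \<forall>j j'. compose U_dom (T (- n) (- l) j) (T n k j') = T (- n + n) (- k + k) (j + j' + i)"
    using l' by (intro T_compose_twisted) auto
  then obtain i where "\<And>j j'. compose U_dom (T (- n) (- l) j) (T n k j') = T (- n + n) (- k + k) (j + j' + i)" by auto
  from this[of "- j - i" j] have "compose U_dom (T (- n) (- l) (- j - i)) (T n k j) = T 0 0 0" by simp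
  then show ?thesis by blast
qed

abbreviation G where "G \<equiv> inoue_group \<alpha> a b c r t"

lemma generators: "inoue_generators \<alpha> a b c r t = {T 1 0 0, T 0 (axis 1 1) 0, T 0 (axis 2 1) 0, T 0 0 1}"
  unfolding inoue_generators_def T_def affine_map_def by simp

definition T_range where "T_range = {T n k j | n k j. True}"

lemma T_in_range [simp]: "T n k j \<in> T_range"
  by (auto simp: T_range_def)

lemma mult_BijGroup_T: "T n k j \<otimes>\<^bsub>BijGroup U_dom\<^esub> T n' k' j' = compose U_dom (T n k j) (T n' k' j')"
  by (simp add: BijGroup_def T_Bij)

lemma subgroup_T_range: "subgroup T_range (BijGroup U_dom)"
proof (rule group.subgroupI[OF group_BijGroup])
  show "T_range \<subseteq> carrier (BijGroup U_dom)" by (auto simp: T_range_def BijGroup_def T_Bij)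
  show "T_range \<noteq> {}" by (auto simp: T_range_def)
  show "inv\<^bsub>BijGroup U_dom\<^esub> g \<in> T_range" if g: "g \<in> T_range" for g
  proof -
    obtain n k j where g: "g = T n k j" using g by (auto simp: T_range_def)
    obtain n' k' j' where "compose U_dom (T n' k' j') g = T 0 0 0"
      using T_left_inverse g by blast
    then have "inv\<^bsub>BijGroup U_dom\<^esub> g = T n' k' j'"
      by (intro group.inv_equality[OF group_BijGroup])
        (simp_all add: g mult_BijGroup_T T_zero, simp_all add: BijGroup_def T_Bij)
    then show ?thesis by simp
  qed
  show "g \<otimes>\<^bsub>BijGroup U_dom\<^esub> h \<in> T_range" if "g \<in> T_range" "h \<in> T_range" for g h
    using that T_compose by (auto simp: T_range_def mult_BijGroup_T) metis
qed

text \<open>Stated for any subgroup, because it serves both to identify the generated group and to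
  extend an intertwining relation from the generators to the whole group.\<close>

lemma T_mem_subgroup:
  assumes H: "subgroup H (BijGroup U_dom)"
    and gen: "T 1 0 0 \<in> H" "T 0 (axis 1 1) 0 \<in> H" "T 0 (axis 2 1) 0 \<in> H" "T 0 0 1 \<in> H"
  shows "T n k j \<in> H"
proof -
  have mult: "compose U_dom (T n k j) (T n' k' j') \<in> H" if "T n k j \<in> H" "T n' k' j' \<in> H" for n k j n' k' j'
    using subgroup.m_closed[OF H that] by (simp add: mult_BijGroup_T)
  have inv: "T n' k' j' \<in> H" if "T n k j \<in> H" "compose U_dom (T n' k' j') (T n k j) = T 0 0 0" for n k j n' k' j'
  proof -
    have "inv\<^bsub>BijGroup U_dom\<^esub> (T n k j) = T n' k' j'"
      using that(2) by (intro group.inv_equality[OF group_BijGroup])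
        (simp_all add: mult_BijGroup_T T_zero, simp_all add: BijGroup_def T_Bij)
    then show ?thesis using subgroup.m_inv_closed[OF H that(1)] by simp
  qed
  have 0: "compose U_dom (T n 0 j) (T n' 0 j') = T (n + n') 0 (j + j')" for n n' j j'
    unfolding T_def by (subst affine_map_compose) (auto simp: power_int_add \<alpha>_gt_1 less_imp_neq[OF powi_pos, symmetric] algebra_simps)
  have one: "T 0 0 0 \<in> H" using subgroup.one_closed[OF H] by (simp add: T_zero BijGroup_def)
  have neg: "T (- 1) 0 0 \<in> H" "T 0 0 (- 1) \<in> H"
    using inv[OF gen(1), of "-1" 0 0] inv[OF gen(4), of 0 0 "-1"] by (simp_all add: 0)
  have j: "T 0 0 j \<in> H" for j
  proof (induction j rule: int_induct[where k = 0])
    case (step1 i)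
    then show ?case using mult[OF step1(2) gen(4)] by (simp add: 0)
  next
    case (step2 i)
    then show ?case using mult[OF step2(2) neg(2)] by (simp add: 0)
  qed (rule one)
  have n: "T n 0 0 \<in> H" for n
  proof (induction n rule: int_induct[where k = 0])
    case (step1 i)
    then show ?case using mult[OF step1(2) gen(1)] by (simp add: 0)
  next
    case (step2 i)
    then show ?case using mult[OF step2(2) neg(1)] by (simp add: 0)
  qed (rule one)
  \<comment> \<open>Compositions produce an unknown power of \<open>g\<^sub>3\<close>. As all its
    powers lie in \<open>H\<close>, the last exponent may be changed freely.\<close>
  have shift: "\<forall>j. T n k j \<in> H" if "T n k j0 \<in> H" for n k j0
  proof
    fix j
    obtain i where "\<And>j j'. compose U_dom (T n k j) (T 0 0 j') = T n (k + 0) (j + j' + i)"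
      using T_compose_0 by blast
    from this[of j0 "j - j0 - i"] show "T n k j \<in> H"
      using mult[OF that, of 0 0 "j - j0 - i"] by (simp add: assms j)
  qed
  have k: "\<forall>j. T 0 k j \<in> H" for k
  proof (induction k rule: int2_induct)
    case (3 k l)
    obtain i where "\<And>j j'. compose U_dom (T 0 k j) (T 0 l j') = T 0 (k + l) (j + j' + i)"
      using T_compose_0 by blast
    then have "T 0 (k + l) (0 + 0 + i) \<in> H" using mult 3 by metis
    then show ?case by (rule shift)
  next
    case (4 k)
    obtain i where i: "\<And>j j'. compose U_dom (T 0 (- k) j) (T 0 k j') = T 0 (- k + k) (j + j' + i)"
      using T_compose_0 by blast
    have "T 0 (- k) (- i) \<in> H"
      by (rule inv[of 0 k 0]) (use 4 i[of "- i" 0] in simp_all)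
    then show ?case by (rule shift)
  qed (use gen shift in blast)+
  obtain i where "\<And>j j'. compose U_dom (T n 0 j) (T 0 k j') = T n (0 + k) (j + j' + i)"
    using T_compose_0 by blast
  from this[of 0 "j - i"] show ?thesis using mult[OF n, of 0 k "j - i" n] k by simp
qed

lemma group_eq: "G = T_range"
proof
  have sub: "inoue_generators \<alpha> a b c r t \<subseteq> carrier (BijGroup U_dom)"
    unfolding generators by (simp add: BijGroup_def T_Bij)
  have H: "subgroup G (BijGroup U_dom)"
    unfolding inoue_group_def by (rule group.generate_is_subgroup[OF group_BijGroup sub])
  show "G \<subseteq> T_range"
    unfolding inoue_group_def
    by (rule group.generate_subgroup_incl[OF group_BijGroup _ subgroup_T_range]) (simp add: generators)
  have "inoue_generators \<alpha> a b c r t \<subseteq> G"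
    unfolding inoue_group_def by (rule subsetI, rule generate.incl)
  then have "T n k j \<in> G" for n k j
    unfolding generators by (simp add: T_mem_subgroup[OF H])
  then show "T_range \<subseteq> G"
    unfolding T_range_def by blast
qed

lemma mem_G_iff: "g \<in> G \<longleftrightarrow> (\<exists>n k j. g = T n k j)"
  unfolding group_eq T_range_def by blast

end

section \<open>Discreteness of the action, and functions invariant under the lattice\<close>

context inoue
begin

lemma row_mult_small_imp_zero:
  obtains \<epsilon> where "\<epsilon> > 0" "\<And>k. \<bar>row_mult k a\<bar> < \<epsilon> \<Longrightarrow> \<bar>row_mult k b\<bar> < \<epsilon> \<Longrightarrow> k = 0"
proof
  define M where "M = \<bar>a$1\<bar> + \<bar>a$2\<bar> + \<bar>b$1\<bar> + \<bar>b$2\<bar> + 1"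
  \<comment> \<open>In Cramer's rule each \<open>k$i * wedge b a\<close> is a difference of two
    products. \<open>M\<close> bounds their coefficients, so with this \<open>e\<close> each product
    is below half of the absolute value of \<open>wedge b a\<close>, and the integer
    \<open>k$i\<close> is below 1 in absolute value.\<close>
  define e where "e = \<bar>wedge b a\<bar> / (2 * M)"
  have M: "M > 0" "\<bar>a$1\<bar> \<le> M" "\<bar>a$2\<bar> \<le> M" "\<bar>b$1\<bar> \<le> M" "\<bar>b$2\<bar> \<le> M"
    unfolding M_def by linarith+
  show "e > 0" using wedge_nonzero M by (simp add: e_def)
  have eM: "e * M = \<bar>wedge b a\<bar> / 2" using M(1) by (simp add: e_def)
  fix k :: "int^2"
  assume k: "\<bar>row_mult k a\<bar> < e" "\<bar>row_mult k b\<bar> < e"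
  have small: "\<bar>row_mult k a * x - row_mult k b * y\<bar> < \<bar>wedge b a\<bar>" if "\<bar>x\<bar> \<le> M" "\<bar>y\<bar> \<le> M" for x y
  proof -
    have "\<bar>row_mult k a * x\<bar> \<le> \<bar>row_mult k a\<bar> * M" "\<bar>row_mult k b * y\<bar> \<le> \<bar>row_mult k b\<bar> * M"
      unfolding abs_mult using that by (intro mult_left_mono; simp)+
    moreover have "\<bar>row_mult k a\<bar> * M < e * M" "\<bar>row_mult k b\<bar> * M < e * M"
      using mult_strict_right_mono[OF k(1) M(1)] mult_strict_right_mono[OF k(2) M(1)] .
    ultimately show ?thesis unfolding eM by linarith
  qed
  have "of_int (k$1) * wedge b a = - (row_mult k a * b$2 - row_mult k b * a$2)"
    "of_int (k$2) * wedge b a = row_mult k a * b$1 - row_mult k b * a$1"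
    by (simp_all add: row_mult_def wedge_def algebra_simps)
  then have "\<bar>of_int (k$1) * wedge b a\<bar> < \<bar>wedge b a\<bar>" "\<bar>of_int (k$2) * wedge b a\<bar> < \<bar>wedge b a\<bar>"
    using small[OF M(5) M(3)] small[OF M(4) M(2)] by simp_all
  then have "\<bar>of_int (k$1) :: real\<bar> < 1" "\<bar>of_int (k$2) :: real\<bar> < 1"
    using wedge_nonzero by (simp_all add: abs_mult)
  then have "k$1 = 0" "k$2 = 0"
    by (metis of_int_abs of_int_less_1_iff zabs_less_one_iff)+
  then show "k = 0" by (simp add: vec_eq_iff forall_2)
qed

text \<open>The exponents are detected in turn: \<open>n\<close> by the size of the imaginary part
  of w, \<open>k\<close> by the displacement of w and the imaginary part of the displacement of z,
  and \<open>j\<close> by the period.\<close>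

lemma wandering_T:
  assumes "u \<in> U_dom"
  shows "\<exists>V. open V \<and> u \<in> V \<and> V \<subseteq> U_dom \<and> (\<forall>g\<in>G. \<forall>x\<in>V. g x \<in> V \<longrightarrow> g = (\<lambda>x\<in>U_dom. x))"
proof -
  obtain w0 z0 where u: "u = (w0, z0)" by (cases u)
  define y where "y = Im w0"
  have y: "y > 0" using assms u by (simp add: y_def)
  \<comment> \<open>The bounds y / \<beta> and y * \<beta> of the strip have ratio \<alpha>, so
    every nontrivial power of \<alpha> moves the strip off itself.\<close>
  define \<beta> where "\<beta> = sqrt \<alpha>"
  have \<beta>: "\<beta> > 1" "\<beta> * \<beta> = \<alpha>" using \<alpha>_gt_1 by (auto simp: \<beta>_def)
  obtain \<epsilon> where \<epsilon>: "\<epsilon> > 0" "\<And>k. \<bar>row_mult k a\<bar> < \<epsilon> \<Longrightarrow> \<bar>row_mult k b\<bar> < \<epsilon> \<Longrightarrow> k = 0"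
    by (rule row_mult_small_imp_zero) blast
  \<comment> \<open>The first bound leaves no room for a nonzero multiple of \<open>P\<close>. The
    second, divided by an imaginary part larger than \<open>y / \<beta>\<close>, makes
    \<open>row_mult k b\<close> smaller than \<epsilon>.\<close>
  define \<eta> where "\<eta> = min (\<bar>P\<bar> / 2) (\<epsilon> * (y / \<beta>) / 2)"
  have \<eta>: "\<eta> > 0" "2 * \<eta> \<le> \<bar>P\<bar>" "2 * \<eta> \<le> \<epsilon> * (y / \<beta>)"
    using P_nonzero \<epsilon> y \<beta> by (auto simp: \<eta>_def)
  define V where "V = ({w. Im w > y / \<beta>} \<inter> {w. Im w < y * \<beta>} \<inter> ball w0 (\<epsilon> / 2)) \<times> ball z0 \<eta>"
  have "open V"
    unfolding V_def by (intro open_Times open_Int open_halfspace_Im_gt open_halfspace_Im_lt open_ball)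
  moreover have "u \<in> V"
    using u y \<beta> \<epsilon> \<eta> by (simp add: V_def y_def[symmetric] field_simps)
  moreover have yb: "y / \<beta> > 0" using y \<beta> by simp
  then have "V \<subseteq> U_dom" by (auto simp: V_def)
  moreover have "g = (\<lambda>x\<in>U_dom. x)" if g: "g \<in> G" and x: "x \<in> V" "g x \<in> V" for g x
  proof -
    obtain n k j where g: "g = T n k j" using g mem_G_iff by blast
    obtain w z where wz: "x = (w, z)" by (cases x)
    have w: "Im w > y / \<beta>" "Im w < y * \<beta>" "dist w0 w < \<epsilon> / 2" "dist z0 z < \<eta>"
      using x(1) wz by (auto simp: V_def)
    then have Hw: "Im w > 0" using yb by linarith
    have gx: "g x = (of_real (\<alpha> powi n) * (w + of_real (row_mult k a)),
        z + of_real (row_mult k b) * w + of_real (\<delta> k + P * of_int j) + of_int n * t)"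
      unfolding g wz by (rule T_apply[OF Hw])
    have v: "\<alpha> powi n * Im w > y / \<beta>" "\<alpha> powi n * Im w < y * \<beta>"
    proof -
      have "Im (of_real (\<alpha> powi n) * (w + of_real (row_mult k a))) = \<alpha> powi n * Im w"
        by (simp del: of_real_power_int)
      then show "\<alpha> powi n * Im w > y / \<beta>" "\<alpha> powi n * Im w < y * \<beta>"
        using x(2) unfolding gx V_def by (auto simp del: of_real_power_int)
    qed
    have "n = 0"
    proof (rule ccontr)
      assume "n \<noteq> 0"
      then consider "n \<ge> 1" | "n \<le> -1" by linarith
      then show False
      proof cases
        case 1
        then have "\<alpha> powi 1 \<le> \<alpha> powi n" using \<alpha>_gt_1 by (intro power_int_increasing) auto
        then have "\<alpha> * Im w \<le> \<alpha> powi n * Im w" using Hw by simp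
        moreover have "\<alpha> * (y / \<beta>) < \<alpha> * Im w" using w \<alpha>_gt_1 by (intro mult_strict_left_mono) auto
        moreover have "\<alpha> * (y / \<beta>) = y * \<beta>" using \<beta> by (simp add: field_simps flip: \<beta>(2))
        ultimately show False using v by linarith
      next
        case 2
        then have "\<alpha> powi n \<le> \<alpha> powi (-1)" using \<alpha>_gt_1 by (intro power_int_increasing) auto
        then have "\<alpha> powi n * Im w \<le> (1/\<alpha>) * Im w" using Hw by (intro mult_right_mono) (auto simp: field_simps)
        moreover have "(1/\<alpha>) * Im w < (1/\<alpha>) * (y * \<beta>)" using w \<alpha>_gt_1 by (intro mult_strict_left_mono) auto
        moreover have "(1/\<alpha>) * (y * \<beta>) = y / \<beta>" using \<beta> by (simp add: field_simps flip: \<beta>(2))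
        ultimately show False using v by linarith
      qed
    qed
    have d: "dist w0 (w + of_real (row_mult k a)) < \<epsilon> / 2"
      "dist z0 (z + of_real (row_mult k b) * w + of_real (\<delta> k + P * of_int j)) < \<eta>"
      using x(2) unfolding gx \<open>n = 0\<close> by (auto simp: V_def)
    have "dist w (w + of_real (row_mult k a)) < \<epsilon>"
      using d(1) w(3) by (metis dist_commute dist_triangle_half_r)
    then have ka: "\<bar>row_mult k a\<bar> < \<epsilon>" by (simp add: dist_norm)
    have dz: "norm (of_real (row_mult k b) * w + of_real (\<delta> k + P * of_int j)) < 2 * \<eta>"
    proof -
      have "dist z (z + of_real (row_mult k b) * w + of_real (\<delta> k + P * of_int j)) < 2 * \<eta>"
        using d(2) w(4) dist_triangle[of z _ z0] by (smt (verit) dist_commute)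
      moreover have "norm X = dist z (z + X)" for X :: complex
        unfolding dist_commute[of z] by (simp add: dist_norm)
      ultimately show ?thesis by (simp add: add.assoc)
    qed
    \<comment> \<open>Apart from \<open>w\<close> all quantities are real, so the imaginary part
      isolates \<open>row_mult k b * Im w\<close>.\<close>
    have "\<bar>Im (of_real (row_mult k b) * w + of_real (\<delta> k + P * of_int j))\<bar> < 2 * \<eta>"
      using dz abs_Im_le_cmod by (rule le_less_trans[rotated])
    then have "\<bar>row_mult k b\<bar> * Im w < \<epsilon> * (y / \<beta>)" using Hw \<eta>(3) by (simp add: abs_mult)
    also have "\<dots> < \<epsilon> * Im w" using w(1) \<epsilon>(1) by (rule mult_strict_left_mono)
    finally have "\<bar>row_mult k b\<bar> < \<epsilon>" using Hw by simp
    with ka \<epsilon>(2) have "k = 0" by blast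
    have "norm (complex_of_real (P * of_int j)) < \<bar>P\<bar>"
      using dz \<eta>(2) unfolding \<open>k = 0\<close> by simp
    then have "j = 0" using P_nonzero unfolding norm_of_real by (simp add: abs_mult)
    show ?thesis unfolding g \<open>n = 0\<close> \<open>k = 0\<close> \<open>j = 0\<close> by (rule T_zero)
  qed
  ultimately show ?thesis by blast
qed

sublocale wandering_group U_dom G
proof (rule wandering_group.intro)
  show "open U_dom" by (rule open_U_dom)
  show "subgroup G (BijGroup U_dom)" unfolding group_eq by (rule subgroup_T_range)
next
  fix g assume "g \<in> G"
  then obtain n k j where "g = T n k j" using mem_G_iff by blast
  then show "holomorphic2_on g U_dom" by (simp add: T_def holomorphic2_affine_map)
qed (rule wandering_T)

text \<open>If \<open>k\<close> pairs to 0 with \<open>a\<close>, its images under the powers of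
  \<open>N\<close> also do, while their pairings with \<open>b\<close> tend to 0. By discreteness
  one of these images is 0, and then so is \<open>k\<close>.\<close>

lemma row_mult_eq_0_iff: "row_mult k a = 0 \<longleftrightarrow> k = 0"
proof
  assume k: "row_mult k a = 0"
  obtain \<epsilon> where \<epsilon>: "\<epsilon> > 0" "\<And>k. \<bar>row_mult k a\<bar> < \<epsilon> \<Longrightarrow> \<bar>row_mult k b\<bar> < \<epsilon> \<Longrightarrow> k = 0"
    by (rule row_mult_small_imp_zero) blast
  have "(\<lambda>n. inverse \<alpha> ^ n * row_mult k b) \<longlonglongrightarrow> 0 * row_mult k b"
    using \<alpha>_gt_1 by (intro tendsto_mult LIMSEQ_power_zero tendsto_const) (simp add: inverse_less_1_iff)
  then have "\<forall>\<^sub>F n in sequentially. dist (inverse \<alpha> ^ n * row_mult k b) 0 < \<epsilon>"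
    using \<epsilon>(1) by (intro tendstoD) simp
  then obtain n where n: "\<bar>inverse \<alpha> ^ n * row_mult k b\<bar> < \<epsilon>"
    by (auto simp: eventually_sequentially)
  obtain l where l: "row_mult l a = \<alpha> powi (int n) * row_mult k a" "row_mult l b = \<alpha> powi (- int n) * row_mult k b"
    using lattice_scale[of "int n" k] by blast
  then have "row_mult l b = inverse \<alpha> ^ n * row_mult k b"
    by (simp add: power_int_minus power_inverse)
  then have "l = 0" using n l(1) \<epsilon> k by auto
  then have "row_mult k b = 0" using l(2) by (simp add: less_imp_neq[OF powi_pos, symmetric])
  then show "k = 0" using k by (intro row_mult_inj[OF wedge_nonzero]) auto
qed simp

text \<open>The periods \<open>\<kappa> * (inverse \<alpha> ^ n * a $ 1)\<close> are nonzero and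
  tend to 0. So \<phi> takes its value at \<open>\<i>\<close> on points accumulating at
  \<open>\<i>\<close>, and the identity theorem applies.\<close>

lemma periodic_imp_constant:
  assumes hol: "\<phi> holomorphic_on {w. Im w > 0}" and "\<kappa> \<noteq> 0"
    and per: "\<And>k w. Im w > 0 \<Longrightarrow> \<phi> (w + of_real (\<kappa> * row_mult k a)) = \<phi> w"
    and w: "Im w > 0"
  shows "\<phi> w = \<phi> \<i>"
proof -
  define x where "x n = \<kappa> * (inverse \<alpha> ^ n * a $ 1)" for n
  have "row_mult (axis 1 1) a \<noteq> 0"
    by (subst row_mult_eq_0_iff) (simp add: vec_eq_iff forall_2)
  then have a1: "a $ 1 \<noteq> 0" by simp
  have x: "x n \<noteq> 0" "Im w > 0 \<Longrightarrow> \<phi> (w + of_real (x n)) = \<phi> w" for n w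
  proof -
    show "x n \<noteq> 0" using a1 \<open>\<kappa> \<noteq> 0\<close> by (simp add: x_def)
    obtain l where "row_mult l a = \<alpha> powi (- int n) * row_mult (axis 1 1) a"
      using lattice_scale by blast
    then have "x n = \<kappa> * row_mult l a" by (simp add: x_def power_int_minus power_inverse)
    then show "Im w > 0 \<Longrightarrow> \<phi> (w + of_real (x n)) = \<phi> w" using per by simp
  qed
  have "(\<lambda>n. \<kappa> * (inverse \<alpha> ^ n * a $ 1)) \<longlonglongrightarrow> \<kappa> * (0 * a $ 1)"
    using \<alpha>_gt_1 by (intro tendsto_mult LIMSEQ_power_zero tendsto_const) (simp add: inverse_less_1_iff)
  then have "x \<longlonglongrightarrow> 0" by (simp add: x_def[abs_def])
  then have lim: "(\<lambda>n. \<i> + of_real (x n)) \<longlonglongrightarrow> \<i> + of_real 0"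
    by (intro tendsto_intros)
  have "\<i> islimpt range (\<lambda>n. \<i> + of_real (x n))"
    unfolding islimpt_sequential
    by (intro exI[of _ "\<lambda>n. \<i> + of_real (x n)"]) (use lim x(1) in auto)
  have "\<phi> w - \<phi> \<i> = 0"
  proof (rule analytic_continuation[where f = "\<lambda>w. \<phi> w - \<phi> \<i>" and S = "{w. Im w > 0}"])
    show "(\<lambda>w. \<phi> w - \<phi> \<i>) holomorphic_on {w. Im w > 0}"
      using hol by (intro holomorphic_intros)
    show "\<i> islimpt range (\<lambda>n. \<i> + of_real (x n))" by fact
    show "\<phi> v - \<phi> \<i> = 0" if "v \<in> range (\<lambda>n. \<i> + of_real (x n))" for v
      using that x(2)[of \<i>] by auto
  qed (use w in \<open>auto simp: open_halfspace_Im_gt\<close>)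
  then show ?thesis by simp
qed

end

section \<open>Rigidity of equivalences\<close>

text \<open>The function \<open>1 / (f z + \<i>)\<close> is entire and bounded by 1, so Liouville's
  theorem applies to it.\<close>

lemma entire_to_halfplane_constant:
  assumes "f holomorphic_on UNIV" "\<And>z. Im (f z) > 0"
  shows "f z = f 0"
proof -
  have nz: "f z + \<i> \<noteq> 0" for z using assms(2)[of z] by (auto simp: complex_eq_iff)
  have "norm (1 / (f z + \<i>)) \<le> 1" for z
  proof -
    have "1 \<le> Im (f z + \<i>)" using assms(2)[of z] by simp
    also have "\<dots> \<le> norm (f z + \<i>)" using abs_Im_le_cmod[of "f z + \<i>"] by linarith
    finally show ?thesis by (simp add: norm_divide divide_simps)
  qed
  then have "bounded (range (\<lambda>z. 1 / (f z + \<i>)))" by (auto simp: bounded_iff)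
  moreover have "(\<lambda>z. 1 / (f z + \<i>)) holomorphic_on UNIV"
    using assms(1) nz by (auto intro!: holomorphic_intros)
  ultimately have "(\<lambda>z. 1 / (f z + \<i>)) constant_on UNIV"
    by (intro Liouville_theorem)
  then obtain c where "\<And>z. 1 / (f z + \<i>) = c"
    by (auto simp only: constant_on_def)
  then have "1 / (f z + \<i>) = 1 / (f 0 + \<i>)" by metis
  then show ?thesis using nz[of z] nz[of 0] by (simp add: field_simps)
qed

text \<open>The continuous inverse makes \<open>f\<close> proper, so its reciprocal tends to 0 at
  infinity and \<open>f\<close> is a polynomial. Injectivity keeps the derivative from vanishing, so
  the derivative is constant by the fundamental theorem of algebra.\<close>

lemma entire_homeomorphism_affine:
  fixes f g :: "complex \<Rightarrow> complex"
  assumes holf: "f holomorphic_on UNIV" and contg: "continuous_on UNIV g"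
    and gf: "\<And>z. g (f z) = z" and fg: "\<And>z. f (g z) = z"
  obtains A B where "A \<noteq> 0" "\<And>z. f z = A * z + B"
proof -
  have inj: "inj f" by (metis gf injI)
  have "((inverse \<circ> f) \<longlongrightarrow> 0) at_infinity"
  proof (rule tendstoI)
    fix e :: real assume e: "e > 0"
    have "compact (g ` cball 0 (1 / e))"
      using contg by (intro compact_continuous_image) (auto intro: continuous_on_subset)
    then obtain R where R: "\<And>z. z \<in> g ` cball 0 (1 / e) \<Longrightarrow> norm z \<le> R"
      using compact_imp_bounded bounded_iff by metis
    have "dist ((inverse \<circ> f) z) 0 < e" if "norm z \<ge> R + 1" for z
    proof -
      have "f z \<notin> cball 0 (1 / e)"
        using R[of z] that gf[of z] by (metis add_le_same_cancel1 imageI not_one_le_zero order_trans)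
      then have "norm (f z) > 1 / e" by simp
      then have "inverse (norm (f z)) < e" using e
        by (metis inverse_eq_divide inverse_inverse_eq less_imp_inverse_less positive_imp_inverse_positive)
      then show ?thesis by (simp add: norm_inverse)
    qed
    then show "\<forall>\<^sub>F z in at_infinity. dist ((inverse \<circ> f) z) 0 < e"
      unfolding eventually_at_infinity by blast
  qed
  then obtain p n where p: "\<And>z. f z = (\<Sum>i\<le>n. p i * z^i)"
    using pole_at_infinity[OF holf] by metis
  have "f = (\<lambda>z. \<Sum>i\<le>n. p i * z^i)" using p by auto
  \<comment> \<open>The coefficients of the derivative. They are cut off below \<open>n\<close> in
    what follows, because the derivative is treated as a polynomial of formal degree
    \<open>n\<close> and \<open>p (Suc n)\<close> is unspecified.\<close>
  define q where "q i = of_nat (Suc i) * p (Suc i)" for i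
  have "deriv f z = (\<Sum>i\<le>n. q i * (if i < n then 1 else 0) * z^i)" for z
  proof -
    have "(f has_field_derivative (\<Sum>i\<le>n. p i * (of_nat i * z ^ (i - 1)))) (at z)"
      unfolding \<open>f = _\<close> by (auto intro!: derivative_eq_intros sum.cong simp: mult_ac)
    then have "deriv f z = (\<Sum>i\<le>n. p i * (of_nat i * z ^ (i - 1)))"
      by (rule DERIV_imp_deriv)
    also have "\<dots> = (\<Sum>i\<in>{1..n}. p i * (of_nat i * z ^ (i - 1)))"
      by (rule sum.mono_neutral_right) auto
    also have "\<dots> = (\<Sum>i\<in>{0..<n}. p (Suc i) * (of_nat (Suc i) * z ^ i))"
      by (rule sum.reindex_bij_witness[of _ Suc "\<lambda>i. i - 1"]) auto
    also have "\<dots> = (\<Sum>i\<le>n. q i * (if i < n then 1 else 0) * z^i)"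
      by (rule sum.mono_neutral_cong_left) (auto simp: q_def)
    finally show ?thesis .
  qed
  moreover have "deriv f z \<noteq> 0" for z
    using holomorphic_injective_imp_regular[OF holf open_UNIV inj] by simp
  ultimately have "\<not> (q 0 * (if 0 < n then 1 else 0) = 0 \<or> (\<exists>i\<in>{1..n}. q i * (if i < n then 1 else 0) \<noteq> 0))"
    using fundamental_theorem_of_algebra[of "\<lambda>i. q i * (if i < n then 1 else 0)" n] by metis
  then have n: "0 < n" "q 0 \<noteq> 0" and q: "\<And>i. i \<in> {1..n} \<Longrightarrow> i < n \<Longrightarrow> q i = 0"
    by (auto split: if_splits)
  have high: "p i = 0" if "2 \<le> i" "i \<le> n" for i
  proof -
    have "q (i - 1) = 0" using that by (intro q) auto
    moreover have "Suc (i - 1) = i" using that by simp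
    ultimately show ?thesis using that by (auto simp: q_def)
  qed
  have "f z = p 1 * z + p 0" for z
  proof -
    have "f z = (\<Sum>i\<in>{0,1}. p i * z^i)"
      unfolding p using n high by (intro sum.mono_neutral_right) (auto simp: not_less_eq_eq numeral_2_eq_2 Suc_le_eq)
    then show ?thesis by simp
  qed
  moreover have "p 1 \<noteq> 0" using n by (simp add: q_def)
  ultimately show ?thesis using that by blast
qed

lemma constant_deriv_imp_affine:
  assumes "f holomorphic_on {w. Im w > 0}" "\<And>w. Im w > 0 \<Longrightarrow> deriv f w = \<mu>"
  obtains \<nu> where "\<And>w. Im w > 0 \<Longrightarrow> f w = \<mu> * w + \<nu>"
proof -
  have "\<exists>c. \<forall>w\<in>{w. Im w > 0}. f w - \<mu> * w = c"
  proof (rule has_field_derivative_zero_constant)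
    show "convex {w. Im w > 0}" by (rule convex_halfspace_Im_gt)
    fix w assume w: "w \<in> {w. Im w > 0}"
    have "(f has_field_derivative \<mu>) (at w within {w. Im w > 0})"
      using holomorphic_derivI[OF assms(1) open_halfspace_Im_gt w] assms(2) w by auto
    then show "((\<lambda>w. f w - \<mu> * w) has_field_derivative 0) (at w within {w. Im w > 0})"
      by (auto intro!: derivative_eq_intros)
  qed
  then obtain c where "\<And>w. Im w > 0 \<Longrightarrow> f w - \<mu> * w = c" by auto
  then show ?thesis using that[of c] by (simp add: algebra_simps)
qed

text \<open>On each fibre over H the first components of \<open>F\<close> and \<open>F'\<close> are
  entire with values in H, hence constant. So \<open>F\<close> restricts to a homeomorphism from the
  fibre over w to the fibre over m w, and being entire it is affine.\<close>

lemma fibred_form: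
  assumes F: "holomorphic2_on F U_dom" "holomorphic2_on F' U_dom"
    and inv: "\<forall>u\<in>U_dom. F u \<in> U_dom \<and> F' u \<in> U_dom \<and> F' (F u) = u \<and> F (F' u) = u"
  obtains m A B where "m holomorphic_on {w. Im w > 0}" "A holomorphic_on {w. Im w > 0}" "B holomorphic_on {w. Im w > 0}"
    "\<And>w. Im w > 0 \<Longrightarrow> Im (m w) > 0" "\<And>w. Im w > 0 \<Longrightarrow> \<exists>v. Im v > 0 \<and> m v = w"
    "\<And>w. Im w > 0 \<Longrightarrow> A w \<noteq> 0" "\<And>w z. Im w > 0 \<Longrightarrow> F (w, z) = (m w, A w * z + B w)"
proof -
  have FF: "\<And>u. u \<in> U_dom \<Longrightarrow> F u \<in> U_dom" "\<And>u. u \<in> U_dom \<Longrightarrow> F' u \<in> U_dom"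
    "\<And>u. u \<in> U_dom \<Longrightarrow> F' (F u) = u" "\<And>u. u \<in> U_dom \<Longrightarrow> F (F' u) = u"
    using inv by auto
  have pos: "Im (fst (H (w, z))) > 0" if "\<And>u. u \<in> U_dom \<Longrightarrow> H u \<in> U_dom" "Im w > 0" for H :: "complex \<times> complex \<Rightarrow> complex \<times> complex" and w z
    using that(1)[of "(w, z)"] that(2) by (cases "H (w, z)") auto
  have slice_z: "(\<lambda>z. fst (H (w, z))) holomorphic_on UNIV" "(\<lambda>z. snd (H (w, z))) holomorphic_on UNIV"
    if "holomorphic2_on H U_dom" "Im w > 0" for H w
  proof -
    have "((\<lambda>v. (w, v)) has_derivative (\<lambda>v. (0, v))) (at s)" for s
      by (auto intro!: derivative_eq_intros)
    from holomorphic2_on_slice[OF that(1) this, where x = 0 and y = 1] that(2)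
    show "(\<lambda>z. fst (H (w, z))) holomorphic_on UNIV" "(\<lambda>z. snd (H (w, z))) holomorphic_on UNIV"
      unfolding holomorphic_on_def by (simp_all add: field_differentiable_at_within)
  qed
  have slice_w: "(\<lambda>w. fst (F (w, z))) holomorphic_on {w. Im w > 0}" "(\<lambda>w. snd (F (w, z))) holomorphic_on {w. Im w > 0}" for z
  proof -
    have "((\<lambda>v. (v, z)) has_derivative (\<lambda>v. (v, 0))) (at s)" for s
      by (auto intro!: derivative_eq_intros)
    from holomorphic2_on_slice[OF F(1) this, where x = 1 and y = 0]
    show "(\<lambda>w. fst (F (w, z))) holomorphic_on {w. Im w > 0}" "(\<lambda>w. snd (F (w, z))) holomorphic_on {w. Im w > 0}"
      unfolding holomorphic_on_def by (simp_all add: field_differentiable_at_within)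
  qed
  have const: "fst (F (w, z)) = fst (F (w, 0))" "fst (F' (w, z)) = fst (F' (w, 0))" if "Im w > 0" for w z
    using entire_to_halfplane_constant[OF slice_z(1)[OF F(1) that]] entire_to_halfplane_constant[OF slice_z(1)[OF F(2) that]]
      pos[of F, OF FF(1)] pos[of F', OF FF(2)] that by blast+
  define m where "m w = fst (F (w, 0))" for w
  \<comment> \<open>The values at z = 0 and z = 1 determine an affine map of z. Defining its
    coefficients by them makes their holomorphy in w immediate.\<close>
  define B where "B w = snd (F (w, 0))" for w
  define A where "A w = snd (F (w, 1)) - snd (F (w, 0))" for w
  have mpos: "Im (m w) > 0" if "Im w > 0" for w unfolding m_def using pos[of F, OF FF(1)] that by blast
  have inv_fst: "fst (F' (m w, z)) = w" if w: "Im w > 0" for w z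
  proof -
    have "fst (F' (m w, z)) = fst (F' (m w, snd (F (w, 0))))"
      using const(2)[OF mpos[OF w]] by metis
    also have "\<dots> = w" using FF(3)[of "(w, 0)"] w by (simp add: m_def)
    finally show ?thesis .
  qed
  have form: "F (w, z) = (m w, A w * z + B w) \<and> A w \<noteq> 0" if w: "Im w > 0" for w z
  proof -
    have Fw: "F (w, z) = (m w, snd (F (w, z)))" for z using const(1)[OF w] by (metis m_def prod.collapse)
    have Fw': "F' (m w, z) = (w, snd (F' (m w, z)))" for z using inv_fst[OF w] by (metis prod.collapse)
    have "snd (F' (m w, snd (F (w, z)))) = z" for z
      using FF(3)[of "(w, z)"] w Fw by (metis mem_U_dom snd_conv)
    moreover have "snd (F (w, snd (F' (m w, z)))) = z" for z
      using FF(4)[of "(m w, z)"] mpos[OF w] Fw' by (metis mem_U_dom snd_conv)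
    moreover have "continuous_on UNIV (\<lambda>z. snd (F' (m w, z)))"
      using slice_z(2)[OF F(2) mpos[OF w]] holomorphic_on_imp_continuous_on by blast
    ultimately obtain A' B' where "A' \<noteq> 0" "\<And>z. snd (F (w, z)) = A' * z + B'"
      using entire_homeomorphism_affine[OF slice_z(2)[OF F(1) w], of "\<lambda>z. snd (F' (m w, z))"] by metis
    then show ?thesis using Fw by (simp add: A_def B_def)
  qed
  show ?thesis
  proof (rule that[of m A B])
    show "m holomorphic_on {w. Im w > 0}" "A holomorphic_on {w. Im w > 0}" "B holomorphic_on {w. Im w > 0}"
      unfolding m_def A_def B_def by (intro holomorphic_intros slice_w)+
    fix w :: complex assume w: "Im w > 0"
    show "\<exists>v. Im v > 0 \<and> m v = w"
    proof (intro exI conjI)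
      show p: "Im (fst (F' (w, 0))) > 0" using pos[of F', OF FF(2)] w by blast
      show "m (fst (F' (w, 0))) = w"
        using FF(4)[of "(w, 0)"] w const(1)[OF p] by (metis fst_conv m_def mem_U_dom prod.collapse)
    qed
  qed (use mpos form in auto)
qed

lemma connected_U_dom: "connected U_dom"
  using convex_U_dom by (rule convex_connected)

lemma simply_connected_U_dom: "simply_connected U_dom"
  using convex_U_dom by (rule convex_imp_simply_connected)

lemma (in inoue) powi_inject: "\<alpha> powi n = \<alpha> powi n' \<Longrightarrow> n = n'"
  using power_int_strict_increasing[of n n' \<alpha>] power_int_strict_increasing[of n' n \<alpha>] \<alpha>_gt_1
  by (cases n n' rule: linorder_cases) auto

lemma quadratic_eq_0_on_halfplane:
  fixes x y z :: complex
  assumes "\<And>w. Im w > 0 \<Longrightarrow> x * w\<^sup>2 + y * w + z = 0"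
  shows "x = 0" "y = 0" "z = 0"
proof -
  have 1: "- x + y * \<i> + z = 0" using assms[of \<i>] by (simp add: power2_eq_square)
  have 2: "- 4 * x + 2 * (y * \<i>) + z = 0"
    using assms[of "2 * \<i>"] by (simp add: power2_eq_square algebra_simps)
  have 3: "- 9 * x + 3 * (y * \<i>) + z = 0"
    using assms[of "3 * \<i>"] by (simp add: power2_eq_square algebra_simps)
  have "2 * x = 0" using 1 2 3 by algebra
  then show "x = 0" by simp
  with 1 2 have "y * \<i> = 0" by algebra
  then show "y = 0" by simp
  with 1 \<open>x = 0\<close> show "z = 0" by simp
qed

section \<open>Conjugating one group into another\<close>

locale inoue_pair = p: inoue \<alpha> r a b c t + q: inoue \<alpha> r a' b' c' t'
  for \<alpha> r a b c t a' b' c' t'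
begin

sublocale wandering_group_pair U_dom p.G q.G
  by unfold_locales

text \<open>
  Conjugation by \<open>(w, z) \<mapsto> (\<mu> w + \<nu>, \<Lambda> z + f w)\<close> takes the element of normal form
  \<open>(0, k)\<close> to the one of normal form \<open>(0, k')\<close>, up to powers of \<open>g\<^sub>3\<close>.
\<close>

definition corresponds where
  "corresponds \<mu> \<nu> \<Lambda> f k k' \<longleftrightarrow>
    \<mu> * row_mult k a = row_mult k' a' \<and> \<Lambda> * row_mult k b = \<mu> * row_mult k' b' \<and>
    [\<Lambda> * p.\<delta> k + f * row_mult k a = \<nu> * row_mult k' b' + q.\<delta> k'] (rmod q.P)"

lemma intertwines:
  assumes "orbit_equivalence U_dom p.G q.G F F'"
  shows "\<exists>n' k' j'. \<forall>u\<in>U_dom. F (p.T n k j u) = q.T n' k' j' (F u)"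
proof -
  have "p.T n k j \<in> p.G" unfolding p.mem_G_iff by blast
  from orbit_equivalence_intertwines[OF connected_U_dom assms this]
  obtain h where h: "h \<in> q.G" "\<forall>u\<in>U_dom. F (p.T n k j u) = h (F u)" by blast
  from h(1) obtain n' k' j' where "h = q.T n' k' j'" unfolding q.mem_G_iff by blast
  with h(2) show ?thesis by blast
qed

lemma intertwines_reverse:
  assumes "orbit_equivalence U_dom p.G q.G F F'"
  shows "\<exists>n k j. \<forall>u\<in>U_dom. F (p.T n k j u) = q.T n' k' j' (F u)"
proof -
  interpret rev: inoue_pair \<alpha> r a' b' c' t' a b c t by unfold_locales
  obtain n k j where h: "\<forall>u\<in>U_dom. F' (q.T n' k' j' u) = p.T n k j (F' u)"
    using rev.intertwines[OF orbit_equivalence_sym[OF assms]] by blast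
  have F: "\<And>u. u \<in> U_dom \<Longrightarrow> F u \<in> U_dom" "\<And>u. u \<in> U_dom \<Longrightarrow> F' (F u) = u" "\<And>u. u \<in> U_dom \<Longrightarrow> F (F' u) = u"
    using assms unfolding orbit_equivalence_def by auto
  have "F (p.T n k j u) = q.T n' k' j' (F u)" if u: "u \<in> U_dom" for u
  proof -
    have "q.T n' k' j' (F u) \<in> U_dom"
      using affine_map_U_dom[OF q.powi_pos F(1)[OF u]] unfolding q.T_def by blast
    then have "q.T n' k' j' (F u) = F (F' (q.T n' k' j' (F u)))" using F(3) by simp
    also have "\<dots> = F (p.T n k j u)" using h F(1,2)[OF u] by simp
    finally show ?thesis by simp
  qed
  then show ?thesis by blast
qed

lemma base_map_affine:
  assumes hol: "m holomorphic_on {w. Im w > 0}"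
    and pos: "\<And>w. Im w > 0 \<Longrightarrow> Im (m w) > 0"
    and surj: "\<And>w. Im w > 0 \<Longrightarrow> \<exists>v. Im v > 0 \<and> m v = w"
    and E: "\<And>n k. \<exists>n' k'. \<forall>w. Im w > 0 \<longrightarrow>
      m (of_real (\<alpha> powi n) * (w + of_real (row_mult k a))) = of_real (\<alpha> powi n') * (m w + of_real (row_mult k' a'))"
  obtains \<mu> \<nu> :: real where "\<mu> > 0" "\<And>w. Im w > 0 \<Longrightarrow> m w = of_real \<mu> * w + of_real \<nu>"
proof -
  have shift: "\<exists>y. \<forall>w. Im w > 0 \<longrightarrow> m (w + of_real ((\<alpha> - 1) * row_mult k a)) = m w + y" for k
  proof -
    obtain n0 k0 where 0: "\<And>w. Im w > 0 \<Longrightarrow> m (of_real \<alpha> * w) = of_real (\<alpha> powi n0) * (m w + of_real (row_mult k0 a'))"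
      using E[of 1 0] by auto
    obtain n1 k1 where 1: "\<And>w. Im w > 0 \<Longrightarrow> m (w + of_real (row_mult k a)) = of_real (\<alpha> powi n1) * (m w + of_real (row_mult k1 a'))"
      using E[of 0 k] by auto
    obtain l where l: "row_mult l a = \<alpha> * row_mult k a"
      using p.row_mult_N(1) by blast
    obtain n2 k2 where 2: "\<And>w. Im w > 0 \<Longrightarrow> m (w + of_real (\<alpha> * row_mult k a)) = of_real (\<alpha> powi n2) * (m w + of_real (row_mult k2 a'))"
      using E[of 0 l] l by auto
    \<comment> \<open>The value of \<open>m\<close> at \<alpha> (w + ka) is computed in two ways,
      with the translation after the dilation and before it.\<close>
    have eq: "of_real (\<alpha> powi n2) * (of_real (\<alpha> powi n0) * (m w + of_real (row_mult k0 a')) + of_real (row_mult k2 a'))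
        = of_real (\<alpha> powi n0) * (of_real (\<alpha> powi n1) * (m w + of_real (row_mult k1 a')) + of_real (row_mult k0 a'))"
      if w: "Im w > 0" for w
    proof -
      have "Im (of_real \<alpha> * w) > 0" "Im (w + of_real (row_mult k a)) > 0" using w p.\<alpha>_gt_1 by simp_all
      moreover have "of_real \<alpha> * w + of_real (\<alpha> * row_mult k a) = of_real \<alpha> * (w + of_real (row_mult k a))"
        by (simp add: algebra_simps)
      ultimately show ?thesis using 0[of w] 0[of "w + of_real (row_mult k a)"] 1[OF w] 2[of "of_real \<alpha> * w"] w by metis
    qed
    \<comment> \<open>Both sides of \<open>eq\<close> are affine in \<open>m w\<close>, and
      \<open>m\<close> takes the two values chosen here. Subtracting the two instances eliminates
      the constant terms and leaves the equality of the linear factors.\<close>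
    obtain v v' where v: "Im v > 0" "m v = \<i>" "Im v' > 0" "m v' = 2 * \<i>"
      using surj[of \<i>] surj[of "2 * \<i>"] by auto
    have "q2 * p * (u' - u) = p * q1 * (u' - u)"
      if "q2 * (p * (u + x0) + x2) = p * (q1 * (u + x1) + x0)" "q2 * (p * (u' + x0) + x2) = p * (q1 * (u' + x1) + x0)"
      for q2 p q1 u u' x0 x1 x2 :: complex
      using that by algebra
    from this[OF eq[OF v(1)] eq[OF v(3)]]
    have "of_real (\<alpha> powi n2) * of_real (\<alpha> powi n0) * \<i> = of_real (\<alpha> powi n0) * of_real (\<alpha> powi n1) * \<i>"
      unfolding v by (simp del: of_real_power_int)
    then have n12: "complex_of_real (\<alpha> powi n2) = of_real (\<alpha> powi n1)"
      using less_imp_neq[OF q.powi_pos[of n0], symmetric] by (simp del: of_real_power_int)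
    have "m (w + of_real ((\<alpha> - 1) * row_mult k a)) = m w + of_real (\<alpha> powi n1) * (of_real (row_mult k2 a') - of_real (row_mult k1 a'))"
      if w: "Im w > 0" for w
    proof -
      let ?v = "w - of_real (row_mult k a)"
      have v: "Im ?v > 0" using w by simp
      have "?v + of_real (row_mult k a) = w" "?v + of_real (\<alpha> * row_mult k a) = w + of_real ((\<alpha> - 1) * row_mult k a)"
        by (simp_all add: algebra_simps)
      then show ?thesis using 1[OF v] 2[OF v] n12 by (simp add: algebra_simps del: of_real_power_int)
    qed
    then show ?thesis by blast
  qed
  have "deriv m w = deriv m \<i>" if w: "Im w > 0" for w
  proof (rule p.periodic_imp_constant[OF _ _ _ w, of _ "\<alpha> - 1"])
    show "deriv m holomorphic_on {w. Im w > 0}"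
      using hol by (intro holomorphic_deriv open_halfspace_Im_gt)
    show "\<alpha> - 1 \<noteq> 0" using p.\<alpha>_gt_1 by simp
    fix k and w :: complex assume w: "Im w > 0"
    let ?x = "of_real ((\<alpha> - 1) * row_mult k a) :: complex"
    obtain y where y: "\<And>w. Im w > 0 \<Longrightarrow> m (w + ?x) = m w + y" using shift by blast
    have "(m has_field_derivative deriv m (w + ?x)) (at (w + ?x))"
      by (rule holomorphic_derivI[OF hol open_halfspace_Im_gt]) (use w in simp)
    then have "((\<lambda>w. m (w + ?x)) has_field_derivative deriv m (w + ?x)) (at w)"
      by (simp add: DERIV_shift)
    moreover have "(m has_field_derivative deriv m w) (at w)"
      by (rule holomorphic_derivI[OF hol open_halfspace_Im_gt]) (use w in simp)
    then have "((\<lambda>w. m w + y) has_field_derivative deriv m w) (at w)"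
      by (auto intro!: derivative_eq_intros)
    then have "((\<lambda>w. m (w + ?x)) has_field_derivative deriv m w) (at w)"
      by (rule has_field_derivative_transform_within_open[OF _ open_halfspace_Im_gt[of 0]]) (use w y in auto)
    ultimately show "deriv m (w + ?x) = deriv m w" by (rule DERIV_unique)
  qed
  then obtain \<nu> where \<nu>: "\<And>w. Im w > 0 \<Longrightarrow> m w = deriv m \<i> * w + \<nu>"
    using constant_deriv_imp_affine[OF hol] by metis
  define \<mu> where "\<mu> = deriv m \<i>"
  \<comment> \<open>Preserving the half-plane forces a real nonnegative slope and a nonnegative
    imaginary part of \<nu>. Surjectivity then makes that imaginary part 0.\<close>
  have im: "Im \<mu> * x + Re \<mu> * y + Im \<nu> > 0" if "y > 0" for x y
    using pos[of "Complex x y"] \<nu>[of "Complex x y"] that by (simp add: \<mu>_def algebra_simps)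
  have "Im \<mu> = 0"
  proof (rule ccontr)
    assume "Im \<mu> \<noteq> 0"
    then show False using im[of 1 "- (Re \<mu> + Im \<nu>) / Im \<mu>"] by simp
  qed
  have nonneg: "Re \<mu> \<ge> 0"
  proof (rule ccontr)
    assume "\<not> Re \<mu> \<ge> 0"
    define y where "y = 1 + \<bar>Im \<nu>\<bar> / (- Re \<mu>)"
    have "y > 0" using \<open>\<not> Re \<mu> \<ge> 0\<close> by (simp add: y_def add_pos_nonneg)
    moreover have "Re \<mu> * y = Re \<mu> - \<bar>Im \<nu>\<bar>" using \<open>\<not> Re \<mu> \<ge> 0\<close> by (simp add: y_def field_simps)
    ultimately show False using im[of y 0] \<open>\<not> Re \<mu> \<ge> 0\<close> by simp
  qed
  have "Im \<nu> \<ge> 0"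
  proof (rule ccontr)
    assume "\<not> Im \<nu> \<ge> 0"
    define y where "y = - Im \<nu> / (Re \<mu> + 1)"
    have "y > 0" using \<open>\<not> Im \<nu> \<ge> 0\<close> nonneg by (simp add: y_def divide_less_0_iff)
    moreover have "(Re \<mu> + 1) * y = - Im \<nu>" using nonneg by (simp add: y_def)
    then have "Re \<mu> * y + y = - Im \<nu>" by (simp add: algebra_simps)
    ultimately show False using im[of y 0] by simp
  qed
  moreover have "Im \<nu> \<le> 0"
  proof (rule ccontr)
    assume n: "\<not> Im \<nu> \<le> 0"
    then obtain v where v: "Im v > 0" "m v = of_real (Im \<nu> / 2) * \<i>"
      using surj[of "of_real (Im \<nu> / 2) * \<i>"] by auto
    then have "Im (\<mu> * v + \<nu>) = Im (of_real (Im \<nu> / 2) * \<i>)" using \<nu>[OF v(1)] unfolding \<mu>_def by metis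
    then have "Im (\<mu> * v + \<nu>) = Im \<nu> / 2" by simp
    moreover have "Re \<mu> * Im v \<ge> 0" using nonneg v by simp
    ultimately show False using n \<open>Im \<mu> = 0\<close> by simp
  qed
  ultimately have "Im \<nu> = 0" by simp
  have "Re \<mu> \<noteq> 0" using im[of 1 0] \<open>Im \<nu> = 0\<close> by auto
  with nonneg have "Re \<mu> > 0" by simp
  moreover have "m w = of_real (Re \<mu>) * w + of_real (Re \<nu>)" if "Im w > 0" for w
    using \<nu>[OF that] \<open>Im \<mu> = 0\<close> \<open>Im \<nu> = 0\<close> by (simp add: \<mu>_def complex_eq_iff)
  ultimately show ?thesis using that by blast
qed

lemma orbit_equivalence_affine:
  assumes oe: "orbit_equivalence U_dom p.G q.G F F'"
  obtains \<mu> \<nu> \<Lambda> :: real and e f \<kappa> :: complex where "\<mu> > 0" "\<Lambda> \<noteq> 0"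
    "\<And>w z. Im w > 0 \<Longrightarrow> F (w, z) = (of_real \<mu> * w + of_real \<nu>, of_real \<Lambda> * z + (e * w\<^sup>2 + f * w + \<kappa>))"
proof -
  have F: "holomorphic2_on F U_dom" "holomorphic2_on F' U_dom"
    "\<forall>u\<in>U_dom. F u \<in> U_dom \<and> F' u \<in> U_dom \<and> F' (F u) = u \<and> F (F' u) = u"
    using oe unfolding orbit_equivalence_def by auto
  obtain m A B where m: "m holomorphic_on {w. Im w > 0}" "A holomorphic_on {w. Im w > 0}" "B holomorphic_on {w. Im w > 0}"
    "\<And>w. Im w > 0 \<Longrightarrow> Im (m w) > 0" "\<And>w. Im w > 0 \<Longrightarrow> \<exists>v. Im v > 0 \<and> m v = w"
    "\<And>w. Im w > 0 \<Longrightarrow> A w \<noteq> 0" and form: "\<And>w z. Im w > 0 \<Longrightarrow> F (w, z) = (m w, A w * z + B w)"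
    by (rule fibred_form[OF F]) (rule that; assumption)
  have E: "\<exists>n' k' j'. \<forall>w z. Im w > 0 \<longrightarrow>
      m (of_real (\<alpha> powi n) * (w + of_real (row_mult k a))) = of_real (\<alpha> powi n') * (m w + of_real (row_mult k' a')) \<and>
      A (of_real (\<alpha> powi n) * (w + of_real (row_mult k a))) * (z + of_real (row_mult k b) * w + of_real (p.\<delta> k + p.P * of_int j) + of_int n * t)
        + B (of_real (\<alpha> powi n) * (w + of_real (row_mult k a)))
      = A w * z + B w + of_real (row_mult k' b') * m w + of_real (q.\<delta> k' + q.P * of_int j') + of_int n' * t'"
    (is "\<exists>n' k' j'. \<forall>w z. _ \<longrightarrow> ?E n' k' j' w z") for n k j
  proof -
    obtain n' k' j' where h: "\<And>u. u \<in> U_dom \<Longrightarrow> F (p.T n k j u) = q.T n' k' j' (F u)"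
      using intertwines[OF oe] by blast
    show ?thesis
    proof (intro exI allI impI)
      fix w z :: complex assume w: "Im w > 0"
      have "Im (of_real (\<alpha> powi n) * (w + of_real (row_mult k a))) > 0"
        using w by (simp del: of_real_power_int)
      from form[OF this] have "F (p.T n k j (w, z)) = (m (of_real (\<alpha> powi n) * (w + of_real (row_mult k a))),
        A (of_real (\<alpha> powi n) * (w + of_real (row_mult k a))) * (z + of_real (row_mult k b) * w + of_real (p.\<delta> k + p.P * of_int j) + of_int n * t)
        + B (of_real (\<alpha> powi n) * (w + of_real (row_mult k a))))"
        unfolding p.T_apply[OF w] .
      moreover have "q.T n' k' j' (F (w, z)) = (of_real (\<alpha> powi n') * (m w + of_real (row_mult k' a')),
        A w * z + B w + of_real (row_mult k' b') * m w + of_real (q.\<delta> k' + q.P * of_int j') + of_int n' * t')"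
        unfolding form[OF w] q.T_apply[OF m(4)[OF w]] ..
      ultimately show "?E n' k' j' w z"
        using h[of "(w, z)"] w by simp
    qed
  qed
  have "\<exists>n' k'. \<forall>w. Im w > 0 \<longrightarrow>
      m (of_real (\<alpha> powi n) * (w + of_real (row_mult k a))) = of_real (\<alpha> powi n') * (m w + of_real (row_mult k' a'))" for n k
    using E[of n k 0] by blast
  from base_map_affine[OF m(1,4,5) this]
  obtain \<mu> \<nu> where \<mu>: "\<mu> > 0" and mw: "\<And>w. Im w > 0 \<Longrightarrow> m w = of_real \<mu> * w + of_real \<nu>" by metis
  have E0: "\<exists>k' j'. \<mu> * row_mult k a = row_mult k' a' \<and> (\<forall>w z. Im w > 0 \<longrightarrow>
      A (w + of_real (row_mult k a)) * (z + of_real (row_mult k b) * w + of_real (p.\<delta> k + p.P * of_int j)) + B (w + of_real (row_mult k a))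
      = A w * z + B w + of_real (row_mult k' b') * (of_real \<mu> * w + of_real \<nu>) + of_real (q.\<delta> k' + q.P * of_int j'))" for k j
  proof -
    obtain n' k' j' where h: "\<And>w z. Im w > 0 \<Longrightarrow>
      m (w + of_real (row_mult k a)) = of_real (\<alpha> powi n') * (m w + of_real (row_mult k' a')) \<and>
      A (w + of_real (row_mult k a)) * (z + of_real (row_mult k b) * w + of_real (p.\<delta> k + p.P * of_int j)) + B (w + of_real (row_mult k a))
      = A w * z + B w + of_real (row_mult k' b') * m w + of_real (q.\<delta> k' + q.P * of_int j') + of_int n' * t'"
      using E[of 0 k j] by auto
    have h1: "of_real \<mu> * (w + of_real (row_mult k a)) + of_real \<nu> = of_real (\<alpha> powi n') * (of_real \<mu> * w + of_real \<nu> + of_real (row_mult k' a'))"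
      if "Im w > 0" for w
    proof -
      have "Im (w + of_real (row_mult k a)) > 0" using that by simp
      then show ?thesis using conjunct1[OF h[OF that]] mw that by metis
    qed
    \<comment> \<open>The imaginary parts compare \<mu> with
      \<open>\<alpha> powi n' * \<mu>\<close>, so \<open>n'\<close> is 0: now that \<open>m\<close>
      is affine, lattice elements are conjugated to lattice elements up to powers of
      \<open>g\<^sub>3\<close>.\<close>
    from h1[of \<i>] have "Im (of_real \<mu> * (\<i> + of_real (row_mult k a)) + of_real \<nu>) = Im (of_real (\<alpha> powi n') * (of_real \<mu> * \<i> + of_real \<nu> + of_real (row_mult k' a')))"
      by simp
    then have "\<alpha> powi n' = \<alpha> powi 0" using \<mu> by (simp del: of_real_power_int)
    then have "n' = 0" by (rule p.powi_inject)
    have "\<mu> * row_mult k a = row_mult k' a'"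
    proof -
      have "complex_of_real (\<mu> * row_mult k a) = of_real (row_mult k' a')"
        using h1[of \<i>] \<open>n' = 0\<close> by (simp add: algebra_simps)
      then show ?thesis using of_real_eq_iff by blast
    qed
    moreover have "A (w + of_real (row_mult k a)) * (z + of_real (row_mult k b) * w + of_real (p.\<delta> k + p.P * of_int j)) + B (w + of_real (row_mult k a))
      = A w * z + B w + of_real (row_mult k' b') * (of_real \<mu> * w + of_real \<nu>) + of_real (q.\<delta> k' + q.P * of_int j')" if w: "Im w > 0" for w z
      using conjunct2[OF h[OF w]] unfolding \<open>n' = 0\<close> mw[OF w] by simp
    ultimately show ?thesis by blast
  qed
  \<comment> \<open>This is the relation for \<open>g\<^sub>3\<close>. Its conjugate translates w by
    0, so it is a power of the target \<open>g\<^sub>3\<close>, and \<Lambda> is the ratio of the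
    two translations of z.\<close>
  obtain k' j' where kj: "\<mu> * row_mult 0 a = row_mult k' a'" "\<And>w z. Im w > 0 \<Longrightarrow>
      A (w + of_real (row_mult 0 a)) * (z + of_real (row_mult 0 b) * w + of_real (p.\<delta> 0 + p.P * of_int 1)) + B (w + of_real (row_mult 0 a))
      = A w * z + B w + of_real (row_mult k' b') * (of_real \<mu> * w + of_real \<nu>) + of_real (q.\<delta> k' + q.P * of_int j')"
    using E0[of 0 1] by blast
  have "k' = 0" using kj(1) q.row_mult_eq_0_iff by simp
  define \<Lambda> where "\<Lambda> = q.P * of_int j' / p.P"
  have A: "A w = of_real \<Lambda>" if w: "Im w > 0" for w
  proof -
    have "A w * of_real p.P = of_real (q.P * of_int j')"
      using kj(2)[OF w, of 0] unfolding \<open>k' = 0\<close> by simp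
    then show ?thesis using p.P_nonzero by (simp add: \<Lambda>_def field_simps)
  qed
  have "\<Lambda> \<noteq> 0" using A[of \<i>] m(6)[of \<i>] by auto
  \<comment> \<open>A lattice translation changes \<open>B\<close> by a polynomial of degree at most
    one, so the second derivative of \<open>B\<close> is invariant.\<close>
  have BE: "\<exists>x y. \<forall>w. Im w > 0 \<longrightarrow> B (w + of_real (row_mult k a)) = B w + (x * w + y)" for k
  proof -
    obtain k' j' where kj: "\<And>w z. Im w > 0 \<Longrightarrow>
      A (w + of_real (row_mult k a)) * (z + of_real (row_mult k b) * w + of_real (p.\<delta> k + p.P * of_int 0)) + B (w + of_real (row_mult k a))
      = A w * z + B w + of_real (row_mult k' b') * (of_real \<mu> * w + of_real \<nu>) + of_real (q.\<delta> k' + q.P * of_int j')"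
      using E0[of k 0] by blast
    have "B (w + of_real (row_mult k a)) = B w + ((of_real (row_mult k' b') * of_real \<mu> - of_real \<Lambda> * of_real (row_mult k b)) * w
        + (of_real (row_mult k' b') * of_real \<nu> + of_real (q.\<delta> k' + q.P * of_int j') - of_real \<Lambda> * of_real (p.\<delta> k)))"
      if w: "Im w > 0" for w
    proof -
      have "A (w + of_real (row_mult k a)) = of_real \<Lambda>" using A w by simp
      then show ?thesis using kj[OF w, of 0] by (simp add: algebra_simps)
    qed
    then show ?thesis by blast
  qed
  have hB': "deriv B holomorphic_on {w. Im w > 0}" 
    using m(3) by (intro holomorphic_deriv open_halfspace_Im_gt)
  have DB: "(B has_field_derivative deriv B w) (at w)" "(deriv B has_field_derivative deriv (deriv B) w) (at w)" if "Im w > 0" for w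
    using that by (auto intro: holomorphic_derivI[OF m(3) open_halfspace_Im_gt] holomorphic_derivI[OF hB' open_halfspace_Im_gt])
  have "deriv (deriv B) w = deriv (deriv B) \<i>" if w: "Im w > 0" for w
  proof (rule p.periodic_imp_constant[OF _ _ _ w, of _ 1])
    show "deriv (deriv B) holomorphic_on {w. Im w > 0}"
      by (rule holomorphic_deriv[OF hB' open_halfspace_Im_gt])
    fix k and w :: complex assume w: "Im w > 0"
    let ?x = "of_real (1 * row_mult k a) :: complex"
    obtain x y where xy: "\<And>w. Im w > 0 \<Longrightarrow> B (w + ?x) = B w + (x * w + y)" using BE[of k] by auto
    have B1: "deriv B (w + ?x) = deriv B w + x" if w: "Im w > 0" for w
    proof (rule DERIV_unique)
      show "((\<lambda>w. B (w + ?x)) has_field_derivative deriv B (w + ?x)) (at w)"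
        using DB(1)[of "w + ?x"] w by (simp add: DERIV_shift)
      have "((\<lambda>w. B w + (x * w + y)) has_field_derivative deriv B w + x) (at w)"
        using DB(1)[OF w] by (auto intro!: derivative_eq_intros)
      then show "((\<lambda>w. B (w + ?x)) has_field_derivative deriv B w + x) (at w)"
        by (rule has_field_derivative_transform_within_open[OF _ open_halfspace_Im_gt[of 0]]) (use w xy in auto)
    qed
    show "deriv (deriv B) (w + ?x) = deriv (deriv B) w"
    proof (rule DERIV_unique)
      show "((\<lambda>w. deriv B (w + ?x)) has_field_derivative deriv (deriv B) (w + ?x)) (at w)"
        using DB(2)[of "w + ?x"] w by (simp add: DERIV_shift)
      have "((\<lambda>w. deriv B w + x) has_field_derivative deriv (deriv B) w) (at w)"
        using DB(2)[OF w] by (auto intro!: derivative_eq_intros)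
      then show "((\<lambda>w. deriv B (w + ?x)) has_field_derivative deriv (deriv B) w) (at w)"
        by (rule has_field_derivative_transform_within_open[OF _ open_halfspace_Im_gt[of 0]]) (use w B1 in auto)
    qed
  qed simp
  then obtain f where f: "\<And>w. Im w > 0 \<Longrightarrow> deriv B w = deriv (deriv B) \<i> * w + f"
    using constant_deriv_imp_affine[OF hB'] by metis
  define e where "e = deriv (deriv B) \<i> / 2"
  have "(\<lambda>w. B w - e * w\<^sup>2) holomorphic_on {w. Im w > 0}"
    using m(3) by (intro holomorphic_intros)
  then have "\<exists>\<kappa>. \<forall>w. Im w > 0 \<longrightarrow> B w - e * w\<^sup>2 = f * w + \<kappa>"
  proof (rule constant_deriv_imp_affine[of _ f])
    show "deriv (\<lambda>w. B w - e * w\<^sup>2) w = f" if w: "Im w > 0" for w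
      by (rule DERIV_imp_deriv) (use DB(1)[OF w] f[OF w] in \<open>auto intro!: derivative_eq_intros simp: e_def field_simps\<close>)
  qed blast
  then obtain \<kappa> where "\<And>w. Im w > 0 \<Longrightarrow> B w - e * w\<^sup>2 = f * w + \<kappa>" by blast
  then have "B w = e * w\<^sup>2 + f * w + \<kappa>" if "Im w > 0" for w
    using that by (simp add: algebra_simps)
  then have "F (w, z) = (of_real \<mu> * w + of_real \<nu>, of_real \<Lambda> * z + (e * w\<^sup>2 + f * w + \<kappa>))" if "Im w > 0" for w z
    using form[OF that] mw[OF that] A[OF that] that by simp
  then show ?thesis by (rule that[OF \<mu> \<open>\<Lambda> \<noteq> 0\<close>])
qed

text \<open>The relation for each group element is an identity of polynomials of degree at most two
  in w, and \<open>coefs\<close> collects the equalities of coefficients. The additive constant of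
  \<open>F\<close> cancels in it. The last conclusion is the relation for
  \<open>g\<^sub>0\<close>.\<close>

lemma orbit_equivalence_parameters:
  assumes oe: "orbit_equivalence U_dom p.G q.G F F'"
  obtains \<mu> \<nu> \<Lambda> f where "\<mu> > 0" "\<Lambda> \<noteq> 0"
    "\<And>k. \<exists>k'. corresponds \<mu> \<nu> \<Lambda> f k k'"
    "\<And>k'. \<exists>k. corresponds \<mu> \<nu> \<Lambda> f k k'"
    "\<exists>k j. (1 - \<alpha>) * \<nu> = \<alpha> * row_mult k a' \<and> (\<alpha> - 1) * f = \<mu> * row_mult k b' \<and>
      t' = of_real \<Lambda> * t - of_real (row_mult k b' * \<nu> + q.\<delta> k + q.P * of_int j)"
proof -
  obtain \<mu> \<nu> \<Lambda> :: real and e f \<kappa> where \<mu>: "\<mu> > 0" and \<Lambda>: "\<Lambda> \<noteq> 0" and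
    F: "\<And>w z. Im w > 0 \<Longrightarrow> F (w, z) = (of_real \<mu> * w + of_real \<nu>, of_real \<Lambda> * z + (e * w\<^sup>2 + f * w + \<kappa>))"
    by (rule orbit_equivalence_affine[OF oe]) (rule that; assumption)
  have coefs: "n = n' \<and> \<mu> * (\<alpha> powi n * row_mult k a) + \<nu> = \<alpha> powi n * (\<nu> + row_mult k' a') \<and>
      e * (of_real (\<alpha> powi n))\<^sup>2 = e \<and>
      of_real (\<Lambda> * row_mult k b) + 2 * e * (of_real (\<alpha> powi n))\<^sup>2 * of_real (row_mult k a) + f * of_real (\<alpha> powi n) = f + of_real (row_mult k' b' * \<mu>) \<and>
      of_real \<Lambda> * (of_real (p.\<delta> k + p.P * of_int j) + of_int n * t) + e * (of_real (\<alpha> powi n))\<^sup>2 * (of_real (row_mult k a))\<^sup>2 + f * of_real (\<alpha> powi n) * of_real (row_mult k a)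
        = of_real (row_mult k' b' * \<nu> + q.\<delta> k' + q.P * of_int j') + of_int n' * t'"
    if h: "\<forall>u\<in>U_dom. F (p.T n k j u) = q.T n' k' j' (F u)" for n k j n' k' j'
  proof -
    define W where "W w = complex_of_real (\<alpha> powi n) * (w + of_real (row_mult k a))" for w
    have eq: "of_real \<mu> * W w + of_real \<nu> = of_real (\<alpha> powi n') * (of_real \<mu> * w + of_real \<nu> + of_real (row_mult k' a'))" (is ?E1)
      "of_real \<Lambda> * (z + of_real (row_mult k b) * w + of_real (p.\<delta> k + p.P * of_int j) + of_int n * t) + (e * (W w)\<^sup>2 + f * W w + \<kappa>)
        = of_real \<Lambda> * z + (e * w\<^sup>2 + f * w + \<kappa>) + of_real (row_mult k' b') * (of_real \<mu> * w + of_real \<nu>) + of_real (q.\<delta> k' + q.P * of_int j') + of_int n' * t'" (is ?E2)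
      if w: "Im w > 0" for w z
    proof -
      have "Im (W w) > 0" using w by (simp add: W_def del: of_real_power_int)
      then have "F (p.T n k j (w, z)) = (of_real \<mu> * W w + of_real \<nu>,
          of_real \<Lambda> * (z + of_real (row_mult k b) * w + of_real (p.\<delta> k + p.P * of_int j) + of_int n * t) + (e * (W w)\<^sup>2 + f * W w + \<kappa>))"
        unfolding p.T_apply[OF w] W_def by (rule F)
      moreover have "Im (of_real \<mu> * w + of_real \<nu>) > 0" using w \<mu> by simp
      then have "q.T n' k' j' (F (w, z)) = (of_real (\<alpha> powi n') * (of_real \<mu> * w + of_real \<nu> + of_real (row_mult k' a')),
          of_real \<Lambda> * z + (e * w\<^sup>2 + f * w + \<kappa>) + of_real (row_mult k' b') * (of_real \<mu> * w + of_real \<nu>) + of_real (q.\<delta> k' + q.P * of_int j') + of_int n' * t')"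
        unfolding F[OF w] by (rule q.T_apply)
      moreover have "F (p.T n k j (w, z)) = q.T n' k' j' (F (w, z))" using h w by simp
      ultimately show ?E1 ?E2
        by simp_all
    qed
    define X where "X = complex_of_real (\<alpha> powi n)"
    define Y where "Y = complex_of_real (row_mult k a)"
    have "0 * w\<^sup>2 + (of_real \<mu> * X - of_real (\<alpha> powi n') * of_real \<mu>) * w
        + (of_real \<mu> * X * Y + of_real \<nu> - of_real (\<alpha> powi n') * (of_real \<nu> + of_real (row_mult k' a'))) = 0" if "Im w > 0" for w
      using eq(1)[OF that] unfolding W_def X_def[symmetric] Y_def[symmetric] by algebra
    from quadratic_eq_0_on_halfplane[OF this]
    have 1: "of_real \<mu> * X = of_real (\<alpha> powi n') * of_real \<mu>"
      "of_real \<mu> * X * Y + of_real \<nu> = of_real (\<alpha> powi n') * (of_real \<nu> + of_real (row_mult k' a'))" by simp_all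
    have "\<alpha> powi n = \<alpha> powi n'"
      using 1(1) \<mu> unfolding X_def by (simp del: of_real_power_int)
    then have n: "n = n'" by (rule p.powi_inject)
    have "complex_of_real (\<mu> * (\<alpha> powi n * row_mult k a) + \<nu>) = of_real (\<alpha> powi n * (\<nu> + row_mult k' a'))"
      using 1(2) unfolding n[symmetric] X_def Y_def by (simp del: of_real_power_int add: mult.assoc)
    then have 2: "\<mu> * (\<alpha> powi n * row_mult k a) + \<nu> = \<alpha> powi n * (\<nu> + row_mult k' a')"
      using of_real_eq_iff by blast
    define L where "L = complex_of_real \<Lambda>"
    define M where "M = complex_of_real \<mu>"
    define V where "V = complex_of_real \<nu>"
    define kb where "kb = complex_of_real (row_mult k b)"
    define kb' where "kb' = complex_of_real (row_mult k' b')"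
    define s where "s = of_real (p.\<delta> k + p.P * of_int j) + of_int n * t"
    define s' where "s' = of_real (q.\<delta> k' + q.P * of_int j') + of_int n' * t'"
    have "(e * X\<^sup>2 - e) * w\<^sup>2 + (L * kb + 2 * e * X\<^sup>2 * Y + f * X - f - kb' * M) * w
        + (L * s + e * X\<^sup>2 * Y\<^sup>2 + f * X * Y - kb' * V - s') = 0" if "Im w > 0" for w
    proof -
      have "L * (0 + kb * w + s) + (e * (X * (w + Y))\<^sup>2 + f * (X * (w + Y)) + \<kappa>)
        = L * 0 + (e * w\<^sup>2 + f * w + \<kappa>) + kb' * (M * w + V) + s'"
        using eq(2)[OF that, of 0] unfolding W_def X_def Y_def L_def M_def V_def kb_def kb'_def s_def s'_def
        by (simp only: add.assoc)
      then show ?thesis by algebra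
    qed
    from quadratic_eq_0_on_halfplane[OF this]
    have 3: "e * X\<^sup>2 = e" "L * kb + 2 * e * X\<^sup>2 * Y + f * X = f + kb' * M"
      "L * s + e * X\<^sup>2 * Y\<^sup>2 + f * X * Y = kb' * V + s'" by (simp_all add: algebra_simps)
    show ?thesis
      using n 2 3 unfolding X_def Y_def L_def M_def V_def kb_def kb'_def s_def s'_def
      by (intro conjI) (simp_all only: of_real_add of_real_mult add.assoc)
  qed
  obtain n0 k0 j0 where g0: "\<forall>u\<in>U_dom. F (p.T 1 0 0 u) = q.T n0 k0 j0 (F u)"
    using intertwines[OF oe] by blast
  note c0 = coefs[OF g0]
  have "e * (of_real (\<alpha>\<^sup>2 - 1)) = 0" using c0 by (simp add: algebra_simps)
  moreover have "\<alpha>\<^sup>2 > 1" using p.\<alpha>_gt_1 by (simp add: one_less_power)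
  then have "complex_of_real (\<alpha>\<^sup>2 - 1) \<noteq> 0" unfolding of_real_eq_0_iff by linarith
  ultimately have e: "e = 0" unfolding mult_eq_0_iff by blast
  \<comment> \<open>The linear coefficient in the relation for \<open>g\<^sub>0\<close> expresses
    \<open>f\<close>, so far a complex number, by real quantities.\<close>
  have "f * of_real (\<alpha> - 1) = of_real (row_mult k0 b' * \<mu>)" using c0 by (simp add: e algebra_simps)
  then have "f = of_real (row_mult k0 b' * \<mu> / (\<alpha> - 1))" using p.\<alpha>_gt_1 by (simp add: field_simps)
  then obtain f' where f: "f = complex_of_real f'" by blast
  have c3: "(1 - \<alpha>) * \<nu> = \<alpha> * row_mult k0 a' \<and> (\<alpha> - 1) * f' = \<mu> * row_mult k0 b' \<and>
      t' = of_real \<Lambda> * t - of_real (row_mult k0 b' * \<nu> + q.\<delta> k0 + q.P * of_int j0)"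
  proof (intro conjI)
    show "(1 - \<alpha>) * \<nu> = \<alpha> * row_mult k0 a'" using c0 by (simp add: algebra_simps)
    have "complex_of_real ((\<alpha> - 1) * f') = of_real (\<mu> * row_mult k0 b')"
      using \<open>f * of_real (\<alpha> - 1) = of_real (row_mult k0 b' * \<mu>)\<close> unfolding f by (simp add: mult.commute)
    then show "(\<alpha> - 1) * f' = \<mu> * row_mult k0 b'" using of_real_eq_iff by blast
    have "1 = n0" using c0 by blast
    then show "t' = of_real \<Lambda> * t - of_real (row_mult k0 b' * \<nu> + q.\<delta> k0 + q.P * of_int j0)"
      using c0 by (simp add: algebra_simps)
  qed
  have c: "corresponds \<mu> \<nu> \<Lambda> f' k k'"
    if h: "\<forall>u\<in>U_dom. F (p.T 0 k 0 u) = q.T 0 k' j' (F u)" for k k' j'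
    unfolding corresponds_def
  proof (intro conjI)
    note c = coefs[OF h]
    show "\<mu> * row_mult k a = row_mult k' a'" using c by simp
    have "complex_of_real (\<Lambda> * row_mult k b) = of_real (\<mu> * row_mult k' b')" using c by (simp add: e)
    then show "\<Lambda> * row_mult k b = \<mu> * row_mult k' b'" using of_real_eq_iff by blast
    have "complex_of_real (\<Lambda> * p.\<delta> k + f' * row_mult k a) = of_real (row_mult k' b' * \<nu> + q.\<delta> k' + q.P * of_int j')"
      using c by (simp add: e f)
    then have "\<Lambda> * p.\<delta> k + f' * row_mult k a = row_mult k' b' * \<nu> + q.\<delta> k' + q.P * of_int j'"
      using of_real_eq_iff by blast
    then show "[\<Lambda> * p.\<delta> k + f' * row_mult k a = \<nu> * row_mult k' b' + q.\<delta> k'] (rmod q.P)"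
      unfolding rcong_altdef by (intro exI[of _ "- j'"]) (simp add: algebra_simps)
  qed
  show ?thesis
  proof (rule that[of \<mu> \<Lambda> \<nu> f', OF \<mu> \<Lambda>])
    fix k
    obtain n' k' j' where h: "\<forall>u\<in>U_dom. F (p.T 0 k 0 u) = q.T n' k' j' (F u)"
      using intertwines[OF oe] by blast
    moreover have "0 = n'" using coefs[OF h] by blast
    ultimately show "\<exists>k'. corresponds \<mu> \<nu> \<Lambda> f' k k'"
      using c by blast
  next
    fix k'
    obtain n k j where h: "\<forall>u\<in>U_dom. F (p.T n k j u) = q.T 0 k' 0 (F u)"
      using intertwines_reverse[OF oe] by blast
    moreover have n: "n = 0" using coefs[OF h] by blast
    \<comment> \<open>The element found for \<open>k'\<close> carries an unknown power
      \<open>j\<close> of \<open>g\<^sub>3\<close>, whereas \<open>c\<close> speaks of power 0. The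
      conjugate of \<open>p.T 0 k 0\<close> has the same pairings, so its exponents are again
      \<open>k'\<close>.\<close>
    obtain n2 k2 j2 where h2: "\<forall>u\<in>U_dom. F (p.T 0 k 0 u) = q.T n2 k2 j2 (F u)"
      using intertwines[OF oe] by blast
    have n2: "0 = n2" using coefs[OF h2] by blast
    have "row_mult k2 a' = row_mult k' a'" using coefs[OF h] coefs[OF h2] unfolding n n2[symmetric] by simp
    moreover have "complex_of_real (row_mult k2 b' * \<mu>) = of_real (row_mult k' b' * \<mu>)"
      using coefs[OF h] coefs[OF h2] unfolding n n2[symmetric] e by auto
    then have "row_mult k2 b' = row_mult k' b'" using \<mu> of_real_eq_iff by auto
    ultimately have "k2 = k'" by (intro row_mult_inj[OF q.wedge_nonzero])
    with h2 n2 show "\<exists>k. corresponds \<mu> \<nu> \<Lambda> f' k k'"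
      using c by blast
  next
    show "\<exists>k j. (1 - \<alpha>) * \<nu> = \<alpha> * row_mult k a' \<and> (\<alpha> - 1) * f' = \<mu> * row_mult k b' \<and>
      t' = of_real \<Lambda> * t - of_real (row_mult k b' * \<nu> + q.\<delta> k + q.P * of_int j)"
      using c3 by blast
  qed
qed

end

section \<open>Constructing an equivalence from its parameters\<close>

context inoue_pair
begin

text \<open>Together with \<open>T_mem_subgroup\<close> it reduces the intertwining of the whole
  group to that of the four generators.\<close>

lemma intertwined_subgroup:
  assumes F: "\<And>u. u \<in> U_dom \<Longrightarrow> F u \<in> U_dom"
  shows "subgroup {g \<in> Bij U_dom. \<exists>h\<in>q.G. \<forall>u\<in>U_dom. F (g u) = h (F u)} (BijGroup U_dom)"
    (is "subgroup ?H _")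
proof (rule group.subgroupI[OF group_BijGroup])
  show "?H \<subseteq> carrier (BijGroup U_dom)" by (auto simp: BijGroup_def)
  have "(\<lambda>u\<in>U_dom. u) \<in> ?H"
    by (intro CollectI conjI id_Bij bexI[OF _ q.G_id]) (use F in simp)
  then show "?H \<noteq> {}" by blast
next
  fix g assume "g \<in> ?H"
  then obtain h where g: "g \<in> Bij U_dom" and h: "h \<in> q.G" "\<And>u. u \<in> U_dom \<Longrightarrow> F (g u) = h (F u)" by blast
  obtain k where k: "k \<in> q.G" "\<And>u. u \<in> U_dom \<Longrightarrow> k (h u) = u"
    using q.G_inverse[OF h(1)] by metis
  let ?g = "\<lambda>u\<in>U_dom. inv_into U_dom g u"
  have "F (?g u) = k (F u)" if u: "u \<in> U_dom" for u
  proof -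
    have v: "inv_into U_dom g u \<in> U_dom" "g (inv_into U_dom g u) = u"
      using g u Bij_inv_into_mem[OF g u] by (auto simp: Bij_def bij_betw_inv_into_right)
    then have "k (F u) = F (inv_into U_dom g u)"
      using h(2)[OF v(1)] k(2)[OF F[OF v(1)]] by simp
    then show ?thesis using u by simp
  qed
  then have "?g \<in> ?H" using k(1) restrict_inv_into_Bij[OF g] by blast
  then show "inv\<^bsub>BijGroup U_dom\<^esub> g \<in> ?H" by (simp only: inv_BijGroup[OF g])
next
  fix g g' assume "g \<in> ?H" "g' \<in> ?H"
  then obtain h h' where g: "g \<in> Bij U_dom" "g' \<in> Bij U_dom" and h: "h \<in> q.G" "\<And>u. u \<in> U_dom \<Longrightarrow> F (g u) = h (F u)"
    and h': "h' \<in> q.G" "\<And>u. u \<in> U_dom \<Longrightarrow> F (g' u) = h' (F u)" by blast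
  have "F (compose U_dom g g' u) = compose U_dom h h' (F u)" if u: "u \<in> U_dom" for u
  proof -
    have "g' u \<in> U_dom" using Bij_imp_funcset[OF g(2)] u by blast
    then show ?thesis using u h h' F by (simp add: compose_def)
  qed
  then have "compose U_dom g g' \<in> ?H" using compose_Bij[OF g] q.G_compose[OF h(1) h'(1)] by blast
  then show "g \<otimes>\<^bsub>BijGroup U_dom\<^esub> g' \<in> ?H" using g by (simp add: BijGroup_def)
qed

lemma orbit_equivalence_of_generators:
  assumes hol: "holomorphic2_on F U_dom" "holomorphic2_on F' U_dom"
    and inv: "\<forall>u\<in>U_dom. F u \<in> U_dom \<and> F' u \<in> U_dom \<and> F' (F u) = u \<and> F (F' u) = u"
    and 1: "\<And>n k j. (n, k, j) \<in> {(1, 0, 0), (0, axis 1 1, 0), (0, axis 2 1, 0), (0, 0, 1)} \<Longrightarrow>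
      \<exists>h\<in>q.G. \<forall>u\<in>U_dom. F (p.T n k j u) = h (F u)"
    and 2: "\<And>n k j. (n, k, j) \<in> {(1, 0, 0), (0, axis 1 1, 0), (0, axis 2 1, 0), (0, 0, 1)} \<Longrightarrow>
      \<exists>h\<in>p.G. \<forall>u\<in>U_dom. F' (q.T n k j u) = h (F' u)"
  shows "orbit_equivalence U_dom p.G q.G F F'"
proof -
  interpret rev: inoue_pair \<alpha> r a' b' c' t' a b c t by unfold_locales
  have P: "\<exists>h\<in>q.G. \<forall>u\<in>U_dom. F (g u) = h (F u)" if g_in: "g \<in> p.G" for g
  proof -
    obtain n k j where g: "g = p.T n k j" using g_in p.mem_G_iff by blast
    have "subgroup {g \<in> Bij U_dom. \<exists>h\<in>q.G. \<forall>u\<in>U_dom. F (g u) = h (F u)} (BijGroup U_dom)"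
      by (rule intertwined_subgroup) (use inv in blast)
    from p.T_mem_subgroup[OF this, of n k j] show ?thesis
      unfolding g using p.T_Bij 1 by blast
  qed
  have Q: "\<exists>h\<in>p.G. \<forall>u\<in>U_dom. F' (g u) = h (F' u)" if g_in: "g \<in> q.G" for g
  proof -
    obtain n k j where g: "g = q.T n k j" using g_in q.mem_G_iff by blast
    have "subgroup {g \<in> Bij U_dom. \<exists>h\<in>p.G. \<forall>u\<in>U_dom. F' (g u) = h (F' u)} (BijGroup U_dom)"
      by (rule rev.intertwined_subgroup) (use inv in blast)
    from q.T_mem_subgroup[OF this, of n k j] show ?thesis
      unfolding g using q.T_Bij 2 by blast
  qed
  have "p.proj x = p.proj y \<longleftrightarrow> q.proj (F x) = q.proj (F y)" if xy: "x \<in> U_dom" "y \<in> U_dom" for x y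
  proof
    assume "p.proj x = p.proj y"
    then obtain g where g: "g \<in> p.G" "g x = y" using p.proj_eq_iff[OF xy] by blast
    then obtain h where "h \<in> q.G" "h (F x) = F y" using P[OF g(1)] xy by metis
    then show "q.proj (F x) = q.proj (F y)" using q.proj_eq_iff inv xy by blast
  next
    assume "q.proj (F x) = q.proj (F y)"
    moreover have Fxy: "F x \<in> U_dom" "F y \<in> U_dom" using inv xy by blast+
    ultimately obtain g where g: "g \<in> q.G" "g (F x) = F y" using q.proj_eq_iff by blast
    then obtain h where "h \<in> p.G" "h (F' (F x)) = F' (F y)" using Q[OF g(1)] Fxy by metis
    then show "p.proj x = p.proj y" using p.proj_eq_iff[OF xy] inv xy by metis
  qed
  then show ?thesis unfolding orbit_equivalence_def using hol inv by blast
qed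

text \<open>The equivalence is (w, z) -> (\<mu> w + \<nu>, \<Lambda> z + f w). The hypothesis
  \<open>per\<close> lets the two generators \<open>g\<^sub>3\<close> correspond to each other up to
  inversion, so that the inverse map respects their powers too.\<close>

lemma orbit_equivalence_of_parameters:
  assumes \<mu>: "\<mu> > 0" and \<Lambda>: "\<Lambda> \<noteq> 0"
    and per: "\<Lambda> * p.P = q.P \<or> \<Lambda> * p.P = - q.P"
    and 1: "\<And>k. \<exists>k'. corresponds \<mu> \<nu> \<Lambda> f k k'"
    and 2: "\<And>k'. \<exists>k. corresponds \<mu> \<nu> \<Lambda> f k k'"
    and 3: "(1 - \<alpha>) * \<nu> = \<alpha> * row_mult k0 a'" "(\<alpha> - 1) * f = \<mu> * row_mult k0 b'"
      "t' = of_real \<Lambda> * t - of_real (row_mult k0 b' * \<nu> + q.\<delta> k0 + q.P * of_int j0)"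
  shows "\<exists>F F'. orbit_equivalence U_dom p.G q.G F F'"
proof -
  interpret rev: inoue_pair \<alpha> r a' b' c' t' a b c t by unfold_locales
  define F :: "complex \<times> complex \<Rightarrow> complex \<times> complex" where
    "F = (\<lambda>(w, z). (of_real \<mu> * w + of_real \<nu>, of_real \<Lambda> * z + of_real f * w + 0))"
  define F' :: "complex \<times> complex \<Rightarrow> complex \<times> complex" where
    "F' = (\<lambda>(w, z). (of_real (1/\<mu>) * w + of_real (- \<nu> / \<mu>), of_real (1/\<Lambda>) * z + of_real (- f / (\<Lambda> * \<mu>)) * w + of_real (f * \<nu> / (\<Lambda> * \<mu>))))"
  have hol: "holomorphic2_on F U_dom" "holomorphic2_on F' U_dom"
    unfolding F_def F'_def by (rule holomorphic2_on_affine)+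
  have inv: "\<forall>u\<in>U_dom. F u \<in> U_dom \<and> F' u \<in> U_dom \<and> F' (F u) = u \<and> F (F' u) = u"
    using \<mu> \<Lambda> by (auto simp: F_def F'_def field_simps)
  have conj0: "F (p.T 0 k j u) = q.T 0 k' j' (F u)"
    if "\<mu> * row_mult k a = row_mult k' a'" "\<Lambda> * row_mult k b = \<mu> * row_mult k' b'"
      "\<Lambda> * (p.\<delta> k + p.P * of_int j) + f * row_mult k a = \<nu> * row_mult k' b' + (q.\<delta> k' + q.P * of_int j')" "u \<in> U_dom"
    for k k' j j' u
  proof -
    obtain w z where u: "u = (w, z)" by (cases u)
    have w: "Im w > 0" "Im (of_real \<mu> * w + of_real \<nu>) > 0" using that(4) u \<mu> by simp_all
    have e: "complex_of_real \<mu> * of_real (row_mult k a) = of_real (row_mult k' a')"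
      "complex_of_real \<Lambda> * of_real (row_mult k b) = of_real \<mu> * of_real (row_mult k' b')"
      "complex_of_real \<Lambda> * of_real (p.\<delta> k + p.P * of_int j) + of_real f * of_real (row_mult k a) = of_real \<nu> * of_real (row_mult k' b') + of_real (q.\<delta> k' + q.P * of_int j')"
      using that(1-3) unfolding of_real_mult[symmetric] of_real_add[symmetric] by simp_all
    show ?thesis
      unfolding u F_def case_prod_conv p.T_apply[OF w(1)] q.T_apply[OF w(2)] prod.inject
    proof
      show "of_real \<mu> * (of_real (\<alpha> powi 0) * (w + of_real (row_mult k a))) + of_real \<nu> =
        complex_of_real (\<alpha> powi 0) * (of_real \<mu> * w + of_real \<nu> + of_real (row_mult k' a'))"
        using e(1) by (simp add: algebra_simps)
      show "of_real \<Lambda> * (z + of_real (row_mult k b) * w + of_real (p.\<delta> k + p.P * of_int j) + of_int 0 * t) + of_real f * (of_real (\<alpha> powi 0) * (w + of_real (row_mult k a))) + 0 =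
        of_real \<Lambda> * z + of_real f * w + 0 + of_real (row_mult k' b') * (of_real \<mu> * w + of_real \<nu>) + of_real (q.\<delta> k' + q.P * of_int j') + of_int 0 * t'"
        using e(2,3) unfolding power_int_0_right of_real_1 of_int_0 by algebra
    qed
  qed
  have conj1: "F (p.T 1 0 0 u) = q.T 1 k0 j0 (F u)" if "u \<in> U_dom" for u
  proof -
    obtain w z where u: "u = (w, z)" by (cases u)
    have w: "Im w > 0" "Im (of_real \<mu> * w + of_real \<nu>) > 0" using that u \<mu> by simp_all
    have e: "(1 - complex_of_real \<alpha>) * of_real \<nu> = of_real \<alpha> * of_real (row_mult k0 a')"
      "(of_real \<alpha> - 1) * complex_of_real f = of_real \<mu> * of_real (row_mult k0 b')"
      using arg_cong[OF 3(1), of complex_of_real] arg_cong[OF 3(2), of complex_of_real] by simp_all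
    have t': "t' + (of_real (row_mult k0 b') * of_real \<nu> + of_real (q.\<delta> k0 + q.P * of_int j0)) = of_real \<Lambda> * t"
      unfolding 3(3) by simp
    show ?thesis
      unfolding u F_def case_prod_conv p.T_apply[OF w(1)] q.T_apply[OF w(2)] prod.inject
    proof
      show "of_real \<mu> * (of_real (\<alpha> powi 1) * (w + of_real (row_mult 0 a))) + of_real \<nu> =
        complex_of_real (\<alpha> powi 1) * (of_real \<mu> * w + of_real \<nu> + of_real (row_mult k0 a'))"
        using e(1) by (simp add: algebra_simps)
      have "of_real \<Lambda> * (z + 0 * w + 0 + 1 * t) + of_real f * (of_real \<alpha> * (w + 0)) + 0 =
        of_real \<Lambda> * z + of_real f * w + 0 + of_real (row_mult k0 b') * (of_real \<mu> * w + of_real \<nu>) + of_real (q.\<delta> k0 + q.P * of_int j0) + 1 * t'"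
        using e(2) t' by algebra
      then show "of_real \<Lambda> * (z + of_real (row_mult 0 b) * w + of_real (p.\<delta> 0 + p.P * of_int 0) + of_int 1 * t) + of_real f * (of_real (\<alpha> powi 1) * (w + of_real (row_mult 0 a))) + 0 =
        of_real \<Lambda> * z + of_real f * w + 0 + of_real (row_mult k0 b') * (of_real \<mu> * w + of_real \<nu>) + of_real (q.\<delta> k0 + q.P * of_int j0) + of_int 1 * t'"
        by simp
    qed
  qed
  have T1: "\<exists>k' j'. \<forall>u\<in>U_dom. F (p.T 0 k 0 u) = q.T 0 k' j' (F u)" for k
  proof -
    obtain k' where k': "\<mu> * row_mult k a = row_mult k' a'" "\<Lambda> * row_mult k b = \<mu> * row_mult k' b'"
      "[\<Lambda> * p.\<delta> k + f * row_mult k a = \<nu> * row_mult k' b' + q.\<delta> k'] (rmod q.P)"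
      using 1 unfolding corresponds_def by blast
    then obtain j where "\<nu> * row_mult k' b' + q.\<delta> k' = \<Lambda> * p.\<delta> k + f * row_mult k a + of_int j * q.P"
      unfolding rcong_altdef by blast
    then have "\<Lambda> * (p.\<delta> k + p.P * of_int 0) + f * row_mult k a = \<nu> * row_mult k' b' + (q.\<delta> k' + q.P * of_int (- j))"
      by (simp add: algebra_simps)
    from conj0[OF k'(1,2) this] show ?thesis by blast
  qed
  have T2: "\<exists>k j. \<forall>u\<in>U_dom. F (p.T 0 k j u) = q.T 0 k' i (F u)" for k' i
  proof -
    obtain k where k: "\<mu> * row_mult k a = row_mult k' a'" "\<Lambda> * row_mult k b = \<mu> * row_mult k' b'"
      "[\<Lambda> * p.\<delta> k + f * row_mult k a = \<nu> * row_mult k' b' + q.\<delta> k'] (rmod q.P)"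
      using 2 unfolding corresponds_def by blast
    then obtain j where j: "\<nu> * row_mult k' b' + q.\<delta> k' = \<Lambda> * p.\<delta> k + f * row_mult k a + of_int j * q.P"
      unfolding rcong_altdef by blast
    \<comment> \<open>The prescribed exponent \<open>i\<close> is reached exactly, with the sign by
      which the two periods correspond.\<close>
    define j' where "j' = (if \<Lambda> * p.P = q.P then j + i else - (j + i))"
    have "\<Lambda> * p.P * of_int j' = of_int (j + i) * q.P" 
    proof (cases "\<Lambda> * p.P = q.P")
      case False
      then have "\<Lambda> * p.P = - q.P" using per by blast
      then show ?thesis using False by (simp only: j'_def if_False of_int_minus) (simp add: algebra_simps)
    qed (simp add: j'_def)
    then have "\<Lambda> * (p.\<delta> k + p.P * of_int j') + f * row_mult k a = \<nu> * row_mult k' b' + (q.\<delta> k' + q.P * of_int i)"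
      using j by (simp add: algebra_simps)
    from conj0[OF k(1,2) this] show ?thesis by blast
  qed
  have T3: "\<exists>j. \<forall>u\<in>U_dom. F (p.T 0 0 1 u) = q.T 0 0 j (F u)"
  proof -
    define s :: int where "s = (if \<Lambda> * p.P = q.P then 1 else - 1)"
    have s: "\<Lambda> * p.P = q.P * of_int s" using per by (auto simp: s_def)
    have "\<forall>u\<in>U_dom. F (p.T 0 0 1 u) = q.T 0 0 s (F u)"
      by (intro ballI conj0; simp add: s)
    then show ?thesis by blast
  qed
  have reverse: "\<exists>h\<in>p.G. \<forall>u\<in>U_dom. F' (q.T n' k' j' u) = h (F' u)"
    if h: "\<forall>u\<in>U_dom. F (p.T n k j u) = q.T n' k' j' (F u)" for n k j n' k' j'
  proof (rule bexI[of _ "p.T n k j"])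
    show "p.T n k j \<in> p.G" using p.mem_G_iff by blast
    then have in_U: "p.T n k j u \<in> U_dom" if "u \<in> U_dom" for u using that by (rule p.G_closed)
    show "\<forall>u\<in>U_dom. F' (q.T n' k' j' u) = p.T n k j (F' u)"
    proof
      fix u assume u: "u \<in> U_dom"
      then have "q.T n' k' j' u = F (p.T n k j (F' u))" using h inv by simp
      then show "F' (q.T n' k' j' u) = p.T n k j (F' u)" using in_U inv u by simp
    qed
  qed
  have "orbit_equivalence U_dom p.G q.G F F'"
  proof (rule orbit_equivalence_of_generators[OF hol inv])
    fix n :: int and k :: "int^2" and j :: int
    assume "(n, k, j) \<in> {(1, 0, 0), (0, axis 1 1, 0), (0, axis 2 1, 0), (0, 0, 1)}"
    then consider "n = 1" "k = 0" "j = 0" | "n = 0" "j = 0" | "n = 0" "k = 0" "j = 1" by auto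
    then have "\<exists>n' k' j'. \<forall>u\<in>U_dom. F (p.T n k j u) = q.T n' k' j' (F u)"
      using conj1 T1 T3 by cases blast+
    then show "\<exists>h\<in>q.G. \<forall>u\<in>U_dom. F (p.T n k j u) = h (F u)" using q.mem_G_iff by blast
  next
    let ?H = "{g \<in> Bij U_dom. \<exists>h\<in>p.G. \<forall>u\<in>U_dom. F' (g u) = h (F' u)}"
    have H: "subgroup ?H (BijGroup U_dom)"
      by (rule rev.intertwined_subgroup) (use inv in blast)
    have h0: "q.T 0 k i \<in> ?H" for k i
      using T2[of k i] reverse q.T_Bij by blast
    have "q.T 1 k0 j0 \<in> ?H"
      using conj1 reverse[of 1 0 0 1 k0 j0] q.T_Bij by blast
    have mult: "compose U_dom (q.T n k j) (q.T n' k' j') \<in> ?H" if "q.T n k j \<in> ?H" "q.T n' k' j' \<in> ?H" for n k j n' k' j'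
      using subgroup.m_closed[OF H that] unfolding q.mult_BijGroup_T .
    \<comment> \<open>\<open>conj1\<close> only covers the element of the target with lattice part
      \<open>k0\<close>. Multiplying it by a lattice element with exponents \<open>- k0\<close>,
      which \<open>h0\<close> covers, leaves the target \<open>g\<^sub>0\<close>.\<close>
    obtain i where i: "\<And>j j'. compose U_dom (q.T 1 k0 j) (q.T 0 (- k0) j') = q.T 1 (k0 + - k0) (j + j' + i)"
      using q.T_compose_0 by blast
    have "q.T 1 0 0 \<in> ?H"
      using mult[OF \<open>q.T 1 k0 j0 \<in> ?H\<close> h0[of "- k0" "- j0 - i"]] unfolding i by simp
    fix n :: int and k :: "int^2" and j :: int
    assume "(n, k, j) \<in> {(1, 0, 0), (0, axis 1 1, 0), (0, axis 2 1, 0), (0, 0, 1)}"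
    then have "q.T n k j \<in> ?H" using h0 \<open>q.T 1 0 0 \<in> ?H\<close> by blast
    then show "\<exists>h\<in>p.G. \<forall>u\<in>U_dom. F' (q.T n k j u) = h (F' u)" by blast
  qed
  then show ?thesis by blast
qed

end

section \<open>The actions on reduced parameters\<close>

lemma rcong_minus_modulus: "[x = y] (rmod - m) \<longleftrightarrow> [x = y] (rmod m)"
  unfolding rcong_altdef by (metis minus_minus mult_minus_left mult_minus_right of_int_minus)

lemma rcong_mult_left: "[x = y] (rmod m) \<Longrightarrow> [k * x = k * y] (rmod k * m)"
  unfolding rcong_altdef by (auto simp: algebra_simps)

lemma rcong_mult_of_int: "[x = y] (rmod m) \<Longrightarrow> [of_int n * x = of_int n * y] (rmod m)"
  unfolding rcong_altdef by (elim exE, rule_tac x = "n * na" in exI) (simp add: algebra_simps)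

lemma row_mult_rcong:
  assumes "\<And>i. [c$i = c'$i] (rmod m)"
  shows "[row_mult k c = row_mult k c'] (rmod m)"
  unfolding row_mult_def using assms by (intro rcong_add rcong_mult_of_int)

lemma delta_change_c: "delta a b c' k = delta a b c k + (row_mult k c' - row_mult k c)"
  by (simp add: delta_def)

lemma delta_rcong:
  assumes "\<And>i. [c$i = c'$i] (rmod m)"
  shows "[delta a b c' k = delta a b c k] (rmod m)"
proof -
  have "delta a b c' k = delta a b c k - row_mult k c + row_mult k c'"
    "delta a b c k - row_mult k c + row_mult k c = delta a b c k"
    by (simp_all add: delta_change_c[of a b c' k c])
  then show ?thesis
    using rcong_add[OF rcong_refl[of "delta a b c k - row_mult k c"] rcong_sym[OF row_mult_rcong[of c c' m k, OF assms]]]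
    by (simp only:)
qed

lemma delta_minus:
  assumes "r > 0"
  shows "[delta a b c (- k) = row_mult k b * row_mult k a - delta a b c k] (rmod period a b r)"
proof -
  have "[0 = delta a b c k + delta a b c (- k) - row_mult k b * row_mult k a] (rmod period a b r)"
    using delta_add[OF assms, of a b c k "- k"] by (simp add: row_mult_minus)
  from rcong_add[OF this rcong_refl[of "row_mult k b * row_mult k a - delta a b c k"]]
  show ?thesis by (simp add: rcong_sym_iff)
qed

definition tcong :: "real \<Rightarrow> complex \<Rightarrow> complex \<Rightarrow> bool" where
  "tcong m t t' \<longleftrightarrow> (\<exists>n::int. t' = t + of_real m * of_int n)"

lemma tcong_of_real: "[x = y] (rmod m) \<Longrightarrow> tcong m (t + of_real x) (t + of_real y)"
  unfolding rcong_altdef tcong_def by (auto simp: algebra_simps)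

lemma tcong_refl: "tcong m t t"
  unfolding tcong_def by (intro exI[of _ 0]) simp

lemma tcong_sym: "tcong m t t' \<Longrightarrow> tcong m t' t"
  unfolding tcong_def by (elim exE, rule_tac x = "- n" in exI) simp

lemma tcong_trans: "tcong m t t' \<Longrightarrow> tcong m t' t'' \<Longrightarrow> tcong m t t''"
  unfolding tcong_def by (elim exE, rule_tac x = "n + na" in exI) (simp add: algebra_simps)

lemma coset_c_eq: "coset_c a b r c = {c'. \<forall>i. [c$i = c'$i] (rmod period a b r)}"
proof (intro Set.set_eqI iffI)
  fix c' assume "c' \<in> coset_c a b r c"
  then obtain v :: "real^2" where v: "c' = c + period a b r *\<^sub>R v" "\<forall>i. v$i \<in> \<int>"
    unfolding coset_c_def lattice2_def by blast
  have "[c$i = c'$i] (rmod period a b r)" for i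
  proof -
    obtain n where "v$i = of_int n" using v(2) by (auto elim: Ints_cases)
    then show ?thesis unfolding rcong_altdef v(1) by (intro exI[of _ n]) simp
  qed
  then show "c' \<in> {c'. \<forall>i. [c$i = c'$i] (rmod period a b r)}" by blast
next
  fix c' assume "c' \<in> {c'. \<forall>i. [c$i = c'$i] (rmod period a b r)}"
  then have "\<forall>i. \<exists>n. c'$i = c$i + of_int n * period a b r" unfolding rcong_altdef by blast
  then obtain n where n: "\<And>i. c'$i = c$i + of_int (n i) * period a b r" by metis
  have "c' = c + period a b r *\<^sub>R (\<chi> i. of_int (n i))"
    by (simp add: vec_eq_iff n)
  moreover have "\<forall>i. ((\<chi> i. of_int (n i)) :: real^2) $ i \<in> \<int>" by simp
  ultimately show "c' \<in> coset_c a b r c" unfolding coset_c_def lattice2_def by blast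
qed

lemma coset_t_eq: "coset_t a b r t = {t'. tcong (period a b r) t t'}"
  unfolding coset_t_def tcong_def by auto

lemma reduce_eq_iff:
  "reduce r (a, b, c, t) = reduce r (a, b, c', t') \<longleftrightarrow>
    (\<forall>i. [c$i = c'$i] (rmod period a b r)) \<and> tcong (period a b r) t t'"
proof
  assume "reduce r (a, b, c, t) = reduce r (a, b, c', t')"
  then have "coset_c a b r c = coset_c a b r c'" "coset_t a b r t = coset_t a b r t'"
    by (simp_all add: reduce_def)
  then show "(\<forall>i. [c$i = c'$i] (rmod period a b r)) \<and> tcong (period a b r) t t'"
    unfolding coset_c_eq coset_t_eq using tcong_refl by blast
next
  assume *: "(\<forall>i. [c$i = c'$i] (rmod period a b r)) \<and> tcong (period a b r) t t'"
  then have "[c$i = x] (rmod period a b r) \<longleftrightarrow> [c'$i = x] (rmod period a b r)"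
    "tcong (period a b r) t s \<longleftrightarrow> tcong (period a b r) t' s" for i x s
    by (meson rcong_trans rcong_sym tcong_trans tcong_sym)+
  then have "coset_c a b r c = coset_c a b r c'" "coset_t a b r t = coset_t a b r t'"
    unfolding coset_c_eq coset_t_eq by (intro Collect_cong; simp)+
  then show "reduce r (a, b, c, t) = reduce r (a, b, c', t')" by (simp add: reduce_def)
qed

text \<open>When \<open>F\<close> respects the congruences, all representatives have the same image
  and \<open>the_elem\<close> is applied to a singleton. The actions by scaling, by \<int>^2 and by
  GL are all evaluated through this lemma.\<close>

lemma descend_reduce:
  assumes "\<And>c' t'. (\<And>i. [c$i = c'$i] (rmod period a b r)) \<Longrightarrow> tcong (period a b r) t t' \<Longrightarrow>
    reduce r (F (a, b, c', t')) = reduce r (F (a, b, c, t))"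
  shows "descend r F (reduce r (a, b, c, t)) = reduce r (F (a, b, c, t))"
proof -
  have "(\<lambda>(c, t). reduce r (F (a, b, c, t))) ` (coset_c a b r c \<times> coset_t a b r t) = {reduce r (F (a, b, c, t))}"
  proof (intro subset_antisym subsetI)
    fix x assume "x \<in> (\<lambda>(c, t). reduce r (F (a, b, c, t))) ` (coset_c a b r c \<times> coset_t a b r t)"
    then show "x \<in> {reduce r (F (a, b, c, t))}" using assms unfolding coset_c_eq coset_t_eq by auto
  next
    fix x assume "x \<in> {reduce r (F (a, b, c, t))}"
    moreover have "c \<in> coset_c a b r c" "t \<in> coset_t a b r t"
      unfolding coset_c_eq coset_t_eq using tcong_refl by auto
    ultimately show "x \<in> (\<lambda>(c, t). reduce r (F (a, b, c, t))) ` (coset_c a b r c \<times> coset_t a b r t)"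
      by (intro image_eqI[of _ _ "(c, t)"]) auto
  qed
  then show ?thesis by (simp add: descend_def reduce_def)
qed

section \<open>The three moves on representatives\<close>

type_synonym params = "(real^2) \<times> (real^2) \<times> (real^2) \<times> complex"

text \<open>This and the next two are the functions inside \<open>act_scale\<close>,
  \<open>act_Z2\<close> and \<open>act_GL\<close>, named so that membership, equivalence and
  reduction can be studied on representatives.\<close>

definition scale_param :: "real \<Rightarrow> real \<Rightarrow> params \<Rightarrow> params" where
  "scale_param \<mu> \<rho> = (\<lambda>(a, b, c, t). (\<mu> *\<^sub>R a, \<rho> *\<^sub>R b, (\<mu> * \<rho>) *\<^sub>R c, of_real (\<mu> * \<rho>) * t))"

definition shift_param :: "real \<Rightarrow> int^2 \<Rightarrow> params \<Rightarrow> params" where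
  "shift_param \<alpha> k = (\<lambda>(a, b, c, t). (a, b, shift_c \<alpha> a b k c, shift_t \<alpha> a b k c t))"

definition GL_param :: "int^2^2 \<Rightarrow> params \<Rightarrow> params" where
  "GL_param K = (\<lambda>(a, b, c, t). let M = real_matrix K; A = M *v a; B = M *v b in
       (A, B, (1/2) *\<^sub>R cwise A B + M *v (c - (1/2) *\<^sub>R cwise a b) + (wedge b a / 2) *\<^sub>R (\<chi> i. M$i$1 * M$i$2), t))"

text \<open>The half products in the definition combine into \<open>delta\<close>: the new
  \<open>c$i\<close> is the constant term of the element with exponents \<open>K$i\<close>. So the
  action is a change of generators of the lattice part.\<close>

lemma GL_param_eq:
  "GL_param K (a, b, c, t) = (real_matrix K *v a, real_matrix K *v b, (\<chi> i. delta a b c (K$i)), t)"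
proof -
  have "((1/2) *\<^sub>R cwise (real_matrix K *v a) (real_matrix K *v b) + real_matrix K *v (c - (1/2) *\<^sub>R cwise a b)
      + (wedge b a / 2) *\<^sub>R (\<chi> i. real_matrix K$i$1 * real_matrix K$i$2)) $ i = delta a b c (K$i)" for i
    by (simp add: cwise_def real_matrix_vector)
      (simp add: real_matrix_def delta_def row_mult_def wedge_def field_simps)
  then show ?thesis by (simp add: GL_param_def Let_def vec_eq_iff)
qed

lemma shift_t_eq:
  "shift_t \<alpha> a b k c t = t + of_real (\<alpha> * row_mult k a * row_mult k b / (1 - \<alpha>) + delta a b c k)"
  by (simp add: shift_t_def delta_def add.assoc)

lemma row_mult_shift_c:
  "row_mult l (shift_c \<alpha> a b k c) = row_mult l c - \<alpha> * row_mult k a / (\<alpha> - 1) * row_mult l b - row_mult k b / (\<alpha> - 1) * row_mult l a"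
proof -
  have "row_mult l (c - x *\<^sub>R b - y *\<^sub>R a) = row_mult l c - x * row_mult l b - y * row_mult l a" for x y
    by (simp add: row_mult_def algebra_simps)
  then show ?thesis unfolding shift_c_def .
qed

lemma period_scale: "period (\<mu> *\<^sub>R a) (\<rho> *\<^sub>R b) r = \<mu> * \<rho> * period a b r"
  by (simp add: period_def wedge_def algebra_simps)

lemma delta_scale: "delta (\<mu> *\<^sub>R a) (\<rho> *\<^sub>R b) ((\<mu> * \<rho>) *\<^sub>R c) k = \<mu> * \<rho> * delta a b c k"
  by (simp add: delta_def row_mult_scaleR algebra_simps add_divide_distrib)

lemma wedge_matrix:
  "wedge (real_matrix K *v b) (real_matrix K *v a) = of_int (det K) * wedge b a"
  by (simp add: wedge_def real_matrix_vector row_mult_def det_2 algebra_simps)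

lemma det_invertible_int:
  fixes K :: "int^2^2"
  assumes "invertible K"
  shows "det K = 1 \<or> det K = - 1"
proof -
  obtain K' where "K ** K' = mat 1" using assms unfolding invertible_def by blast
  then have "det K * det K' = 1" by (metis det_I det_mul)
  then show ?thesis by (simp add: zmult_eq_1_iff) blast
qed

lemma period_matrix:
  assumes "invertible K"
  shows "period (real_matrix K *v a) (real_matrix K *v b) r = period a b r \<or>
    period (real_matrix K *v a) (real_matrix K *v b) r = - period a b r"
  using det_invertible_int[OF assms] by (auto simp: period_def wedge_matrix)

lemma rcong_period_matrix:
  assumes "invertible K"
  shows "[x = y] (rmod period (real_matrix K *v a) (real_matrix K *v b) r) \<longleftrightarrow> [x = y] (rmod period a b r)"
  using period_matrix[OF assms, of a b r] rcong_minus_modulus by metis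

text \<open>Biholomorphism of the surfaces, expressed upstairs and on parameters;
  \<open>biholomorphic_iff_surface_equiv\<close> gives the translation.\<close>

definition surface_equiv :: "real \<Rightarrow> nat \<Rightarrow> params \<Rightarrow> params \<Rightarrow> bool" where
  "surface_equiv \<alpha> r = (\<lambda>(a, b, c, t) (a', b', c', t').
     \<exists>F F'. orbit_equivalence U_dom (inoue_group \<alpha> a b c r t) (inoue_group \<alpha> a' b' c' r t') F F')"

lemma surface_equiv_refl: "surface_equiv \<alpha> r p p"
  unfolding surface_equiv_def using orbit_equivalence_id by (auto split: prod.split)

lemma surface_equiv_sym: "surface_equiv \<alpha> r p q \<Longrightarrow> surface_equiv \<alpha> r q p"
  unfolding surface_equiv_def case_prod_unfold using orbit_equivalence_sym by blast

lemma surface_equiv_trans: "surface_equiv \<alpha> r p q \<Longrightarrow> surface_equiv \<alpha> r q s \<Longrightarrow> surface_equiv \<alpha> r p s"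
  unfolding surface_equiv_def case_prod_unfold using orbit_equivalence_trans by blast

lemma vector_matrix_mult_assoc: "(k v* (A :: int^2^2)) v* B = k v* (A ** B)"
  by (simp add: vec_eq_iff vector_matrix_mult_def matrix_matrix_mult_def sum_2 forall_2 algebra_simps)

lemma row_matrix_mult: "((A :: int^2^2) ** B) $ i = A $ i v* B"
  by (simp add: vec_eq_iff vector_matrix_mult_def matrix_matrix_mult_def sum_2 forall_2 algebra_simps)

lemma vector_matrix_mult_1: "k v* (mat 1 :: int^2^2) = k"
  by (simp add: vec_eq_iff vector_matrix_mult_def mat_def sum_2 forall_2)

context inoue
begin

lemma scale_param_mem:
  assumes "\<mu> > 0" "\<rho> \<noteq> 0"
  shows "scale_param \<mu> \<rho> (a, b, c, t) \<in> param_set \<alpha> r"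
  unfolding scale_param_def case_prod_conv mem_param_set_iff[OF \<alpha>_nonzero]
proof (intro conjI exI[of _ N] allI)
  show "wedge (\<rho> *\<^sub>R b) (\<mu> *\<^sub>R a) \<noteq> 0"
    using wedge_nonzero assms by (simp add: wedge_def algebra_simps) 
  show "lattice_matrix \<alpha> (\<mu> *\<^sub>R a) (\<rho> *\<^sub>R b) N"
    using N(1) by (simp add: lattice_matrix_def row_mult_scaleR)
  show "[delta (\<mu> *\<^sub>R a) (\<rho> *\<^sub>R b) ((\<mu> * \<rho>) *\<^sub>R c) (N $ i) = ((\<mu> * \<rho>) *\<^sub>R c) $ i] (rmod period (\<mu> *\<^sub>R a) (\<rho> *\<^sub>R b) r)" for i
    using rcong_mult_left[OF N(2)[of i], of "\<mu> * \<rho>"] by (simp add: delta_scale period_scale)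
qed

text \<open>Realised by (w, z) -> (\<mu> w, \<mu> \<rho> z), which keeps all exponents.\<close>

lemma scale_param_equiv:
  assumes "\<mu> > 0" "\<rho> \<noteq> 0"
  shows "surface_equiv \<alpha> r (a, b, c, t) (scale_param \<mu> \<rho> (a, b, c, t))"
proof -
  interpret pr: inoue_pair \<alpha> r a b c t "\<mu> *\<^sub>R a" "\<rho> *\<^sub>R b" "(\<mu> * \<rho>) *\<^sub>R c" "of_real (\<mu> * \<rho>) * t"
    using scale_param_mem[OF assms] \<alpha>_gt_1 r_pos by unfold_locales (simp_all add: scale_param_def)
  have *: "pr.corresponds \<mu> 0 (\<mu> * \<rho>) 0 k k" for k
    by (simp add: pr.corresponds_def row_mult_scaleR delta_scale)
  have "\<exists>F F'. orbit_equivalence U_dom G pr.q.G F F'"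
  proof (rule pr.orbit_equivalence_of_parameters[where \<mu> = \<mu> and \<Lambda> = "\<mu> * \<rho>" and f = 0 and \<nu> = 0 and ?k0.0 = 0 and ?j0.0 = 0])
    show "\<mu> * \<rho> * P = pr.q.P \<or> \<mu> * \<rho> * P = - pr.q.P" by (simp add: period_scale)
  qed (rule assms(1) | (rule exI, rule *) | (use assms in simp))+
  then show ?thesis by (simp add: surface_equiv_def scale_param_def)
qed

lemma act_scale_reduce:
  assumes "\<mu> > 0" "\<rho> \<noteq> 0"
  shows "act_scale r (\<mu>, \<rho>) (reduce r (a, b, c, t)) = reduce r (scale_param \<mu> \<rho> (a, b, c, t))"
  unfolding act_scale_def case_prod_conv scale_param_def[symmetric]
proof (rule descend_reduce)
  fix c' t' assume c': "\<And>i. [c$i = c'$i] (rmod P)" and t': "tcong P t t'"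
  have "[((\<mu> * \<rho>) *\<^sub>R c') $ i = ((\<mu> * \<rho>) *\<^sub>R c) $ i] (rmod \<mu> * \<rho> * P)" for i
    using rcong_mult_left[OF rcong_sym[OF c'[of i]], of "\<mu> * \<rho>"] by simp
  moreover have "tcong (\<mu> * \<rho> * P) (of_real (\<mu> * \<rho>) * t') (of_real (\<mu> * \<rho>) * t)"
    using tcong_sym[OF t'] unfolding tcong_def by (auto simp: algebra_simps)
  ultimately show "reduce r (scale_param \<mu> \<rho> (a, b, c', t')) = reduce r (scale_param \<mu> \<rho> (a, b, c, t))"
    unfolding scale_param_def case_prod_conv reduce_eq_iff period_scale by blast
qed

lemma cross_rcong_0: "[row_mult k a * row_mult l b - row_mult k b * row_mult l a = 0] (rmod P)"
proof -
  have "row_mult k a * row_mult l b - row_mult k b * row_mult l a = 0 + of_int (k$2 * l$1 - k$1 * l$2) * wedge b a"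
    by (simp add: row_mult_def wedge_def algebra_simps)
  then show ?thesis using rcong_wedge[OF r_pos, of 0] by metis
qed

lemma shift_param_mem: "shift_param \<alpha> k (a, b, c, t) \<in> param_set \<alpha> r"
  unfolding shift_param_def case_prod_conv mem_param_set_iff[OF \<alpha>_nonzero]
proof (intro conjI exI[of _ N] allI)
  show "wedge b a \<noteq> 0" by (rule wedge_nonzero)
  show "lattice_matrix \<alpha> a b N" by (rule N)
  fix i
  let ?x = "\<alpha> * row_mult k a / (\<alpha> - 1)" and ?y = "row_mult k b / (\<alpha> - 1)"
  have Ni: "row_mult (N$i) a = \<alpha> * a$i" "row_mult (N$i) b = inverse \<alpha> * b$i"
    using N(1) by (auto simp: lattice_matrix_def)
  have "delta a b (shift_c \<alpha> a b k c) (N $ i) = \<delta> (N$i) + (- ?x * (inverse \<alpha> * b$i) - ?y * (\<alpha> * a$i))"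
    unfolding delta_change_c[of a b "shift_c \<alpha> a b k c" _ c] row_mult_shift_c Ni by simp
  \<comment> \<open>The changes of \<open>delta\<close> at \<open>N$i\<close> and of
    \<open>c$i\<close> differ by the commutator term
    \<open>row_mult k a * b$i - row_mult k b * a$i\<close>, which \<open>cross_rcong_0\<close>
    removes modulo \<open>P\<close>.\<close>
  moreover have "shift_c \<alpha> a b k c $ i + (row_mult k a * b$i - row_mult k b * a$i) = c$i + (- ?x * (inverse \<alpha> * b$i) - ?y * (\<alpha> * a$i))"
  proof -
    define X where "X = ?x"
    define Y where "Y = ?y"
    define V where "V = row_mult k a / (\<alpha> - 1)"
    have "X = row_mult k a + V" "Y * \<alpha> = Y + row_mult k b" "X * inverse \<alpha> = V"
      using \<alpha>_gt_1 by (simp_all add: X_def Y_def V_def field_simps)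
    then have "c$i - X * b$i - Y * a$i + (row_mult k a * b$i - row_mult k b * a$i) = c$i + (- X * (inverse \<alpha> * b$i) - Y * (\<alpha> * a$i))"
      by algebra
    then show ?thesis by (simp add: shift_c_def X_def Y_def)
  qed
  moreover have "[\<delta> (N$i) + z = c$i + z] (rmod P)" for z using N(2) by simp
  ultimately have "[delta a b (shift_c \<alpha> a b k c) (N $ i) = shift_c \<alpha> a b k c $ i + (row_mult k a * b$i - row_mult k b * a$i)] (rmod P)"
    by (simp only:)
  also have "[shift_c \<alpha> a b k c $ i + (row_mult k a * b$i - row_mult k b * a$i) = shift_c \<alpha> a b k c $ i] (rmod P)"
    using rcong_add[OF rcong_refl cross_rcong_0[of k "axis i 1"]] by simp
  finally show "[delta a b (shift_c \<alpha> a b k c) (N $ i) = shift_c \<alpha> a b k c $ i] (rmod P)" .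
qed

text \<open>Realised by (w, z) -> (w + \<nu>, z + f w) with \<nu> = \<alpha> ka / (\<alpha> - 1) and
  f = - kb / (\<alpha> - 1). It keeps the exponents of lattice elements and gives the conjugate of
  \<open>g\<^sub>0\<close> the exponents \<open>- k\<close>. These values of \<nu> and f solve the
  two equations that this imposes.\<close>

lemma shift_param_equiv: "surface_equiv \<alpha> r (a, b, c, t) (shift_param \<alpha> k (a, b, c, t))"
proof -
  interpret pr: inoue_pair \<alpha> r a b c t a b "shift_c \<alpha> a b k c" "shift_t \<alpha> a b k c t"
    using shift_param_mem[of k] \<alpha>_gt_1 r_pos by unfold_locales (simp_all add: shift_param_def)
  define x where "x = row_mult k a"
  define y where "y = row_mult k b"
  have d: "pr.q.\<delta> l = \<delta> l - \<alpha> * x / (\<alpha> - 1) * row_mult l b - y / (\<alpha> - 1) * row_mult l a" for l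
    unfolding delta_change_c[of a b "shift_c \<alpha> a b k c" _ c] row_mult_shift_c x_def y_def by simp
  have c12: "pr.corresponds 1 (\<alpha> * x / (\<alpha> - 1)) 1 (- y / (\<alpha> - 1)) l l" for l
    unfolding pr.corresponds_def d by simp
  have "[pr.q.\<delta> (- k) = \<alpha> * x / (\<alpha> - 1) * y + (- (\<alpha> * x * y / (1 - \<alpha>)) - \<delta> k)] (rmod P)"
  proof -
    define X where "X = \<alpha> * x / (\<alpha> - 1) * y"
    define Y where "Y = y / (\<alpha> - 1) * x"
    define Z where "Z = \<alpha> * x * y / (1 - \<alpha>)"
    have "pr.q.\<delta> (- k) = \<delta> (- k) + (X + Y)"
      unfolding d row_mult_minus x_def[symmetric] y_def[symmetric] X_def Y_def by simp
    moreover have "y * x + Y = - Z"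
      using \<alpha>_gt_1 by (simp add: Y_def Z_def field_simps)
    then have "y * x - \<delta> k + (X + Y) = X + (- Z - \<delta> k)" by linarith
    moreover have "[\<delta> (- k) + (X + Y) = y * x - \<delta> k + (X + Y)] (rmod P)"
      using rcong_add[OF delta_minus[OF r_pos, of a b c k] rcong_refl[of "X + Y"]] by (simp only: x_def y_def)
    ultimately have "[pr.q.\<delta> (- k) = X + (- Z - \<delta> k)] (rmod P)" by (simp only:)
    then show ?thesis unfolding X_def Z_def .
  qed
  then obtain j where j: "\<alpha> * x / (\<alpha> - 1) * y + (- (\<alpha> * x * y / (1 - \<alpha>)) - \<delta> k) = pr.q.\<delta> (- k) + of_int j * P"
    unfolding rcong_altdef by blast
  have "\<alpha> * x * y / (1 - \<alpha>) + \<delta> k = - (row_mult (- k) b * (\<alpha> * x / (\<alpha> - 1)) + pr.q.\<delta> (- k) + P * of_int j)"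
    using j unfolding row_mult_minus y_def[symmetric] by (simp add: algebra_simps)
  then have t: "shift_t \<alpha> a b k c t = of_real 1 * t - of_real (row_mult (- k) b * (\<alpha> * x / (\<alpha> - 1)) + pr.q.\<delta> (- k) + P * of_int j)"
    unfolding shift_t_eq x_def[symmetric] y_def[symmetric]
    by (simp only: of_real_minus of_real_1 mult_1 add_uminus_conv_diff)
  have "\<exists>F F'. orbit_equivalence U_dom G pr.q.G F F'"
  proof (rule pr.orbit_equivalence_of_parameters[where \<mu> = 1 and \<Lambda> = 1 and f = "- y / (\<alpha> - 1)" and \<nu> = "\<alpha> * x / (\<alpha> - 1)" and ?k0.0 = "- k"])
    show "(1 - \<alpha>) * (\<alpha> * x / (\<alpha> - 1)) = \<alpha> * row_mult (- k) a"
      "(\<alpha> - 1) * (- y / (\<alpha> - 1)) = 1 * row_mult (- k) b"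
      using \<alpha>_gt_1 by (simp_all add: row_mult_minus x_def y_def field_simps)
  qed (rule t | (rule exI, rule c12) | simp)+
  then show ?thesis by (simp add: surface_equiv_def shift_param_def)
qed

lemma act_Z2_reduce: "act_Z2 \<alpha> r k (reduce r (a, b, c, t)) = reduce r (shift_param \<alpha> k (a, b, c, t))"
  unfolding act_Z2_def shift_param_def[symmetric]
proof (rule descend_reduce)
  fix c' t' assume c': "\<And>i. [c$i = c'$i] (rmod P)" and t': "tcong P t t'"
  have "[shift_c \<alpha> a b k c' $ i = shift_c \<alpha> a b k c $ i] (rmod P)" for i
    using rcong_sym[OF c'[of i]] by (simp add: shift_c_def)
  moreover have "tcong P (shift_t \<alpha> a b k c' t') (shift_t \<alpha> a b k c t)"
  proof (rule tcong_trans)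
    show "tcong P (shift_t \<alpha> a b k c' t') (shift_t \<alpha> a b k c' t)"
      using tcong_sym[OF t'] unfolding tcong_def shift_t_eq by (auto simp: algebra_simps)
    have "[delta a b c' k = \<delta> k] (rmod P)" by (rule delta_rcong[OF c'])
    then show "tcong P (shift_t \<alpha> a b k c' t) (shift_t \<alpha> a b k c t)"
      unfolding shift_t_eq by (intro tcong_of_real) simp
  qed
  ultimately show "reduce r (shift_param \<alpha> k (a, b, c', t')) = reduce r (shift_param \<alpha> k (a, b, c, t))"
    unfolding shift_param_def case_prod_conv reduce_eq_iff by blast
qed

end

context inoue
begin

text \<open>Exponents \<open>k\<close> for the new generators are exponents \<open>k v* K\<close>
  for the old ones, so the constant terms agree up to powers of \<open>g\<^sub>3\<close>.\<close>

lemma delta_GL: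
  assumes "invertible K"
  shows "[delta (real_matrix K *v a) (real_matrix K *v b) (\<chi> i. \<delta> (K$i)) k = \<delta> (k v* K)] (rmod P)"
proof (rule rcong_sym, rule delta_vector_matrix[OF r_pos])
  fix k l
  show "[delta (real_matrix K *v a) (real_matrix K *v b) (\<chi> i. \<delta> (K$i)) (k + l)
    = delta (real_matrix K *v a) (real_matrix K *v b) (\<chi> i. \<delta> (K$i)) k + delta (real_matrix K *v a) (real_matrix K *v b) (\<chi> i. \<delta> (K$i)) l
      + row_mult k (real_matrix K *v b) * row_mult l (real_matrix K *v a)] (rmod P)"
    using delta_add[OF r_pos] rcong_period_matrix[OF assms] by blast
qed (simp_all add: row_mult_real_matrix)

lemma GL_param_mem:
  assumes "invertible K"
  shows "GL_param K (a, b, c, t) \<in> param_set \<alpha> r"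
proof -
  obtain K' where K': "K ** K' = mat 1" "K' ** K = mat 1" using assms unfolding invertible_def by blast
  have row: "(K ** N ** K') $ i v* K = K $ i v* N" for i
    unfolding row_matrix_mult[symmetric] by (simp add: K' flip: matrix_mul_assoc)
  show ?thesis
    unfolding GL_param_eq mem_param_set_iff[OF \<alpha>_nonzero]
  \<comment> \<open>In the new basis the integer matrix is the conjugate of \<open>N\<close> by
    \<open>K\<close>.\<close>
  proof (intro conjI exI[of _ "K ** N ** K'"] allI)
    show "wedge (real_matrix K *v b) (real_matrix K *v a) \<noteq> 0"
      using det_invertible_int[OF assms] wedge_nonzero by (auto simp: wedge_matrix)
    show "lattice_matrix \<alpha> (real_matrix K *v a) (real_matrix K *v b) (K ** N ** K')"
      unfolding lattice_matrix_def row_mult_real_matrix row row_mult_N real_matrix_vector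
      by (simp add: divide_inverse)
    fix i
    have "[delta (real_matrix K *v a) (real_matrix K *v b) (\<chi> i. \<delta> (K$i)) ((K ** N ** K') $ i) = \<delta> (K $ i v* N)] (rmod P)"
      using delta_GL[OF assms, of "(K ** N ** K') $ i"] unfolding row .
    from rcong_trans[OF this delta_N]
    show "[delta (real_matrix K *v a) (real_matrix K *v b) (\<chi> i. \<delta> (K$i)) ((K ** N ** K') $ i) = (\<chi> i. \<delta> (K$i)) $ i]
        (rmod period (real_matrix K *v a) (real_matrix K *v b) r)"
      unfolding rcong_period_matrix[OF assms] by simp
  qed
qed

text \<open>Realised by the identity map, since only the generators change. A matrix of determinant
  -1 replaces \<open>g\<^sub>3\<close> by its inverse, which the two signs in the condition on
  periods allow.\<close>

lemma GL_param_equiv: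
  assumes K: "invertible K"
  shows "surface_equiv \<alpha> r (a, b, c, t) (GL_param K (a, b, c, t))"
proof -
  obtain K' where K': "K ** K' = mat 1" "K' ** K = mat 1" using assms unfolding invertible_def by blast
  interpret pr: inoue_pair \<alpha> r a b c t "real_matrix K *v a" "real_matrix K *v b" "\<chi> i. \<delta> (K$i)" t
    using GL_param_mem[OF K] \<alpha>_gt_1 r_pos by unfold_locales (simp_all add: GL_param_eq)
  have *: "pr.corresponds 1 0 1 0 (k v* K) k" for k
    using rcong_sym[OF delta_GL[OF K, of k]] by (simp add: pr.corresponds_def row_mult_real_matrix rcong_period_matrix[OF K])
  have "\<exists>F F'. orbit_equivalence U_dom G pr.q.G F F'"
  proof (rule pr.orbit_equivalence_of_parameters[where \<mu> = 1 and \<Lambda> = 1 and f = 0 and \<nu> = 0 and ?k0.0 = 0 and ?j0.0 = 0])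
    show "1 * P = pr.q.P \<or> 1 * P = - pr.q.P"
      using period_matrix[OF K, of a b r] by auto
    fix k
    have "k v* K' v* K = k" by (simp add: vector_matrix_mult_assoc K' vector_matrix_mult_1)
    then show "\<exists>k'. pr.corresponds 1 0 1 0 k k'"
      using *[of "k v* K'"] by metis
  qed ((rule exI, rule *) | simp)+
  then show ?thesis by (simp add: surface_equiv_def GL_param_eq)
qed

lemma act_GL_reduce:
  assumes K: "invertible K"
  shows "act_GL r K (reduce r (a, b, c, t)) = reduce r (GL_param K (a, b, c, t))"
  unfolding act_GL_def GL_param_def[symmetric]
proof (rule descend_reduce)
  fix c' t' assume c': "\<And>i. [c$i = c'$i] (rmod P)" and t': "tcong P t t'"
  have "[(\<chi> i. delta a b c' (K$i)) $ i = (\<chi> i. \<delta> (K$i)) $ i] (rmod P)" for i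
    using delta_rcong[OF c', where k = "K$i"] by simp
  moreover have "tcong (period (real_matrix K *v a) (real_matrix K *v b) r) t' t"
    using period_matrix[OF K, of a b r] tcong_sym[OF t'] unfolding tcong_def
    by (auto intro: exI[of _ "- n" for n])
  ultimately show "reduce r (GL_param K (a, b, c', t')) = reduce r (GL_param K (a, b, c, t))"
    unfolding GL_param_eq reduce_eq_iff rcong_period_matrix[OF K] by blast
qed

text \<open>
  With \<open>n = m(N - I)\<close>, shifting by \<open>d m = n - n N\<^sup>-\<^sup>1\<close> is conjugation by a translation of \<open>z\<close>
  composed with an element of the group, and hence does not change the group.
\<close>

lemma shift_param_mod_d:
  assumes d: "of_int d = \<alpha> + 1 / \<alpha> - 2"
  shows "reduce r (shift_param \<alpha> (k + d *s m) (a, b, c, t)) = reduce r (shift_param \<alpha> k (a, b, c, t))"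
proof -
  define l where "l = d *s m"
  define n where "n = m v* N + - m"
  define ma where "ma = row_mult m a"
  define mb where "mb = row_mult m b"
  define ka where "ka = row_mult k a"
  define kb where "kb = row_mult k b"
  define \<beta> where "\<beta> = \<alpha> - 1"
  have \<beta>: "\<beta> \<noteq> 0" "\<alpha> = \<beta> + 1" "\<beta> + 1 \<noteq> 0" using \<alpha>_gt_1 by (auto simp: \<beta>_def)
  have la: "row_mult l a = \<beta>\<^sup>2 / \<alpha> * ma" "row_mult l b = \<beta>\<^sup>2 / \<alpha> * mb"
  proof -
    have "of_int d = \<beta>\<^sup>2 / \<alpha>" unfolding d \<beta>_def by (simp add: field_simps power2_eq_square)
    then show "row_mult l a = \<beta>\<^sup>2 / \<alpha> * ma" "row_mult l b = \<beta>\<^sup>2 / \<alpha> * mb"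
      by (simp_all add: l_def row_mult_smult ma_def mb_def)
  qed
  have na: "row_mult n a = \<beta> * ma" "row_mult n b = - \<beta> / \<alpha> * mb"
    unfolding n_def row_mult_add row_mult_minus row_mult_N ma_def[symmetric] mb_def[symmetric]
    by (simp_all add: \<beta>_def field_simps)
  \<comment> \<open>The row \<open>n\<close> is chosen so that the change of \<open>c\<close> caused
    by \<open>l\<close> is the commutator term of \<open>n\<close> with each row
    \<open>j\<close>.\<close>
  have D: "[\<alpha> * row_mult l a / \<beta> * row_mult j b + row_mult l b / \<beta> * row_mult j a = 0] (rmod P)" for j
  proof -
    have "\<alpha> * row_mult l a / \<beta> * row_mult j b + row_mult l b / \<beta> * row_mult j a = row_mult n a * row_mult j b - row_mult n b * row_mult j a"
      unfolding la na using \<beta>(1) by (simp add: field_simps power2_eq_square)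
    then show ?thesis using cross_rcong_0[of n j] by simp
  qed
  have c_eq: "shift_c \<alpha> a b (k + l) c $ i = shift_c \<alpha> a b k c $ i - (\<alpha> * row_mult l a / \<beta> * row_mult (axis i 1) b + row_mult l b / \<beta> * row_mult (axis i 1) a)" for i
    by (simp add: shift_c_def row_mult_add \<beta>_def algebra_simps add_divide_distrib)
  have C: "[shift_c \<alpha> a b (k + l) c $ i = shift_c \<alpha> a b k c $ i] (rmod P)" for i
    unfolding c_eq using rcong_diff[OF rcong_refl D[of "axis i 1"]] by simp
  obtain v where v: "row_mult v a = \<alpha> powi (- 1) * row_mult n a" "row_mult v b = \<alpha> powi (- (- 1)) * row_mult n b" "[\<delta> v = \<delta> n] (rmod P)"
    using lattice_scale by blast
  have v': "row_mult v a = \<beta> * ma / \<alpha>" "row_mult v b = - \<beta> * mb"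
    using v(1,2) unfolding na by (simp_all add: field_simps)
  \<comment> \<open>Here \<open>v\<close> is n N^-1, so n - v = m (N - I)^2 N^-1, and (N - I)^2 = d
    N by Cayley-Hamilton.\<close>
  have "l = n + - v"
    by (rule row_mult_inj[OF wedge_nonzero])
      (unfold row_mult_add row_mult_minus v' na la, simp_all add: \<beta>_def field_simps power2_eq_square)
  then have "[\<delta> l = \<delta> n + \<delta> (- v) + row_mult n b * row_mult (- v) a] (rmod P)"
    using delta_add[OF r_pos] by metis
  also have "[\<delta> n + \<delta> (- v) + row_mult n b * row_mult (- v) a = \<delta> n + (row_mult v b * row_mult v a - \<delta> n) + row_mult n b * row_mult (- v) a] (rmod P)"
    by (intro rcong_add rcong_refl rcong_trans[OF delta_minus[OF r_pos, of a b c v] rcong_diff[OF rcong_refl v(3)]])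
  also have "\<delta> n + (row_mult v b * row_mult v a - \<delta> n) + row_mult n b * row_mult (- v) a = - (\<beta> ^ 3 / \<alpha>\<^sup>2) * ma * mb"
    unfolding row_mult_minus v' na by (simp add: \<beta>_def field_simps power2_eq_square power3_eq_cube)
  finally have dl: "[\<delta> l = - (\<beta> ^ 3 / \<alpha>\<^sup>2) * ma * mb] (rmod P)" .
  have "[\<delta> (k + l) = \<delta> k + - (\<beta> ^ 3 / \<alpha>\<^sup>2) * ma * mb + kb * row_mult l a] (rmod P)"
    using rcong_trans[OF delta_add[OF r_pos, of a b c k l] rcong_add[OF rcong_add[OF rcong_refl dl] rcong_refl]]
    unfolding kb_def .
  then have "[\<alpha> * row_mult (k + l) a * row_mult (k + l) b / (1 - \<alpha>) + \<delta> (k + l)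
      = \<alpha> * row_mult (k + l) a * row_mult (k + l) b / (1 - \<alpha>) + (\<delta> k + - (\<beta> ^ 3 / \<alpha>\<^sup>2) * ma * mb + kb * row_mult l a)] (rmod P)"
    by simp
  \<comment> \<open>The right side is the wanted value minus two terms that vanish modulo
    \<open>P\<close>: the expression in \<open>D\<close> at \<open>k + l\<close>, and the commutator
    term of \<open>k\<close> and \<open>l\<close>.\<close>
  also have "\<alpha> * row_mult (k + l) a * row_mult (k + l) b / (1 - \<alpha>) + (\<delta> k + - (\<beta> ^ 3 / \<alpha>\<^sup>2) * ma * mb + kb * row_mult l a)
      = \<alpha> * ka * kb / (1 - \<alpha>) + \<delta> k
        - (\<alpha> * row_mult l a / \<beta> * row_mult (k + l) b + row_mult l b / \<beta> * row_mult (k + l) a)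
        - (row_mult k a * row_mult l b - row_mult k b * row_mult l a)"
  proof -
    define x where "x = \<beta> / \<alpha> * ma"
    define y where "y = \<beta> / \<alpha> * mb"
    have xy: "\<beta>\<^sup>2 / \<alpha> * ma = \<beta> * x" "\<beta>\<^sup>2 / \<alpha> * mb = \<beta> * y" "\<beta> ^ 3 / \<alpha>\<^sup>2 * ma * mb = \<beta> * x * y"
      by (simp_all add: x_def y_def power2_eq_square power3_eq_cube)
    have e: "1 - \<alpha> = - \<beta>" by (simp add: \<beta>_def)
    have m: "- (\<beta> ^ 3 / \<alpha>\<^sup>2) * ma * mb = - (\<beta> * x * y)" using xy(3) by simp
    show ?thesis
      unfolding row_mult_add la xy(1,2) m ka_def[symmetric] kb_def[symmetric] e using \<beta>(1) unfolding \<beta>(2)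
      by (simp add: field_simps)
  qed
  also have "[\<dots> = \<alpha> * ka * kb / (1 - \<alpha>) + \<delta> k - 0 - 0] (rmod P)"
    by (intro rcong_diff rcong_refl D cross_rcong_0)
  finally have "tcong P (shift_t \<alpha> a b (k + l) c t) (shift_t \<alpha> a b k c t)"
    unfolding shift_t_eq ka_def kb_def by (intro tcong_of_real) simp
  then show ?thesis
    unfolding shift_param_def case_prod_conv reduce_eq_iff l_def[symmetric] using C by blast
qed

lemma act_Zd2_reduce:
  assumes d: "of_int d = \<alpha> + 1 / \<alpha> - 2"
  shows "act_Zd2 \<alpha> r (Zd2_class d k) (reduce r (a, b, c, t)) = reduce r (shift_param \<alpha> k (a, b, c, t))"
proof -
  have "(\<lambda>k. act_Z2 \<alpha> r k (reduce r (a, b, c, t))) ` Zd2_class d k = {reduce r (shift_param \<alpha> k (a, b, c, t))}"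
  proof (intro subset_antisym subsetI)
    fix x assume "x \<in> (\<lambda>k. act_Z2 \<alpha> r k (reduce r (a, b, c, t))) ` Zd2_class d k"
    then show "x \<in> {reduce r (shift_param \<alpha> k (a, b, c, t))}"
      unfolding Zd2_class_def act_Z2_reduce using shift_param_mod_d[OF d] by auto
  next
    fix x assume "x \<in> {reduce r (shift_param \<alpha> k (a, b, c, t))}"
    moreover have "k \<in> Zd2_class d k"
      unfolding Zd2_class_def by (intro CollectI exI[of _ 0]) simp
    ultimately show "x \<in> (\<lambda>k. act_Z2 \<alpha> r k (reduce r (a, b, c, t))) ` Zd2_class d k"
      unfolding act_Z2_reduce by blast
  qed
  then show ?thesis by (simp add: act_Zd2_def)
qed

text \<open>Passing to other representatives multiplies generators by powers of
  \<open>g\<^sub>3\<close>, so the identity map is an equivalence.\<close>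

lemma surface_equiv_of_reduce_eq:
  assumes "(a, b, c', t') \<in> param_set \<alpha> r" "reduce r (a, b, c, t) = reduce r (a, b, c', t')"
  shows "surface_equiv \<alpha> r (a, b, c, t) (a, b, c', t')"
proof -
  interpret pr: inoue_pair \<alpha> r a b c t a b c' t'
    using assms(1) \<alpha>_gt_1 r_pos by unfold_locales
  have c': "[c$i = c'$i] (rmod P)" and "tcong P t t'" for i using assms(2) unfolding reduce_eq_iff by auto
  then obtain j where t': "t' = t + of_real P * of_int j" unfolding tcong_def by blast
  have *: "pr.corresponds 1 0 1 0 k k" for k
    using rcong_sym[OF delta_rcong[OF c']] by (simp add: pr.corresponds_def)
  have "\<exists>F F'. orbit_equivalence U_dom G pr.q.G F F'"
    by (rule pr.orbit_equivalence_of_parameters[where \<mu> = 1 and \<Lambda> = 1 and f = 0 and \<nu> = 0 and ?k0.0 = 0 and ?j0.0 = "- j"];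
        ((rule exI, rule *) | (simp add: t')))
  then show ?thesis by (simp add: surface_equiv_def)
qed

lemma full_action_reduce:
  fixes k :: "int^2" and K :: "int^2^2"
  assumes "\<mu> > 0" "\<rho> \<noteq> 0" "invertible K" and d: "of_int d = \<alpha> + 1 / \<alpha> - 2"
  defines "q \<equiv> GL_param K (shift_param \<alpha> k (scale_param \<mu> \<rho> (a, b, c, t)))"
  shows "full_action \<alpha> r ((\<mu>, \<rho>), K, Zd2_class d k) (reduce r (a, b, c, t)) = reduce r q"
    and "q \<in> param_set \<alpha> r" and "surface_equiv \<alpha> r (a, b, c, t) q"
proof -
  obtain a1 b1 c1 t1 where 1: "scale_param \<mu> \<rho> (a, b, c, t) = (a1, b1, c1, t1)" by (metis prod_cases4)
  interpret s1: inoue \<alpha> r a1 b1 c1 t1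
    using scale_param_mem[OF assms(1,2)] \<alpha>_gt_1 r_pos unfolding 1 by unfold_locales
  obtain a2 b2 c2 t2 where 2: "shift_param \<alpha> k (a1, b1, c1, t1) = (a2, b2, c2, t2)" by (metis prod_cases4)
  interpret s2: inoue \<alpha> r a2 b2 c2 t2
    using s1.shift_param_mem[of k] \<alpha>_gt_1 r_pos unfolding 2 by unfold_locales
  have q: "q = GL_param K (a2, b2, c2, t2)" by (simp add: q_def 1 2)
  show "full_action \<alpha> r ((\<mu>, \<rho>), K, Zd2_class d k) (reduce r (a, b, c, t)) = reduce r q"
    unfolding full_action_def case_prod_conv act_scale_reduce[OF assms(1,2)] 1 s1.act_Zd2_reduce[OF d] 2
      s2.act_GL_reduce[OF assms(3)] q ..
  show "q \<in> param_set \<alpha> r" unfolding q by (rule s2.GL_param_mem[OF assms(3)])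
  show "surface_equiv \<alpha> r (a, b, c, t) q"
    unfolding q
    by (rule surface_equiv_trans[OF surface_equiv_trans[OF scale_param_equiv[OF assms(1,2), unfolded 1]
          s1.shift_param_equiv[of k, unfolded 2]] s2.GL_param_equiv[OF assms(3)]])
qed

end

section \<open>Recovering the moves from an equivalence\<close>

context inoue_pair
begin

lemma reduce_eq_of_orbit_equivalence:
  assumes oe: "orbit_equivalence U_dom p.G q.G F F'"
  shows "\<exists>\<mu>>0. \<exists>\<rho>. \<rho> \<noteq> 0 \<and> (\<exists>K k. invertible K \<and>
    reduce r (a', b', c', t') = reduce r (GL_param K (shift_param \<alpha> k (scale_param \<mu> \<rho> (a, b, c, t)))))"
proof -
  obtain \<mu> \<nu> \<Lambda> f where \<mu>: "\<mu> > 0" and \<Lambda>: "\<Lambda> \<noteq> 0" and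
    c1: "\<And>k. \<exists>k'. corresponds \<mu> \<nu> \<Lambda> f k k'" and c2: "\<And>k'. \<exists>k. corresponds \<mu> \<nu> \<Lambda> f k k'" and
    c3: "\<exists>k j. (1 - \<alpha>) * \<nu> = \<alpha> * row_mult k a' \<and> (\<alpha> - 1) * f = \<mu> * row_mult k b' \<and>
      t' = of_real \<Lambda> * t - of_real (row_mult k b' * \<nu> + q.\<delta> k + q.P * of_int j)"
    by (rule orbit_equivalence_parameters[OF oe]) (rule that; assumption)
  define \<rho> where "\<rho> = \<Lambda> / \<mu>"
  have \<rho>: "\<rho> \<noteq> 0" "\<mu> * \<rho> = \<Lambda>" "\<rho> = \<Lambda> / \<mu>" using \<mu> \<Lambda> by (auto simp: \<rho>_def)
  \<comment> \<open>The target generators, pulled back to the source lattice, will give the rows of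
    \<open>K\<close>.\<close>
  have "\<exists>k. \<mu> * row_mult k a = a'$i \<and> \<rho> * row_mult k b = b'$i \<and> [\<Lambda> * p.\<delta> k + f * row_mult k a = \<nu> * b'$i + c'$i] (rmod q.P)" for i
    using c2[of "axis i 1"] \<mu> by (auto simp: corresponds_def \<rho>_def field_simps)
  then obtain Kf where Kf: "\<And>i. \<mu> * row_mult (Kf i) a = a'$i" "\<And>i. \<rho> * row_mult (Kf i) b = b'$i"
      "\<And>i. [\<Lambda> * p.\<delta> (Kf i) + f * row_mult (Kf i) a = \<nu> * b'$i + c'$i] (rmod q.P)" by metis
  define K where "K = (\<chi> i. Kf i)"
  have K: "\<mu> * row_mult (K$i) a = a'$i" "\<rho> * row_mult (K$i) b = b'$i"
      "[\<Lambda> * p.\<delta> (K$i) + f * row_mult (K$i) a = \<nu> * b'$i + c'$i] (rmod q.P)" for i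
    using Kf by (simp_all add: K_def)
  \<comment> \<open>Pushing the source generators forward will give the inverse of \<open>K\<close>
    over the integers.\<close>
  have "\<exists>k'. \<mu> * a$i = row_mult k' a' \<and> \<rho> * b$i = row_mult k' b'" for i
    using c1[of "axis i 1"] \<mu> by (auto simp: corresponds_def \<rho>_def field_simps)
  then obtain Kg where Kg: "\<And>i. \<mu> * a$i = row_mult (Kg i) a'" "\<And>i. \<rho> * b$i = row_mult (Kg i) b'" by metis
  define K' where "K' = (\<chi> i. Kg i)"
  have K': "row_mult (K'$i) a' = \<mu> * a$i" "row_mult (K'$i) b' = \<rho> * b$i" for i
    using Kg by (simp_all add: K'_def)
  have one: "(mat 1 :: int^2^2) $ i = axis i 1" for i by (simp add: mat_def axis_def vec_eq_iff)
  have "K ** K' = mat 1"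
  proof -
    have "(K ** K') $ i = axis i 1" for i
    proof (rule row_mult_inj[OF q.wedge_nonzero])
      have "row_mult ((K ** K') $ i) a' = \<mu> * row_mult (K$i) a" "row_mult ((K ** K') $ i) b' = \<rho> * row_mult (K$i) b"
        unfolding row_matrix_mult row_mult_vector_matrix K' by (simp_all add: row_mult_def algebra_simps)
      then show "row_mult ((K ** K') $ i) a' = row_mult (axis i 1) a'" "row_mult ((K ** K') $ i) b' = row_mult (axis i 1) b'"
        unfolding K by simp_all
    qed
    then show ?thesis by (simp add: vec_eq_iff[of "K ** K'"] one)
  qed
  moreover have "K' ** K = mat 1"
  proof -
    have "(K' ** K) $ i = axis i 1" for i
    proof (rule row_mult_inj[OF p.wedge_nonzero])
      have "\<mu> * row_mult ((K' ** K) $ i) a = row_mult (K'$i) a'" "\<rho> * row_mult ((K' ** K) $ i) b = row_mult (K'$i) b'"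
        unfolding row_matrix_mult row_mult_vector_matrix by (simp_all add: row_mult_def[of "K'$i"] flip: K(1,2)) (simp_all add: algebra_simps)
      then show "row_mult ((K' ** K) $ i) a = row_mult (axis i 1) a" "row_mult ((K' ** K) $ i) b = row_mult (axis i 1) b"
        unfolding K' using \<mu> \<rho>(1) by simp_all
    qed
    then show ?thesis by (simp add: vec_eq_iff[of "K' ** K"] one)
  qed
  ultimately have inv: "invertible K" unfolding invertible_def by blast
  obtain k0 j where k0: "(1 - \<alpha>) * \<nu> = \<alpha> * row_mult k0 a'" "(\<alpha> - 1) * f = \<mu> * row_mult k0 b'"
      "t' = of_real \<Lambda> * t - of_real (row_mult k0 b' * \<nu> + q.\<delta> k0 + q.P * of_int j)"
    using c3 by blast
  \<comment> \<open>\<open>k0\<close> refers to the target lattice, whereas the shift acts before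
    \<open>K\<close> and so on exponents of the source; \<open>l\<close> is the preimage of
    \<open>k0\<close> there.\<close>
  obtain l where l: "\<mu> * row_mult l a = row_mult k0 a'" "\<Lambda> * row_mult l b = \<mu> * row_mult k0 b'"
      "[\<Lambda> * p.\<delta> l + f * row_mult l a = \<nu> * row_mult k0 b' + q.\<delta> k0] (rmod q.P)"
    using c2 unfolding corresponds_def by blast
  define x where "x = row_mult k0 a'"
  define y where "y = row_mult k0 b'"
  define \<beta> where "\<beta> = \<alpha> - 1"
  have \<beta>: "\<beta> \<noteq> 0" "1 - \<alpha> = - \<beta>" "\<alpha> = \<beta> + 1" using p.\<alpha>_gt_1 by (auto simp: \<beta>_def)
  have \<nu>f: "\<nu> = - \<alpha> * x / \<beta>" "f = \<mu> * y / \<beta>"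
    using k0(1,2) \<beta>(1) unfolding \<beta>(2) x_def[symmetric] y_def[symmetric] \<beta>_def[symmetric]
    by (simp_all add: field_simps)
  have lx: "\<mu> * row_mult l a = x" "\<rho> * row_mult l b = y"
    using l \<mu> by (auto simp: x_def y_def \<rho>_def field_simps)
  have per: "period (\<mu> *\<^sub>R a) (\<rho> *\<^sub>R b) r = \<Lambda> * p.P" by (simp add: period_scale \<rho>(2))
  have KA: "real_matrix K *v (\<mu> *\<^sub>R a) = a'" "real_matrix K *v (\<rho> *\<^sub>R b) = b'"
    using K by (simp_all add: vec_eq_iff real_matrix_vector row_mult_scaleR)
  \<comment> \<open>\<open>K\<close> has determinant 1 or -1, so the target period is \<Lambda>
    times the source period up to sign, and the two congruences agree.\<close>
  have rc: "[u = v] (rmod \<Lambda> * p.P) \<longleftrightarrow> [u = v] (rmod q.P)" for u v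
    using rcong_period_matrix[OF inv, of u v "\<mu> *\<^sub>R a" "\<rho> *\<^sub>R b" r] unfolding KA per by simp
  \<comment> \<open>The sign is reversed because a shift by \<open>k\<close> gives the conjugate of
    \<open>g\<^sub>0\<close> the exponents \<open>- k\<close>, as in
    \<open>shift_param_equiv\<close>.\<close>
  let ?k = "- l"
  define c2 where "c2 = shift_c \<alpha> (\<mu> *\<^sub>R a) (\<rho> *\<^sub>R b) ?k ((\<mu> * \<rho>) *\<^sub>R c)"
  have C: "[c'$i = delta (\<mu> *\<^sub>R a) (\<rho> *\<^sub>R b) c2 (K$i)] (rmod q.P)" for i
  proof -
    have "delta (\<mu> *\<^sub>R a) (\<rho> *\<^sub>R b) c2 (K$i) = \<Lambda> * p.\<delta> (K$i) + \<alpha> * x / \<beta> * b'$i + y / \<beta> * a'$i"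
      unfolding c2_def delta_change_c[of _ _ "shift_c \<alpha> (\<mu> *\<^sub>R a) (\<rho> *\<^sub>R b) ?k ((\<mu> * \<rho>) *\<^sub>R c)" _ "(\<mu> * \<rho>) *\<^sub>R c"] row_mult_shift_c
        delta_scale row_mult_scaleR row_mult_minus mult_minus_right lx K \<beta>_def[symmetric]
      by (simp add: \<rho>(2))
    also have "\<dots> = \<Lambda> * p.\<delta> (K$i) + f * row_mult (K$i) a - \<nu> * b'$i"
      unfolding \<nu>f K(1)[symmetric] by simp
    finally show ?thesis
      using rcong_diff[OF K(3)[of i] rcong_refl[of "\<nu> * b'$i"]] by (simp add: rcong_sym_iff)
  qed
  have T: "tcong q.P t' (shift_t \<alpha> (\<mu> *\<^sub>R a) (\<rho> *\<^sub>R b) ?k ((\<mu> * \<rho>) *\<^sub>R c) (of_real (\<mu> * \<rho>) * t))"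
  proof -
    have "[\<Lambda> * p.\<delta> (- l) = \<Lambda> * (row_mult l b * row_mult l a - p.\<delta> l)] (rmod q.P)"
      unfolding rc[symmetric] by (rule rcong_mult_left[OF delta_minus[OF p.r_pos]])
    moreover have "\<Lambda> * (row_mult l b * row_mult l a - p.\<delta> l) = y * x - \<Lambda> * p.\<delta> l"
      unfolding lx[symmetric] \<rho>(2)[symmetric] by (simp add: algebra_simps)
    ultimately have 1: "[\<Lambda> * p.\<delta> (- l) = y * x - \<Lambda> * p.\<delta> l] (rmod q.P)" by simp
    have "[- (y * \<nu> + q.\<delta> k0 + q.P * of_int j) = - (y * \<nu> + q.\<delta> k0)] (rmod q.P)"
      unfolding rcong_altdef by (intro exI[of _ j]) (simp add: algebra_simps)
    also have "[- (y * \<nu> + q.\<delta> k0) = - (\<Lambda> * p.\<delta> l + f * row_mult l a)] (rmod q.P)"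
      using rcong_uminus[OF rcong_sym[OF l(3)]] by (simp add: y_def mult.commute)
    also have "- (\<Lambda> * p.\<delta> l + f * row_mult l a) = \<alpha> * x * y / (1 - \<alpha>) + (y * x - \<Lambda> * p.\<delta> l)"
    proof -
      have "f * row_mult l a = y / \<beta> * x" unfolding \<nu>f lx(1)[symmetric] by simp
      moreover have "\<alpha> * x * y / (1 - \<alpha>) + y * x = - (y / \<beta> * x)"
        unfolding \<beta>(2) using \<beta>(1) by (simp add: \<beta>(3) field_simps)
      ultimately show ?thesis by linarith
    qed
    also have "[\<dots> = \<alpha> * x * y / (1 - \<alpha>) + \<Lambda> * p.\<delta> (- l)] (rmod q.P)"
      by (rule rcong_add[OF rcong_refl rcong_sym[OF 1]])
    finally have "tcong q.P (of_real \<Lambda> * t + of_real (- (y * \<nu> + q.\<delta> k0 + q.P * of_int j)))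
        (of_real \<Lambda> * t + of_real (\<alpha> * x * y / (1 - \<alpha>) + \<Lambda> * p.\<delta> (- l)))"
      by (rule tcong_of_real)
    moreover have "t' = of_real \<Lambda> * t + of_real (- (y * \<nu> + q.\<delta> k0 + q.P * of_int j))"
      unfolding k0(3) y_def by simp
    moreover have "shift_t \<alpha> (\<mu> *\<^sub>R a) (\<rho> *\<^sub>R b) ?k ((\<mu> * \<rho>) *\<^sub>R c) (of_real (\<mu> * \<rho>) * t)
        = of_real \<Lambda> * t + of_real (\<alpha> * x * y / (1 - \<alpha>) + \<Lambda> * p.\<delta> (- l))"
      unfolding shift_t_eq delta_scale row_mult_scaleR row_mult_minus mult_minus_right lx unfolding \<rho>(2) by simp
    ultimately show ?thesis by metis
  qed
  have "reduce r (a', b', c', t') = reduce r (GL_param K (shift_param \<alpha> ?k (scale_param \<mu> \<rho> (a, b, c, t))))"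
    unfolding scale_param_def shift_param_def case_prod_conv GL_param_eq KA reduce_eq_iff c2_def[symmetric]
    using C T by simp
  with \<mu> \<rho>(1) inv show ?thesis by blast
qed

end

section \<open>The moduli space\<close>

text \<open>\<alpha> is a root of X^2 - \<theta> X + 1, so \<theta> = \<alpha> + 1 / \<alpha>. This
  also gives the uniqueness of \<theta> that the definite description calls for.\<close>

lemma S_plus_d_eq:
  assumes "S_plus_admissible \<alpha>" "\<alpha> > 1"
  shows "of_int (S_plus_d \<alpha>) = \<alpha> + 1 / \<alpha> - 2"
proof -
  have root: "of_int \<theta> = \<alpha> + 1 / \<alpha>" if "\<theta> \<ge> 3" "\<alpha> = S_plus_root \<theta>" for \<theta>
  proof -
    have "(of_int \<theta> :: real) \<ge> 3" using that(1) by simp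
    then have "(of_int \<theta> :: real)\<^sup>2 - 4 \<ge> 0" using power_mono[of 3 "of_int \<theta> :: real" 2] by simp
    then have "(sqrt ((of_int \<theta>)\<^sup>2 - 4))\<^sup>2 = (of_int \<theta> :: real)\<^sup>2 - 4" by simp
    moreover have "sqrt ((of_int \<theta>)\<^sup>2 - 4) = 2 * \<alpha> - of_int \<theta>"
      using that(2) by (simp add: S_plus_root_def)
    ultimately have "(2 * \<alpha> - of_int \<theta>)\<^sup>2 = (of_int \<theta>)\<^sup>2 - 4" by simp
    then have "of_int \<theta> * \<alpha> = \<alpha> * \<alpha> + 1" by (simp add: power2_eq_square algebra_simps)
    then show ?thesis using assms(2) by (simp add: field_simps)
  qed
  have "\<exists>!\<theta>. \<theta> \<ge> 3 \<and> \<alpha> = S_plus_root \<theta>"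
    using assms(1) root unfolding S_plus_admissible_def by (metis of_int_eq_iff)
  then have "S_plus_theta \<alpha> \<ge> 3 \<and> \<alpha> = S_plus_root (S_plus_theta \<alpha>)"
    unfolding S_plus_theta_def by (rule theI')
  then show ?thesis using root by (simp add: S_plus_d_def)
qed

lemma biholomorphic_iff_surface_equiv:
  assumes "\<alpha> > 1" "r > 0" "p \<in> param_set \<alpha> r" "q \<in> param_set \<alpha> r"
  shows "biholomorphic (inoue_surface \<alpha> r p) (inoue_surface \<alpha> r q) \<longleftrightarrow> surface_equiv \<alpha> r p q"
proof -
  obtain a b c t a' b' c' t' where pq: "p = (a, b, c, t)" "q = (a', b', c', t')" by (metis prod_cases4)
  interpret inoue_pair \<alpha> r a b c t a' b' c' t'
    using assms unfolding pq by unfold_locales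
  show ?thesis
    unfolding pq inoue_surface_def surface_equiv_def case_prod_conv
    using biholomorphic_of_orbit_equivalence orbit_equivalence_of_biholomorphic[OF simply_connected_U_dom] by blast
qed

lemma orbit_reduce:
  assumes "\<alpha> > 1" "S_plus_admissible \<alpha>" "r > 0" "p \<in> param_set \<alpha> r"
  shows "orbit (full_group \<alpha>) (full_action \<alpha> r) (reduce r p) = {reduce r q | q. q \<in> param_set \<alpha> r \<and> surface_equiv \<alpha> r p q}"
proof (intro subset_antisym subsetI)
  obtain a b c t where p: "p = (a, b, c, t)" by (metis prod_cases4)
  interpret inoue \<alpha> r a b c t using assms unfolding p by unfold_locales
  note d = S_plus_d_eq[OF assms(2,1)]
  {
    fix x assume "x \<in> orbit (full_group \<alpha>) (full_action \<alpha> r) (reduce r p)"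
    then obtain g where g: "g \<in> carrier (full_group \<alpha>)" "x = full_action \<alpha> r g (reduce r p)"
      unfolding orbit_def by blast
    then obtain \<mu> \<rho> K k where "g = ((\<mu>, \<rho>), K, Zd2_class (S_plus_d \<alpha>) k)" "\<mu> > 0" "\<rho> \<noteq> 0" "invertible K"
      unfolding full_group_def pos_real_group_def nonzero_real_group_def GL_Zd2_group_def DirProd_def by auto
    with g full_action_reduce[OF _ _ _ d] show "x \<in> {reduce r q | q. q \<in> param_set \<alpha> r \<and> surface_equiv \<alpha> r p q}"
      unfolding p by blast
  next
    fix x assume "x \<in> {reduce r q | q. q \<in> param_set \<alpha> r \<and> surface_equiv \<alpha> r p q}"
    then obtain q where q: "x = reduce r q" "q \<in> param_set \<alpha> r" "surface_equiv \<alpha> r p q" by blast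
    obtain a' b' c' t' where q': "q = (a', b', c', t')" by (metis prod_cases4)
    interpret pr: inoue_pair \<alpha> r a b c t a' b' c' t' using assms q unfolding p q' by unfold_locales
    obtain F F' where "orbit_equivalence U_dom G pr.q.G F F'"
      using q(3) unfolding p q' surface_equiv_def by auto
    then obtain \<mu> \<rho> K k where g: "\<mu> > 0" "\<rho> \<noteq> 0" "invertible K"
      "reduce r q = reduce r (GL_param K (shift_param \<alpha> k (scale_param \<mu> \<rho> (a, b, c, t))))"
      using pr.reduce_eq_of_orbit_equivalence unfolding q' by blast
    then have "x = full_action \<alpha> r ((\<mu>, \<rho>), K, Zd2_class (S_plus_d \<alpha>) k) (reduce r p)"
      using full_action_reduce(1)[OF g(1-3) d] q(1) unfolding p by simp
    moreover have "((\<mu>, \<rho>), K, Zd2_class (S_plus_d \<alpha>) k) \<in> carrier (full_group \<alpha>)"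
      using g unfolding full_group_def pos_real_group_def nonzero_real_group_def GL_Zd2_group_def DirProd_def by auto
    ultimately show "x \<in> orbit (full_group \<alpha>) (full_action \<alpha> r) (reduce r p)"
      unfolding orbit_def by blast
  }
qed

lemma orbit_eq_iff:
  assumes "\<alpha> > 1" "S_plus_admissible \<alpha>" "r > 0" "p \<in> param_set \<alpha> r" "q \<in> param_set \<alpha> r"
  shows "orbit (full_group \<alpha>) (full_action \<alpha> r) (reduce r p) = orbit (full_group \<alpha>) (full_action \<alpha> r) (reduce r q)
    \<longleftrightarrow> surface_equiv \<alpha> r p q"
proof
  assume "orbit (full_group \<alpha>) (full_action \<alpha> r) (reduce r p) = orbit (full_group \<alpha>) (full_action \<alpha> r) (reduce r q)"
  then have "reduce r q \<in> {reduce r q | q. q \<in> param_set \<alpha> r \<and> surface_equiv \<alpha> r p q}"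
    unfolding orbit_reduce[OF assms(1-4)] orbit_reduce[OF assms(1-3,5)] using assms(5) surface_equiv_refl by blast
  \<comment> \<open>Equality of orbits only says that \<open>reduce r q\<close> is the reduction of
    some \<open>s\<close> equivalent to \<open>p\<close>. That \<open>q\<close> is equivalent to
    \<open>s\<close> is the content of \<open>surface_equiv_of_reduce_eq\<close>.\<close>
  then obtain s where s: "reduce r q = reduce r s" "s \<in> param_set \<alpha> r" "surface_equiv \<alpha> r p s" by blast
  obtain a b c t where q: "q = (a, b, c, t)" by (metis prod_cases4)
  obtain c' t' where s': "s = (a, b, c', t')"
    using s(1) unfolding q by (cases s) (auto simp: reduce_def)
  interpret inoue \<alpha> r a b c t using assms unfolding q by unfold_locales
  have "surface_equiv \<alpha> r q s"
    using surface_equiv_of_reduce_eq s(1,2) unfolding q s' by blast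
  then show "surface_equiv \<alpha> r p q" using s(3) surface_equiv_sym surface_equiv_trans by blast
next
  assume "surface_equiv \<alpha> r p q"
  then have "surface_equiv \<alpha> r p s \<longleftrightarrow> surface_equiv \<alpha> r q s" for s
    using surface_equiv_sym surface_equiv_trans by blast
  then show "orbit (full_group \<alpha>) (full_action \<alpha> r) (reduce r p) = orbit (full_group \<alpha>) (full_action \<alpha> r) (reduce r q)"
    unfolding orbit_reduce[OF assms(1-4)] orbit_reduce[OF assms(1-3,5)] by simp
qed

theorem theorem4p27:
  fixes \<alpha> :: real and r :: nat
  assumes "\<alpha> > 1" and "S_plus_admissible \<alpha>" and "r \<ge> 1"
  shows "\<exists>\<Phi>. bij_betw \<Phi> (inoue_surfaces \<alpha> r // biholomorphic_rel \<alpha> r) (moduli_quotient \<alpha> r) \<and>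
    (\<forall>p \<in> param_set \<alpha> r.
       \<Phi> (biholomorphic_rel \<alpha> r `` {inoue_surface \<alpha> r p}) =
         orbit (full_group \<alpha>) (full_action \<alpha> r) (reduce r p))"
proof -
  let ?O = "\<lambda>p. orbit (full_group \<alpha>) (full_action \<alpha> r) (reduce r p)"
  let ?C = "\<lambda>p. biholomorphic_rel \<alpha> r `` {inoue_surface \<alpha> r p}"
  have r: "r > 0" using assms(3) by simp
  have O: "?O p = ?O q \<longleftrightarrow> surface_equiv \<alpha> r p q" if "p \<in> param_set \<alpha> r" "q \<in> param_set \<alpha> r" for p q
    using orbit_eq_iff[OF assms(1,2) r that] .
  have C: "inoue_surface \<alpha> r q \<in> ?C p \<longleftrightarrow> surface_equiv \<alpha> r p q" if "p \<in> param_set \<alpha> r" "q \<in> param_set \<alpha> r" for p q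
    using that biholomorphic_iff_surface_equiv[OF assms(1) r that]
    unfolding biholomorphic_rel_def inoue_surfaces_def by (simp add: Image_singleton_iff)
  have C_sub: "?C p \<subseteq> inoue_surface \<alpha> r ` param_set \<alpha> r" for p
    unfolding biholomorphic_rel_def inoue_surfaces_def by blast
  \<comment> \<open>Different parameters can give the same surface, so \<Phi> picks a parameter of
    some surface in the class. By \<open>O\<close> and \<open>C\<close> the orbit does not depend on
    the choice.\<close>
  define \<Phi> where "\<Phi> X = ?O (SOME p. p \<in> param_set \<alpha> r \<and> inoue_surface \<alpha> r p \<in> X)" for X
  have \<Phi>: "\<Phi> (?C p) = ?O p" if p: "p \<in> param_set \<alpha> r" for p
  proof -
    have "\<exists>q. q \<in> param_set \<alpha> r \<and> inoue_surface \<alpha> r q \<in> ?C p"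
      using p C[OF p p] surface_equiv_refl by blast
    from someI_ex[OF this] obtain q where q: "q \<in> param_set \<alpha> r" "inoue_surface \<alpha> r q \<in> ?C p" "\<Phi> (?C p) = ?O q"
      unfolding \<Phi>_def by blast
    then show ?thesis using C[OF p q(1)] O[OF p q(1)] by simp
  qed
  have quot: "inoue_surfaces \<alpha> r // biholomorphic_rel \<alpha> r = ?C ` param_set \<alpha> r"
    unfolding quotient_def inoue_surfaces_def by auto
  have "bij_betw \<Phi> (?C ` param_set \<alpha> r) (moduli_quotient \<alpha> r)"
  proof (rule bij_betw_imageI)
    show "inj_on \<Phi> (?C ` param_set \<alpha> r)"
    proof (rule inj_onI, elim imageE)
      fix X Y p q assume eq: "\<Phi> X = \<Phi> Y" and X: "X = ?C p" and p: "p \<in> param_set \<alpha> r" and Y: "Y = ?C q" and q: "q \<in> param_set \<alpha> r"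
      have "?O p = ?O q" using eq \<Phi>[OF p] \<Phi>[OF q] unfolding X Y by (simp only:)
      then have e: "surface_equiv \<alpha> r p q" using O[OF p q] by blast
      have "inoue_surface \<alpha> r s \<in> X \<longleftrightarrow> inoue_surface \<alpha> r s \<in> Y" if "s \<in> param_set \<alpha> r" for s
        unfolding X Y C[OF p that] C[OF q that] using e surface_equiv_sym surface_equiv_trans by blast
      then show "X = Y" using C_sub unfolding X Y by blast
    qed
    show "\<Phi> ` ?C ` param_set \<alpha> r = moduli_quotient \<alpha> r"
    proof -
      have "\<Phi> ` ?C ` param_set \<alpha> r = ?O ` param_set \<alpha> r"
        unfolding image_image by (rule image_cong[OF refl \<Phi>])
      also have "\<dots> = moduli_quotient \<alpha> r"
        unfolding moduli_quotient_def orbits_def reduced_set_def by blast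
      finally show ?thesis .
    qed
  qed
  then show ?thesis using \<Phi> unfolding quot by blast
qed

end
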